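(* Let $B$ be a set, $Q_B$ the free abelian group with $\mathbb{Z}$-basis $B$, $\mathcal{N}:B\times B\to\mathbb{C}$ a symmetric function (extended biadditively to $Q_B$), $\Delta(\alpha,\beta)=\mathcal{N}(\alpha,\beta)+\mathbb{Z}$, and $\eta:Q_B\times Q_B\to\mathbb{C}^\times$ a bimultiplicative function with $\eta(\alpha,\alpha)=e^{-\pi i\mathcal{N}(\alpha,\alpha)}$ for all $\alpha\in Q_B$. Let $F=F(B,\mathcal{N},\eta)$ be the $Q_B\times\mathbb{C}$-graded left $A$-module constructed in the context. Then for every $a\in B$ the formal series $a(z)=\sum_{n\in\mathbb{C}}a(n)z^{-n-1}\in\mathrm{End}(F)[[z,z^{\mathbb{C}}]]$ is a field on $F$.
   Context: All vector spaces are over a field $\mathbf{k}\supseteq\mathbb{C}$; $\mathbb{Z}_+$ is the set of non-negative integers. Fields. $U[[z,z^{\mathbb{C}}]]$ is the space of formal series $\sum_{n\in\mathbb{C}}f(n)z^n$ with $f(n)\in U$; for a coset $\Gamma\in\mathbb{C}/\mathbb{Z}$, $U[[z]]z^\Gamma$ is the space of finite sums of $\psi(z)z^d$ with $d\in\Gamma$, $\psi\in U[[z]]$. Given a vector space graded by an abelian group $Q$, $V=\bigoplus_{\alpha\in Q}V^\alpha$, and a symmetric biadditive $\Delta:Q\times Q\to\mathbb{C}/\mathbb{Z}$, a field of charge $\alpha$ is a series $a(z)\in\mathrm{End}(V)[[z,z^{\mathbb{C}}]]$ with $a(z)b\in V^{\alpha+\beta}[[z]]z^{-\Delta(\alpha,\beta)}$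 for all $b\in V^\beta$. Here $V=F$, $Q=Q_B$, $F^\alpha=F(\alpha)=\bigoplus_{d\in\mathbb{C}}F(\alpha,d)$, and $a(z)$ has charge $a\in B\subset Q_B$. Construction of $F$. Let $A$ be the free associative unital $\mathbf{k}$-algebra on the symbols $a(n)$ ($a\in B$, $n\in\mathbb{C}$), with unit denoted $|0\rangle$. It is graded by $Q_B\times\mathbb{C}$, $A=\bigoplus A(\alpha,d)$, with $a_1(n_1)\cdots a_m(n_m)$ of degree $(a_1+\cdots+a_m,\ \sum_i(-n_i-1))$. Put $\mathrm{F}_pA=\bigoplus_{\alpha\in Q_B,\ \mathrm{Re}(d)\le p}A(\alpha,d)$ ($p\in\mathbb{Z}$), $\mathrm{I}_n(A(\alpha,d))=A(\alpha,d)\cap(A\cdot\mathrm{F}_{-n-1}A)$ ($n\in\mathbb{Z}_+$), $\hat A(\alpha,d)=\varprojlim_nA(\alpha,d)/\mathrm{I}_n(A(\alpha,d))$ and $\hat A=\bigoplus_{\alpha,d}\hat A(\alpha,d)$; the product extends continuously to $\hat A$. For $a,b\in B$, $s,t\in\mathbb{C}$ and $N=\mathcal{N}(a,b)$ let $l(a,b,s,t)=\sum_{j\ge0}(-1)^j\binom Nj\bigl(a(s+N-j)b(t+j)-\eta(a,b)e^{\pi iN}b(t+N-j)a(s+j)\bigr)\in\hat A$. Let $I$ be the two-sided ideal of $\hat A$ generated by all $l(a,b,s,t)$, and $J$ the left ideal of $\hat A$ generated by all $a(n)$ with $a\in B$, $n\in\mathbb{C}\setminus\mathbb{Z}_{<0}$,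 and all $a_1(n_1)\cdots a_m(n_m)$ with $m\ge2$, $a_i\in B$, $n_i\in\mathbb{C}$, $n_1\notin\mathcal{N}(a_1,\sum_{i=2}^ma_i)+\mathbb{Z}$. Let $\hat I,\hat J$ be their componentwise closures (the sum over $(\alpha,d)$ of the closures of the homogeneous components in $\hat A(\alpha,d)$), and $F=\hat A/(\hat I+\hat J)$, with the induced grading $F=\bigoplus F(\alpha,d)$; left multiplication makes $F$ a left $A$-module, so each $a(n)$ acts on $F$. *)

theory Defs
  imports
    Complex_Main
    "HOL-Library.Poly_Mapping"
    "HOL-Library.Product_Plus"
    "HOL-Library.Set_Algebras"
    "HOL-Analysis.Elementary_Topology"
    "HOL-Algebra.Module"
    "HOL-Algebra.Algebraic_Closure_Type"
begin

section \<open>Fields on a graded vector space\<close>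

definition vs_endos :: "('k, 'r) ring_scheme \<Rightarrow> ('k, 'v, 'm) module_scheme \<Rightarrow> ('v \<Rightarrow> 'v) set" where
  "vs_endos R V = {f \<in> carrier V \<rightarrow> carrier V.
     (\<forall>x \<in> carrier V. \<forall>y \<in> carrier V. f (x \<oplus>\<^bsub>V\<^esub> y) = f x \<oplus>\<^bsub>V\<^esub> f y) \<and>
     (\<forall>c \<in> carrier R. \<forall>x \<in> carrier V. f (c \<odot>\<^bsub>V\<^esub> x) = c \<odot>\<^bsub>V\<^esub> f x)}"

definition graded_vs ::
    "('k, 'r) ring_scheme \<Rightarrow> ('k, 'v, 'm) module_scheme \<Rightarrow> ('q \<Rightarrow> 'v set) \<Rightarrow> bool" where
  "graded_vs R V G \<longleftrightarrow>
     Ring.field R \<and> Module.module R V \<and> (\<forall>\<alpha>. submodule (G \<alpha>) R V) \<and>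
     (\<forall>v \<in> carrier V. \<exists>!g. (\<forall>\<alpha>. g \<alpha> \<in> G \<alpha>) \<and> finite {\<alpha>. g \<alpha> \<noteq> \<zero>\<^bsub>V\<^esub>} \<and>
        v = finsum V g {\<alpha>. g \<alpha> \<noteq> \<zero>\<^bsub>V\<^esub>})"

text \<open>
  A formal series \<open>\<Sum>\<^sub>e \<phi>(e) z\<^sup>e\<close> with complex exponents is the function \<open>\<phi>\<close>, and an element
  of \<open>\<complex>/\<int>\<close> is a coset, i.e. a set of complex numbers. The set \<open>shifted_series V U \<Gamma>\<close> is
  \<open>U[[z]]z\<^sup>\<Gamma>\<close>: the finite sums of \<open>\<psi>\<^sub>d(z) z\<^sup>d\<close> with \<open>d \<in> \<Gamma>\<close> and \<open>\<psi>\<^sub>d \<in> U[[z]]\<close>.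
\<close>

definition shifted_series ::
    "('k, 'v, 'm) module_scheme \<Rightarrow> 'v set \<Rightarrow> complex set \<Rightarrow> (complex \<Rightarrow> 'v) set" where
  "shifted_series V U \<Gamma> = {\<phi>. \<exists>D \<psi>. finite D \<and> D \<subseteq> \<Gamma> \<and> (\<forall>d \<in> D. \<forall>j :: nat. \<psi> d j \<in> U) \<and>
     (\<forall>e. \<phi> e = finsum V (\<lambda>(d, j). \<psi> d j) {(d, j). d \<in> D \<and> d + of_nat j = e})}"

definition is_field_of_charge ::
    "('k, 'r) ring_scheme \<Rightarrow> ('k, 'v, 'm) module_scheme \<Rightarrow> ('q::ab_group_add \<Rightarrow> 'v set) \<Rightarrow>
     ('q \<Rightarrow> 'q \<Rightarrow> complex set) \<Rightarrow> 'q \<Rightarrow> (complex \<Rightarrow> 'v \<Rightarrow> 'v) \<Rightarrow> bool" where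
  "is_field_of_charge R V G \<Delta> \<alpha> f \<longleftrightarrow>
     graded_vs R V G \<and> (\<forall>e. f e \<in> vs_endos R V) \<and>
     (\<forall>\<beta>. \<forall>b \<in> G \<beta>. (\<lambda>e. f e b) \<in> shifted_series V (G (\<alpha> + \<beta>)) (uminus ` \<Delta> \<alpha> \<beta>))"


section \<open>The free algebra\<close>

text \<open>
  The free algebra is the monoid algebra of the free monoid of words in the letters \<open>a(n)\<close>, where
  \<open>a(n)\<close> is encoded as the pair \<open>(a, n)\<close>; the convolution product of
  \<^theory>\<open>HOL-Library.Poly_Mapping\<close> is written for an additive monoid of exponents, hence the
  following instance.
\<close>

instantiation list :: (type) monoid_add
begin
definition zero_list :: "'a list" where "zero_list = []"
definition plus_list :: "'a list \<Rightarrow> 'a list \<Rightarrow> 'a list" where "plus_list = (@)"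
instance by standard (auto simp: zero_list_def plus_list_def)
end

type_synonym ('b, 'k) falg = "('b \<times> complex) list \<Rightarrow>\<^sub>0 'k"

text \<open>The set \<open>B\<close> is the type \<open>'b\<close>, and \<open>Q\<^sub>B\<close> is the free abelian group on it.\<close>

type_synonym 'b charge = "'b \<Rightarrow>\<^sub>0 int"

abbreviation bas :: "'b \<Rightarrow> 'b charge" where
  "bas a \<equiv> Poly_Mapping.single a 1"

definition monomial :: "('b \<times> complex) list \<Rightarrow> ('b, 'k::field) falg" where
  "monomial w = Poly_Mapping.single w 1"

definition gen :: "'b \<Rightarrow> complex \<Rightarrow> ('b, 'k::field) falg" where
  "gen a n = monomial [(a, n)]"

definition scal :: "'k::field \<Rightarrow> ('b, 'k) falg" where
  "scal c = Poly_Mapping.single 0 c"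

definition word_charge :: "('b \<times> complex) list \<Rightarrow> 'b charge" where
  "word_charge w = (\<Sum>(a, n)\<leftarrow>w. bas a)"

definition word_deg :: "('b \<times> complex) list \<Rightarrow> 'b charge \<times> complex" where
  "word_deg w = (word_charge w, \<Sum>(a, n)\<leftarrow>w. - n - 1)"

definition acomp :: "'b charge \<times> complex \<Rightarrow> ('b, 'k::field) falg set" where
  "acomp i = {u. \<forall>w \<in> Poly_Mapping.keys u. word_deg w = i}"

definition apart :: "'b charge \<times> complex \<Rightarrow> ('b, 'k::field) falg \<Rightarrow> ('b, 'k) falg" where
  "apart i u = (\<Sum>w | w \<in> Poly_Mapping.keys u \<and> word_deg w = i.
     Poly_Mapping.single w (Poly_Mapping.lookup u w))"

definition afilt :: "int \<Rightarrow> ('b, 'k::field) falg set" where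
  "afilt p = {u. \<forall>w \<in> Poly_Mapping.keys u. Re (snd (word_deg w)) \<le> of_int p}"

definition left_ideal :: "'r::ring_1 set \<Rightarrow> bool" where
  "left_ideal L \<longleftrightarrow> 0 \<in> L \<and> (\<forall>x \<in> L. \<forall>y \<in> L. x + y \<in> L) \<and> (\<forall>r. \<forall>x \<in> L. r * x \<in> L)"

definition two_sided_ideal :: "'r::ring_1 set \<Rightarrow> bool" where
  "two_sided_ideal L \<longleftrightarrow> left_ideal L \<and> (\<forall>r. \<forall>x \<in> L. x * r \<in> L)"

text \<open>
  The product \<open>A \<cdot> F\<^sub>p A\<close> consists of the finite sums of products, i.e. it is the
  left ideal generated by \<open>F\<^sub>p A\<close>.
\<close>

definition aI :: "nat \<Rightarrow> 'b charge \<times> complex \<Rightarrow> ('b, 'k::field) falg set" where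
  "aI n i = acomp i \<inter> (left_ideal hull afilt (- int n - 1))"

text \<open>Degrees \<open>i = (\<alpha>, d)\<close> are treated as atomic in the proofs.\<close>

declare split_paired_All [simp del] split_paired_Ex [simp del]

lemma left_ideal_hull: "left_ideal (left_ideal hull S)"
  unfolding left_ideal_def hull_def by auto

lemma hull_0: "0 \<in> left_ideal hull S"
  and hull_add: "x \<in> left_ideal hull S \<Longrightarrow> y \<in> left_ideal hull S \<Longrightarrow> x + y \<in> left_ideal hull S"
  and hull_lmult: "x \<in> left_ideal hull S \<Longrightarrow> r * x \<in> left_ideal hull S"
  using left_ideal_hull[of S] unfolding left_ideal_def by blast+

lemma hull_minus: "x \<in> left_ideal hull S \<Longrightarrow> - x \<in> left_ideal hull S"
  using hull_lmult[of x S "- 1"] by simp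

lemma hull_diff: "x \<in> left_ideal hull S \<Longrightarrow> y \<in> left_ideal hull S \<Longrightarrow> x - y \<in> left_ideal hull S"
  using hull_add[of x S "- y"] hull_minus[of y S] by simp

lemma word_deg_plus: "word_deg (v + w) = word_deg v + word_deg w"
  by (simp add: word_deg_def word_charge_def plus_list_def)

lemma word_deg_zero: "word_deg 0 = 0"
  by (simp add: word_deg_def word_charge_def zero_list_def zero_prod_def)

lemma acomp_0: "0 \<in> acomp i"
  by (simp add: acomp_def)

lemma acomp_add: "u \<in> acomp i \<Longrightarrow> v \<in> acomp i \<Longrightarrow> u + v \<in> acomp i"
  using Poly_Mapping.keys_add[of u v] by (auto simp: acomp_def)

lemma acomp_minus: "u \<in> acomp i \<Longrightarrow> - u \<in> acomp i"
  by (auto simp: acomp_def)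

lemma acomp_mult: "u \<in> acomp i \<Longrightarrow> v \<in> acomp j \<Longrightarrow> u * v \<in> acomp (i + j)"
  using Poly_Mapping.keys_mult[of u v] by (fastforce simp: acomp_def word_deg_plus)

lemma acomp_1: "1 \<in> acomp 0"
  by (simp add: acomp_def word_deg_zero)

lemma aI_0: "0 \<in> aI n i"
  by (simp add: aI_def acomp_0 hull_0)

lemma aI_add: "u \<in> aI n i \<Longrightarrow> v \<in> aI n i \<Longrightarrow> u + v \<in> aI n i"
  by (simp add: aI_def acomp_add hull_add)

lemma aI_minus: "u \<in> aI n i \<Longrightarrow> - u \<in> aI n i"
  by (simp add: aI_def acomp_minus hull_minus)

lemma aI_diff: "u \<in> aI n i \<Longrightarrow> v \<in> aI n i \<Longrightarrow> u - v \<in> aI n i"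
  using aI_add[of u n i "- v"] aI_minus[of v n i] by simp

lemma aI_sum: "(\<And>s. s \<in> S \<Longrightarrow> f s \<in> aI n i) \<Longrightarrow> sum f S \<in> aI n i"
  by (induction S rule: infinite_finite_induct) (auto simp: aI_0 aI_add)

lemma acomp_sum: "(\<And>s. s \<in> S \<Longrightarrow> f s \<in> acomp i) \<Longrightarrow> sum f S \<in> acomp i"
  by (induction S rule: infinite_finite_induct) (auto simp: acomp_0 acomp_add)

lemma aI_acomp: "u \<in> aI n i \<Longrightarrow> u \<in> acomp i"
  by (simp add: aI_def)

lemma aI_antimono: "m \<le> n \<Longrightarrow> aI n i \<subseteq> aI m i"
proof -
  assume "m \<le> n"
  then have "afilt (- int n - 1) \<subseteq> (afilt (- int m - 1) :: ('a, 'b) falg set)"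
    by (fastforce simp: afilt_def)
  then show ?thesis
    using hull_mono unfolding aI_def by blast
qed

lemma aI_lmult: "u \<in> acomp j \<Longrightarrow> v \<in> aI n i \<Longrightarrow> u * v \<in> aI n (j + i)"
  by (simp add: aI_def acomp_mult hull_lmult)

definition shift :: "'b charge \<times> complex \<Rightarrow> nat" where
  "shift i = nat \<lceil>Re (snd i)\<rceil>"

lemma shift_add: "shift (i + j) \<le> shift i + shift j"
  unfolding shift_def using ceiling_add_le[of "Re (snd i)" "Re (snd j)"] by simp linarith

lemma aI_rmult:
  assumes "u \<in> aI m j" "v \<in> acomp i" "m \<ge> n + shift i"
  shows "u * v \<in> aI n (j + i)"
proof -
  let ?L = "left_ideal hull afilt (- int n - 1) :: ('a, 'b) falg set"
  let ?M = "{x. x * v \<in> ?L}"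
  have "left_ideal ?M"
    using left_ideal_hull[of "afilt (- int n - 1) :: ('a, 'b) falg set"]
    by (auto simp: left_ideal_def distrib_right mult.assoc)
  moreover have "afilt (- int m - 1) \<subseteq> ?M"
  proof
    fix x :: "('a, 'b) falg" assume x: "x \<in> afilt (- int m - 1)"
    have "x * v \<in> afilt (- int n - 1)"
      unfolding afilt_def
    proof (intro CollectI ballI)
      fix w assume "w \<in> Poly_Mapping.keys (x * v)"
      then obtain p q where pq: "w = p + q" "p \<in> Poly_Mapping.keys x" "q \<in> Poly_Mapping.keys v"
        using Poly_Mapping.keys_mult[of x v] by auto
      have 1: "Re (snd (word_deg p)) \<le> - real m - 1"
        using x pq by (auto simp: afilt_def)
      have 2: "word_deg q = i" using assms(2) pq by (auto simp: acomp_def)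
      have 3: "Re (snd i) \<le> real (shift i)" unfolding shift_def by linarith
      show "Re (snd (word_deg w)) \<le> real_of_int (- int n - 1)"
        using 1 2 3 assms(3) by (simp add: pq(1) word_deg_plus)
    qed
    then show "x \<in> ?M" using hull_subset[of "afilt (- int n - 1)" left_ideal] by blast
  qed
  ultimately have "left_ideal hull afilt (- int m - 1) \<subseteq> ?M" by (simp add: hull_minimal)
  then show ?thesis using assms acomp_mult[of u j v i] by (auto simp: aI_def)
qed

lemma apart_acomp: "apart i u \<in> acomp i"
  unfolding apart_def by (rule acomp_sum) (auto simp: acomp_def)


section \<open>The completion\<close>

text \<open>
  An element of the completion \<open>\<Oplus>\<^sub>i A^\<^sub>i\<close>, where \<open>i = (\<alpha>, d)\<close>, is given by a compatible family of cosets
  \<open>x i n \<in> A\<^sub>i / I\<^sub>n(A\<^sub>i)\<close> that vanishes for all but finitely many \<open>i\<close>.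
\<close>

typedef (overloaded) ('b, 'k::field) ahat =
  "{x :: 'b charge \<times> complex \<Rightarrow> nat \<Rightarrow> ('b, 'k) falg set.
     (\<forall>i n. \<exists>u \<in> acomp i. x i n = u +o aI n i) \<and>
     (\<forall>i n. x i (Suc n) \<subseteq> x i n) \<and>
     finite {i. \<exists>n. x i n \<noteq> aI n i}}"
  morphisms coset_at Abs_ahat
proof -
  have "aI n i = 0 +o aI n i" for n and i :: "'b charge \<times> complex" by (simp add: elt_set_plus_def)
  then have "\<exists>u \<in> acomp i. aI n i = u +o aI n i" for n and i :: "'b charge \<times> complex"
    using acomp_0 by blast
  moreover have "aI (Suc n) i \<subseteq> aI n i" for n and i :: "'b charge \<times> complex"
    by (rule aI_antimono) simp
  ultimately show ?thesis by (intro exI[of _ "\<lambda>i n. aI n i"] CollectI conjI allI) simp_all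
qed

definition rep_at :: "('b, 'k::field) ahat \<Rightarrow> 'b charge \<times> complex \<Rightarrow> nat \<Rightarrow> ('b, 'k) falg" where
  "rep_at x i n = (SOME u. u \<in> coset_at x i n)"

definition mk_ahat :: "('b charge \<times> complex \<Rightarrow> nat \<Rightarrow> ('b, 'k::field) falg) \<Rightarrow> ('b, 'k) ahat" where
  "mk_ahat r = Abs_ahat (\<lambda>i n. r i n +o aI n i)"

definition asupp :: "('b, 'k::field) ahat \<Rightarrow> ('b charge \<times> complex) set" where
  "asupp x = {i. \<exists>n. coset_at x i n \<noteq> aI n i}"

definition of_falg :: "('b, 'k::field) falg \<Rightarrow> ('b, 'k) ahat" where
  "of_falg u = mk_ahat (\<lambda>i n. apart i u)"

definition hpart :: "'b charge \<times> complex \<Rightarrow> ('b, 'k::field) ahat \<Rightarrow> ('b, 'k) ahat" where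
  "hpart i x = mk_ahat (\<lambda>j n. if j = i then rep_at x i n else 0)"

definition hcomp :: "'b charge \<times> complex \<Rightarrow> ('b, 'k::field) ahat set" where
  "hcomp i = {x. asupp x \<subseteq> {i}}"

definition coherent :: "('b charge \<times> complex \<Rightarrow> nat \<Rightarrow> ('b, 'k::field) falg) \<Rightarrow> bool" where
  "coherent r \<longleftrightarrow> (\<forall>i n. r i n \<in> acomp i) \<and> (\<forall>i n. r i (Suc n) - r i n \<in> aI n i) \<and>
     finite {i. \<exists>n. r i n \<notin> aI n i}"

lemma self_in_coset: "u \<in> u +o aI n i"
  using aI_0[of n i] set_plus_intro2[of 0 "aI n i" u] by simp

lemma coset_eq_iff: "u +o aI n i = v +o aI n i \<longleftrightarrow> u - v \<in> aI n i"
proof (rule iffI)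
  assume "u +o aI n i = v +o aI n i"
  moreover have "u \<in> u +o aI n i" by (rule self_in_coset)
  ultimately show "u - v \<in> aI n i" by (auto simp: elt_set_plus_def)
next
  assume a: "u - v \<in> aI n i"
  show "u +o aI n i = v +o aI n i"
  proof (intro equalityI subsetI)
    fix x assume "x \<in> u +o aI n i"
    then obtain c where "c \<in> aI n i" "x = u + c" by (auto simp: elt_set_plus_def)
    then show "x \<in> v +o aI n i" using aI_add[OF a, of c]
      by (auto simp: elt_set_plus_def intro!: bexI[of _ "(u - v) + c"])
  next
    fix x assume "x \<in> v +o aI n i"
    then obtain c where "c \<in> aI n i" "x = v + c" by (auto simp: elt_set_plus_def)
    then show "x \<in> u +o aI n i" using aI_diff[of c n i "u - v"] a
      by (auto simp: elt_set_plus_def intro!: bexI[of _ "c - (u - v)"])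
  qed
qed

lemma coset_zero_iff: "u +o aI n i = aI n i \<longleftrightarrow> u \<in> aI n i"
  using coset_eq_iff[of u n i 0] by (simp add: elt_set_plus_def)

lemma coset_at_mk: "coherent r \<Longrightarrow> coset_at (mk_ahat r) i n = r i n +o aI n i"
  unfolding mk_ahat_def
proof (subst Abs_ahat_inverse)
  assume r: "coherent r"
  have "r i (Suc n) +o aI (Suc n) i \<subseteq> r i n +o aI n i" for i n
  proof -
    have "r i (Suc n) +o aI (Suc n) i \<subseteq> r i (Suc n) +o aI n i"
      using aI_antimono[of n "Suc n" i] by (auto simp: elt_set_plus_def)
    also have "\<dots> = r i n +o aI n i" using r by (simp add: coset_eq_iff coherent_def)
    finally show ?thesis .
  qed
  then show "(\<lambda>i n. r i n +o aI n i)
    \<in> {x. (\<forall>i n. \<exists>u\<in>acomp i. x i n = u +o aI n i) \<and>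
           (\<forall>i n. x i (Suc n) \<subseteq> x i n) \<and> finite {i. \<exists>n. x i n \<noteq> aI n i}}"
    using r by (auto simp: coherent_def coset_zero_iff)
qed simp

lemma coset_at_rep: "coset_at x i n = rep_at x i n +o aI n i"
  and rep_at_acomp: "rep_at x i n \<in> acomp i"
proof -
  obtain u where u: "u \<in> acomp i" "coset_at x i n = u +o aI n i" using coset_at[of x] by blast
  then have "u \<in> coset_at x i n" using self_in_coset by blast
  then have "rep_at x i n \<in> coset_at x i n" unfolding rep_at_def by (rule someI)
  then have *: "rep_at x i n - u \<in> aI n i" using u by (auto simp: elt_set_plus_def)
  then show "coset_at x i n = rep_at x i n +o aI n i" using u(2) coset_eq_iff by metis
  show "rep_at x i n \<in> acomp i" using acomp_add[OF aI_acomp[OF *] u(1)] by simp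
qed

lemma asupp_iff: "i \<in> asupp x \<longleftrightarrow> (\<exists>n. rep_at x i n \<notin> aI n i)"
  by (simp add: asupp_def coset_at_rep coset_zero_iff)

lemma finite_asupp: "finite (asupp x)"
  using coset_at[of x] by (simp add: asupp_def)

lemma coherent_rep: "coherent (rep_at x)"
proof -
  have "rep_at x i (Suc n) - rep_at x i n \<in> aI n i" for i n
  proof -
    have "coset_at x i (Suc n) \<subseteq> coset_at x i n" using coset_at[of x] by blast
    moreover have "rep_at x i (Suc n) \<in> coset_at x i (Suc n)"
      unfolding coset_at_rep by (rule self_in_coset)
    ultimately show ?thesis unfolding coset_at_rep by (auto simp: elt_set_plus_def)
  qed
  moreover have "finite {i. \<exists>n. rep_at x i n \<notin> aI n i}"
    using finite_asupp[of x] by (simp add: asupp_def coset_at_rep coset_zero_iff)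
  ultimately show ?thesis by (simp add: coherent_def rep_at_acomp)
qed

lemma coherent_le:
  assumes "coherent r" "m \<le> n"
  shows "r i n - r i m \<in> aI m i"
  using assms(2)
proof (induction n rule: dec_induct)
  case base then show ?case by (simp add: aI_0)
next
  case (step n)
  have "r i (Suc n) - r i n \<in> aI m i"
    using step assms(1) aI_antimono[of m n i] by (auto simp: coherent_def)
  from aI_add[OF this step.IH] step show ?case by simp
qed

lemma rep_le: "m \<le> n \<Longrightarrow> rep_at x i n - rep_at x i m \<in> aI m i"
  by (rule coherent_le[OF coherent_rep])

lemma rep_mk: "coherent r \<Longrightarrow> rep_at (mk_ahat r) i n - r i n \<in> aI n i"
  using coset_at_mk[of r i n] by (simp add: coset_at_rep coset_eq_iff)

lemma ahat_eqI: "(\<And>i n. rep_at x i n - rep_at y i n \<in> aI n i) \<Longrightarrow> x = y"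
  by (intro coset_at_inject[THEN iffD1] ext) (simp add: coset_at_rep coset_eq_iff)

lemma mk_eqI: "coherent r \<Longrightarrow> coherent r' \<Longrightarrow> (\<And>i n. r i n - r' i n \<in> aI n i) \<Longrightarrow> mk_ahat r = mk_ahat r'"
  by (intro coset_at_inject[THEN iffD1] ext) (simp add: coset_at_mk coset_eq_iff)

lemma mk_rep: "mk_ahat (rep_at x) = x"
  by (intro ahat_eqI rep_mk coherent_rep)

lemma aI_diff_swap: "u - v \<in> aI n i \<Longrightarrow> v - u \<in> aI n i"
  using aI_minus[of "u - v" n i] by simp

lemma aI_diff_trans: "u - v \<in> aI n i \<Longrightarrow> v - w \<in> aI n i \<Longrightarrow> u - w \<in> aI n i"
  using aI_add[of "u - v" n i "v - w"] by simp

lemma rep_not_supp: "i \<notin> asupp x \<Longrightarrow> rep_at x i n \<in> aI n i"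
  by (simp add: asupp_iff)

lemma apart_eq_0: "i \<notin> word_deg ` Poly_Mapping.keys u \<Longrightarrow> apart i u = 0"
  unfolding apart_def by (rule sum.neutral) blast

lemma coherent_apart: "coherent (\<lambda>i n. apart i u)"
proof -
  have "{i. \<exists>n. apart i u \<notin> aI n i} \<subseteq> word_deg ` Poly_Mapping.keys u"
    using apart_eq_0[of _ u] aI_0 by fastforce
  then have "finite {i. \<exists>n. apart i u \<notin> aI n i}" by (rule finite_subset) simp
  then show ?thesis by (simp add: coherent_def apart_acomp aI_0)
qed

lemma coherent_0: "coherent (\<lambda>i n. 0)"
  by (simp add: coherent_def acomp_0 aI_0)

lemma coherent_add:
  assumes "coherent r" "coherent r'"
  shows "coherent (\<lambda>i n. r i n + r' i n)"
proof -
  have "{i. \<exists>n. r i n + r' i n \<notin> aI n i} \<subseteq> {i. \<exists>n. r i n \<notin> aI n i} \<union> {i. \<exists>n. r' i n \<notin> aI n i}"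
    using aI_add by blast
  then have "finite {i. \<exists>n. r i n + r' i n \<notin> aI n i}"
    by (rule finite_subset) (use assms in \<open>simp add: coherent_def\<close>)
  moreover have "r i (Suc n) + r' i (Suc n) - (r i n + r' i n) \<in> aI n i" for i n
    using aI_add[of "r i (Suc n) - r i n" n i "r' i (Suc n) - r' i n"] assms
    by (simp add: coherent_def algebra_simps)
  ultimately show ?thesis using assms by (simp add: coherent_def acomp_add)
qed

lemma coherent_minus:
  assumes "coherent r"
  shows "coherent (\<lambda>i n. - r i n)"
proof -
  have "- u \<in> aI n i \<longleftrightarrow> u \<in> aI n i" for u :: "('a, 'b) falg" and n i
    using aI_minus[of u n i] aI_minus[of "- u" n i] by auto
  then have "finite {i. \<exists>n. - r i n \<notin> aI n i}" using assms by (simp add: coherent_def)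
  moreover have "- r i (Suc n) - (- r i n) \<in> aI n i" for i n
    using aI_diff_swap[of "r i (Suc n)" "r i n" n i] assms
    by (simp add: coherent_def algebra_simps)
  ultimately show ?thesis using assms by (simp add: coherent_def acomp_minus)
qed

lemma aI_prod_cong:
  assumes "u - u' \<in> aI m i" "v - v' \<in> aI n j" "u' \<in> acomp i" "v \<in> acomp j" "m \<ge> n + shift j"
  shows "u * v - u' * v' \<in> aI n (i + j)"
proof -
  have "u * v - u' * v' = (u - u') * v + u' * (v - v')" by (simp add: algebra_simps)
  then show ?thesis using assms by (simp add: aI_add aI_lmult aI_rmult)
qed

lemma aI_sum_cong: "(\<And>s. s \<in> S \<Longrightarrow> f s - g s \<in> aI n i) \<Longrightarrow> sum f S - sum g S \<in> aI n i"
  using aI_sum[of S "\<lambda>s. f s - g s" n i] by (simp add: sum_subtractf)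

text \<open>Monomials of \<open>A \<cdot> F\<^sub>p A\<close> have a suffix in \<open>F\<^sub>p A\<close>; in particular, \<open>1 \<notin> A \<cdot> F\<^sub>p A\<close> for \<open>p < 0\<close>.\<close>

lemma hull_afilt_suffix:
  assumes "u \<in> left_ideal hull afilt p" "w \<in> Poly_Mapping.keys u"
  shows "\<exists>v s. w = v @ s \<and> Re (snd (word_deg s)) \<le> of_int p"
proof -
  define M :: "('a, 'b) falg set" where
    "M = {u. \<forall>w \<in> Poly_Mapping.keys u. \<exists>v s. w = v @ s \<and> Re (snd (word_deg s)) \<le> of_int p}"
  have "left_ideal M"
    unfolding left_ideal_def
  proof (intro conjI allI ballI)
    show "0 \<in> M" by (simp add: M_def)
    show "x + y \<in> M" if "x \<in> M" "y \<in> M" for x y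
      using that Poly_Mapping.keys_add[of x y] unfolding M_def by blast
    show "r * x \<in> M" if x: "x \<in> M" for r x
      unfolding M_def
    proof (intro CollectI ballI)
      fix w assume "w \<in> Poly_Mapping.keys (r * x)"
      then obtain a b where ab: "w = a + b" "b \<in> Poly_Mapping.keys x"
        using Poly_Mapping.keys_mult[of r x] by blast
      then obtain v s where "b = v @ s" "Re (snd (word_deg s)) \<le> of_int p"
        using x unfolding M_def by blast
      then show "\<exists>v s. w = v @ s \<and> Re (snd (word_deg s)) \<le> of_int p"
        using ab by (intro exI[of _ "a @ v"] exI[of _ s]) (simp add: plus_list_def)
    qed
  qed
  moreover have "afilt p \<subseteq> M"
    unfolding M_def afilt_def by fastforce
  ultimately have "left_ideal hull afilt p \<subseteq> M" by (simp add: hull_minimal)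
  then show ?thesis using assms unfolding M_def by blast
qed

lemma one_notin_aI: "1 \<notin> aI n 0"
proof
  assume "(1 :: ('a, 'b) falg) \<in> aI n 0"
  then have "\<exists>v s. (0 :: ('a \<times> complex) list) = v @ s \<and> Re (snd (word_deg s)) \<le> of_int (- int n - 1)"
    unfolding aI_def by (intro hull_afilt_suffix[of "1 :: ('a, 'b) falg"]) simp_all
  then show False using word_deg_zero by (auto simp: zero_list_def word_deg_def)
qed

text \<open>
  For \<open>x \<in> A^\<^sub>i\<close> and \<open>y \<in> A^\<^sub>j\<close> with \<open>j = (\<beta>, e)\<close>, the \<open>n\<close>-th coset of \<open>x * y\<close> is the product of
  the \<open>m\<close>-th coset of \<open>x\<close> and the \<open>n\<close>-th coset of \<open>y\<close> for every \<open>m \<ge> n + max 0 \<lceil>Re e\<rceil>\<close>, because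
  \<open>F\<^sub>p A \<cdot> A\<^sub>j \<subseteq> F\<^sub>q A\<close> for \<open>q \<ge> p + Re e\<close>.
\<close>

instantiation ahat :: (type, field) "{zero, one, plus, uminus, minus, times}"
begin

definition zero_ahat :: "('a, 'b) ahat" where
  "zero_ahat = mk_ahat (\<lambda>i n. 0)"

definition one_ahat :: "('a, 'b) ahat" where
  "one_ahat = of_falg 1"

definition plus_ahat :: "('a, 'b) ahat \<Rightarrow> ('a, 'b) ahat \<Rightarrow> ('a, 'b) ahat" where
  "plus_ahat x y = mk_ahat (\<lambda>i n. rep_at x i n + rep_at y i n)"

definition uminus_ahat :: "('a, 'b) ahat \<Rightarrow> ('a, 'b) ahat" where
  "uminus_ahat x = mk_ahat (\<lambda>i n. - rep_at x i n)"

definition minus_ahat :: "('a, 'b) ahat \<Rightarrow> ('a, 'b) ahat \<Rightarrow> ('a, 'b) ahat" where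
  "minus_ahat x y = mk_ahat (\<lambda>i n. rep_at x i n - rep_at y i n)"

definition times_ahat :: "('a, 'b) ahat \<Rightarrow> ('a, 'b) ahat \<Rightarrow> ('a, 'b) ahat" where
  "times_ahat x y = mk_ahat (\<lambda>k n. \<Sum>(i, j) | i \<in> asupp x \<and> j \<in> asupp y \<and> i + j = k.
     rep_at x i (n + shift j) * rep_at y j n)"

instance ..

end

lemma rep_zero: "rep_at 0 i n \<in> aI n i"
  using rep_mk[OF coherent_0, of i n] by (simp add: zero_ahat_def)

lemma rep_plus: "rep_at (x + y) i n - (rep_at x i n + rep_at y i n) \<in> aI n i"
  unfolding plus_ahat_def by (rule rep_mk[OF coherent_add[OF coherent_rep coherent_rep]])

lemma rep_uminus: "rep_at (- x) i n - (- rep_at x i n) \<in> aI n i"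
  unfolding uminus_ahat_def by (rule rep_mk[OF coherent_minus[OF coherent_rep]])

lemma rep_minus: "rep_at (x - y) i n - (rep_at x i n - rep_at y i n) \<in> aI n i"
  unfolding minus_ahat_def
  using rep_mk[OF coherent_add[OF coherent_rep[of x] coherent_minus[OF coherent_rep[of y]]]] by simp

lemma rep_of_falg: "rep_at (of_falg u) i n - apart i u \<in> aI n i"
  unfolding of_falg_def by (rule rep_mk[OF coherent_apart])

lemma apart_1: "apart i (1 :: ('b, 'k::field) falg) = (if i = 0 then 1 else 0)"
proof -
  have "{w \<in> Poly_Mapping.keys (1 :: ('b, 'k) falg). word_deg w = i} = (if i = 0 then {0} else {})"
    by (auto simp: word_deg_zero)
  then show ?thesis by (simp add: apart_def)
qed

definition psum :: "('b, 'k::field) ahat \<Rightarrow> ('b, 'k) ahat \<Rightarrow> _ set \<Rightarrow> _ set \<Rightarrow> (_ \<Rightarrow> nat) \<Rightarrow>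
    'b charge \<times> complex \<Rightarrow> nat \<Rightarrow> ('b, 'k) falg" where
  "psum x y S T m k n = (\<Sum>i\<in>S. \<Sum>j\<in>T. if i + j = k then rep_at x i (m j) * rep_at y j n else 0)"

lemma psum_cong:
  assumes fin: "finite S" "finite T" "finite S'" "finite T'"
    and sub: "asupp x \<subseteq> S" "asupp x \<subseteq> S'" "asupp y \<subseteq> T" "asupp y \<subseteq> T'"
    and m: "\<And>j. j \<in> T \<Longrightarrow> m j \<ge> n + shift j" "\<And>j. j \<in> T' \<Longrightarrow> m' j \<ge> n + shift j"
  shows "psum x y S T m k n - psum x y S' T' m' k n \<in> aI n k"
proof -
  have aux: "psum x y S T m k n - psum x y (asupp x) (asupp y) (\<lambda>j. n + shift j) k n \<in> aI n k"
    if fin: "finite S" "finite T" and sub: "asupp x \<subseteq> S" "asupp y \<subseteq> T"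
      and m: "\<And>j. j \<in> T \<Longrightarrow> m j \<ge> n + shift j" for S T m
  proof -
    define f where "f i j = (if i + j = k then rep_at x i (m j) * rep_at y j n else 0)" for i j
    define g where "g i j = (if i + j = k then rep_at x i (n + shift j) * rep_at y j n else 0)" for i j
    have f: "f i j \<in> aI n k" if "i \<notin> asupp x \<or> j \<notin> asupp y" "j \<in> T" for i j
    proof (cases "i + j = k")
      case True
      from that(1) have "rep_at x i (m j) * rep_at y j n \<in> aI n (i + j)"
      proof
        assume "i \<notin> asupp x"
        from aI_rmult[OF rep_not_supp[OF this] rep_at_acomp m[OF that(2)]] show ?thesis .
      next
        assume "j \<notin> asupp y"
        from aI_lmult[OF rep_at_acomp rep_not_supp[OF this]] show ?thesis .
      qed
      then show ?thesis using True by (simp add: f_def)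
    qed (simp add: f_def aI_0)
    have fg: "f i j - g i j \<in> aI n k" if "j \<in> T" for i j
    proof (cases "i + j = k")
      case True
      have "rep_at x i (m j) * rep_at y j n - rep_at x i (n + shift j) * rep_at y j n \<in> aI n (i + j)"
        by (rule aI_prod_cong[OF rep_le[OF m[OF that]]]) (simp_all add: aI_0 rep_at_acomp)
      then show ?thesis using True by (simp add: f_def g_def)
    qed (simp add: f_def g_def aI_0)
    have 1: "(\<Sum>i\<in>S. \<Sum>j\<in>T. f i j) - (\<Sum>i\<in>asupp x. \<Sum>j\<in>T. f i j) \<in> aI n k"
      unfolding sum_diff[OF fin(1) sub(1), symmetric] by (intro aI_sum f) auto
    have 2: "(\<Sum>i\<in>asupp x. \<Sum>j\<in>T. f i j) - (\<Sum>i\<in>asupp x. \<Sum>j\<in>asupp y. g i j) \<in> aI n k"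
    proof (rule aI_sum_cong)
      fix i assume "i \<in> asupp x"
      have "(\<Sum>j\<in>T. f i j) - (\<Sum>j\<in>asupp y. f i j) \<in> aI n k"
        unfolding sum_diff[OF fin(2) sub(2), symmetric] by (intro aI_sum f) auto
      moreover have "(\<Sum>j\<in>asupp y. f i j) - (\<Sum>j\<in>asupp y. g i j) \<in> aI n k"
        by (rule aI_sum_cong, rule fg) (use sub in blast)
      ultimately show "(\<Sum>j\<in>T. f i j) - (\<Sum>j\<in>asupp y. g i j) \<in> aI n k" by (rule aI_diff_trans)
    qed
    from aI_diff_trans[OF 1 2] show ?thesis by (simp add: psum_def f_def g_def)
  qed
  from aI_diff_trans[OF aux[of S T m] aI_diff_swap[OF aux[of S' T' m']]] show ?thesis
    using assms by simp
qed

lemma psum_acomp: "psum x y S T m k n \<in> acomp k"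
  unfolding psum_def by (intro acomp_sum) (auto simp: acomp_0 intro!: acomp_mult rep_at_acomp)

lemma psum_eq_0: "k \<notin> S + T \<Longrightarrow> psum x y S T m k n = 0"
  unfolding psum_def by (intro sum.neutral ballI) (auto simp: set_plus_def)

lemma coherent_psum:
  fixes x y :: "('b, 'k::field) ahat"
  shows "coherent (\<lambda>k n. psum x y (asupp x) (asupp y) (\<lambda>j. n + shift j) k n)"
proof -
  let ?p = "\<lambda>k n. psum x y (asupp x) (asupp y) (\<lambda>j. n + shift j) k n"
  have "{k. \<exists>n. ?p k n \<notin> aI n k} \<subseteq> asupp x + asupp y"
    using psum_eq_0[of _ "asupp x" "asupp y" x y] aI_0 by fastforce
  then have "finite {k. \<exists>n. ?p k n \<notin> aI n k}"
    by (rule finite_subset) (simp add: finite_set_plus finite_asupp)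
  moreover have "?p k (Suc n) - ?p k n \<in> aI n k" for k n
  proof -
    have "?p k (Suc n) - psum x y (asupp x) (asupp y) (\<lambda>j. Suc n + shift j) k n \<in> aI n k"
      unfolding psum_def
    proof (intro aI_sum_cong)
      fix i j
      have "rep_at x i (Suc n + shift j) * rep_at y j (Suc n) -
          rep_at x i (Suc n + shift j) * rep_at y j n \<in> aI n (i + j)"
        by (rule aI_prod_cong[where m = "n + shift j"]) (simp_all add: aI_0 rep_at_acomp rep_le)
      then show "(if i + j = k then rep_at x i (Suc n + shift j) * rep_at y j (Suc n) else 0) -
          (if i + j = k then rep_at x i (Suc n + shift j) * rep_at y j n else 0) \<in> aI n k"
        by (cases "i + j = k") (simp_all add: aI_0)
    qed
    moreover have "psum x y (asupp x) (asupp y) (\<lambda>j. Suc n + shift j) k n - ?p k n \<in> aI n k"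
      by (rule psum_cong) (simp_all add: finite_asupp)
    ultimately show ?thesis by (rule aI_diff_trans)
  qed
  ultimately show ?thesis by (simp add: coherent_def psum_acomp)
qed

lemma times_ahat_psum: "x * y = mk_ahat (\<lambda>k n. psum x y (asupp x) (asupp y) (\<lambda>j. n + shift j) k n)"
proof -
  have "(\<Sum>(i, j) | i \<in> asupp x \<and> j \<in> asupp y \<and> i + j = k. rep_at x i (n + shift j) * rep_at y j n) =
     psum x y (asupp x) (asupp y) (\<lambda>j. n + shift j) k n" for k n
  proof -
    have eq: "{(i, j). i \<in> asupp x \<and> j \<in> asupp y \<and> i + j = k} =
       {p \<in> asupp x \<times> asupp y. fst p + snd p = k}" by (simp add: set_eq_iff split_paired_All)
    have "(\<Sum>(i, j) | i \<in> asupp x \<and> j \<in> asupp y \<and> i + j = k. rep_at x i (n + shift j) * rep_at y j n) =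
      (\<Sum>p\<in>asupp x \<times> asupp y. if fst p + snd p = k
         then rep_at x (fst p) (n + shift (snd p)) * rep_at y (snd p) n else 0)"
      unfolding eq by (subst sum.inter_filter) (simp_all add: finite_asupp split_def cong: if_cong)
    also have "\<dots> = psum x y (asupp x) (asupp y) (\<lambda>j. n + shift j) k n"
      unfolding psum_def by (simp add: sum.cartesian_product case_prod_beta)
    finally show ?thesis .
  qed
  then show ?thesis unfolding times_ahat_def by presburger
qed

lemma rep_times:
  assumes "finite S" "finite T" "asupp x \<subseteq> S" "asupp y \<subseteq> T" "\<And>j. j \<in> T \<Longrightarrow> m j \<ge> n + shift j"
  shows "rep_at (x * y) k n - psum x y S T m k n \<in> aI n k"
proof (rule aI_diff_trans)
  show "rep_at (x * y) k n - psum x y (asupp x) (asupp y) (\<lambda>j. n + shift j) k n \<in> aI n k"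
    unfolding times_ahat_psum by (rule rep_mk[OF coherent_psum])
  show "psum x y (asupp x) (asupp y) (\<lambda>j. n + shift j) k n - psum x y S T m k n \<in> aI n k"
    by (rule psum_cong) (simp_all add: finite_asupp assms)
qed

lemma asupp_times:
  fixes x y :: "('b, 'k::field) ahat"
  shows "asupp (x * y) \<subseteq> asupp x + asupp y"
proof (rule subsetI, rule ccontr)
  fix k assume k: "k \<in> asupp (x * y)" "k \<notin> asupp x + asupp y"
  have "rep_at (x * y) k n \<in> aI n k" for n
    using rep_times[of "asupp x" "asupp y" x y n "\<lambda>j. n + shift j" k]
      psum_eq_0[OF k(2), of x y] by (simp add: finite_asupp)
  with k(1) show False by (simp add: asupp_iff)
qed

lemma psum_factor_cong:
  assumes "\<And>i j. i \<in> S \<Longrightarrow> j \<in> T \<Longrightarrow> i + j = k \<Longrightarrow> f i j - g i j \<in> aI n (i + j)"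
  shows "(\<Sum>i\<in>S. \<Sum>j\<in>T. if i + j = k then f i j else 0) -
     (\<Sum>i\<in>S. \<Sum>j\<in>T. if i + j = k then g i j else 0) \<in> aI n k"
proof (intro aI_sum_cong)
  fix i j assume "i \<in> S" "j \<in> T"
  then show "(if i + j = k then f i j else 0) - (if i + j = k then g i j else 0) \<in> aI n k"
    using assms[of i j] by (cases "i + j = k") (simp_all add: aI_0)
qed

lemma if_sum_if:
  "(if c then (\<Sum>i\<in>S. \<Sum>j\<in>T. if P i j then g i j else 0) else 0) =
   (\<Sum>i\<in>S. \<Sum>j\<in>T. if P i j then if c then g i j else 0 else 0)"
  by (cases c) (simp_all cong: if_cong)

lemma triple_sum_left:
  fixes f :: "'i::ab_semigroup_add \<Rightarrow> 'i \<Rightarrow> 'i \<Rightarrow> 'c::comm_monoid_add"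
  assumes "finite S" "finite T"
  shows "(\<Sum>p\<in>S + T. \<Sum>l\<in>U. if p + l = k then (\<Sum>i\<in>S. \<Sum>j\<in>T. if i + j = p then f i j l else 0) else 0) =
     (\<Sum>i\<in>S. \<Sum>j\<in>T. \<Sum>l\<in>U. if i + j + l = k then f i j l else 0)"
proof -
  have "(\<Sum>p\<in>S + T. \<Sum>l\<in>U. if p + l = k then (\<Sum>i\<in>S. \<Sum>j\<in>T. if i + j = p then f i j l else 0) else 0) =
    (\<Sum>p\<in>S + T. \<Sum>l\<in>U. \<Sum>i\<in>S. \<Sum>j\<in>T. if i + j = p then if p + l = k then f i j l else 0 else 0)"
    by (simp only: if_sum_if)
  also have "\<dots> = (\<Sum>p\<in>S + T. \<Sum>i\<in>S. \<Sum>l\<in>U. \<Sum>j\<in>T. if i + j = p then if p + l = k then f i j l else 0 else 0)"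
    by (intro sum.cong refl sum.swap)
  also have "\<dots> = (\<Sum>p\<in>S + T. \<Sum>i\<in>S. \<Sum>j\<in>T. \<Sum>l\<in>U. if i + j = p then if p + l = k then f i j l else 0 else 0)"
    by (intro sum.cong refl sum.swap)
  also have "\<dots> = (\<Sum>i\<in>S. \<Sum>p\<in>S + T. \<Sum>j\<in>T. \<Sum>l\<in>U. if i + j = p then if p + l = k then f i j l else 0 else 0)"
    by (rule sum.swap)
  also have "\<dots> = (\<Sum>i\<in>S. \<Sum>j\<in>T. \<Sum>p\<in>S + T. \<Sum>l\<in>U. if i + j = p then if p + l = k then f i j l else 0 else 0)"
    by (intro sum.cong refl sum.swap)
  also have "\<dots> = (\<Sum>i\<in>S. \<Sum>j\<in>T. \<Sum>l\<in>U. \<Sum>p\<in>S + T. if i + j = p then if p + l = k then f i j l else 0 else 0)"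
    by (intro sum.cong refl sum.swap)
  also have "\<dots> = (\<Sum>i\<in>S. \<Sum>j\<in>T. \<Sum>l\<in>U. if i + j + l = k then f i j l else 0)"
    by (intro sum.cong refl, subst sum.delta')
      (use assms in \<open>auto simp: finite_set_plus intro: set_plus_intro\<close>)
  finally show ?thesis .
qed

lemma triple_sum_right:
  fixes f :: "'i::ab_semigroup_add \<Rightarrow> 'i \<Rightarrow> 'i \<Rightarrow> 'c::comm_monoid_add"
  assumes "finite T" "finite U"
  shows "(\<Sum>i\<in>S. \<Sum>q\<in>T + U. if i + q = k then (\<Sum>j\<in>T. \<Sum>l\<in>U. if j + l = q then f i j l else 0) else 0) =
     (\<Sum>i\<in>S. \<Sum>j\<in>T. \<Sum>l\<in>U. if i + j + l = k then f i j l else 0)"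
proof (rule sum.cong[OF refl])
  fix i
  have "(\<Sum>q\<in>T + U. if i + q = k then (\<Sum>j\<in>T. \<Sum>l\<in>U. if j + l = q then f i j l else 0) else 0) =
    (\<Sum>q\<in>T + U. \<Sum>j\<in>T. \<Sum>l\<in>U. if j + l = q then if i + q = k then f i j l else 0 else 0)"
    by (simp only: if_sum_if)
  also have "\<dots> = (\<Sum>j\<in>T. \<Sum>q\<in>T + U. \<Sum>l\<in>U. if j + l = q then if i + q = k then f i j l else 0 else 0)"
    by (rule sum.swap)
  also have "\<dots> = (\<Sum>j\<in>T. \<Sum>l\<in>U. \<Sum>q\<in>T + U. if j + l = q then if i + q = k then f i j l else 0 else 0)"
    by (intro sum.cong refl sum.swap)
  also have "\<dots> = (\<Sum>j\<in>T. \<Sum>l\<in>U. if i + j + l = k then f i j l else 0)"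
    by (intro sum.cong refl, subst sum.delta')
      (use assms in \<open>auto simp: finite_set_plus add.assoc intro: set_plus_intro\<close>)
  finally show "(\<Sum>q\<in>T + U. if i + q = k then (\<Sum>j\<in>T. \<Sum>l\<in>U. if j + l = q then f i j l else 0) else 0) =
    (\<Sum>j\<in>T. \<Sum>l\<in>U. if i + j + l = k then f i j l else 0)" .
qed

lemma mult_assoc_ahat: "(x * y) * z = x * (y * z)"
  for x y z :: "('b, 'k::field) ahat"
proof (rule ahat_eqI)
  fix k :: "'b charge \<times> complex" and n :: nat
  define S where "S = asupp x"
  define T where "T = asupp y"
  define U where "U = asupp z"
  note fin = finite_asupp[of x, folded S_def] finite_asupp[of y, folded T_def] finite_asupp[of z, folded U_def]
  define M where "M = n + (\<Sum>j\<in>T. shift j) + (\<Sum>l\<in>U. shift l)"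
  define trip where "trip = (\<lambda>i j l. rep_at x i M * rep_at y j (n + shift l) * rep_at z l n)"
  have M: "n + shift l + shift j \<le> M" if "j \<in> T" "l \<in> U" for j l
    using member_le_sum[OF that(1), of shift] member_le_sum[OF that(2), of shift] fin by (simp add: M_def)
  have L1: "rep_at (x * y * z) k n - psum (x * y) z (S + T) U (\<lambda>l. n + shift l) k n \<in> aI n k"
    by (rule rep_times) (use asupp_times[of x y] in \<open>simp_all add: finite_set_plus fin S_def T_def U_def finite_asupp\<close>)
  have L2: "psum (x * y) z (S + T) U (\<lambda>l. n + shift l) k n -
     (\<Sum>p\<in>S + T. \<Sum>l\<in>U. if p + l = k then psum x y S T (\<lambda>_. M) p (n + shift l) * rep_at z l n else 0) \<in> aI n k"
    unfolding psum_def[of "x * y"]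
  proof (rule psum_factor_cong)
    fix p l assume pl: "p \<in> S + T" "l \<in> U"
    show "rep_at (x * y) p (n + shift l) * rep_at z l n - psum x y S T (\<lambda>_. M) p (n + shift l) * rep_at z l n
       \<in> aI n (p + l)"
    proof (rule aI_prod_cong[where m = "n + shift l"])
      show "rep_at (x * y) p (n + shift l) - psum x y S T (\<lambda>_. M) p (n + shift l) \<in> aI (n + shift l) p"
        by (rule rep_times) (use fin M[OF _ pl(2)] in \<open>simp_all add: S_def T_def\<close>)
    qed (simp_all add: aI_0 rep_at_acomp psum_acomp)
  qed
  have L3: "(\<Sum>p\<in>S + T. \<Sum>l\<in>U. if p + l = k then psum x y S T (\<lambda>_. M) p (n + shift l) * rep_at z l n else 0) =
     (\<Sum>i\<in>S. \<Sum>j\<in>T. \<Sum>l\<in>U. if i + j + l = k then trip i j l else 0)"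
    unfolding triple_sum_left[OF fin(1,2), symmetric]
    by (simp add: psum_def trip_def sum_distrib_right if_distrib[where f = "\<lambda>u. u * w" for w] cong: if_cong)
  have R1: "rep_at (x * (y * z)) k n - psum x (y * z) S (T + U) (\<lambda>_. M) k n \<in> aI n k"
  proof (rule rep_times)
    fix q assume "q \<in> T + U"
    then obtain j l where "j \<in> T" "l \<in> U" "q = j + l" by (auto simp: set_plus_def)
    then show "n + shift q \<le> M" using M[of j l] shift_add[of j l] by simp
  qed (use asupp_times[of y z] in \<open>simp_all add: finite_set_plus fin S_def T_def U_def finite_asupp\<close>)
  have R2: "psum x (y * z) S (T + U) (\<lambda>_. M) k n -
     (\<Sum>i\<in>S. \<Sum>q\<in>T + U. if i + q = k then rep_at x i M * psum y z T U (\<lambda>l. n + shift l) q n else 0) \<in> aI n k"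
    unfolding psum_def[of x]
  proof (rule psum_factor_cong)
    fix i q
    have "rep_at (y * z) q n - psum y z T U (\<lambda>l. n + shift l) q n \<in> aI n q"
      by (rule rep_times) (use fin in \<open>simp_all add: T_def U_def\<close>)
    from aI_lmult[OF rep_at_acomp[of x i M] this]
    show "rep_at x i M * rep_at (y * z) q n - rep_at x i M * psum y z T U (\<lambda>l. n + shift l) q n \<in> aI n (i + q)"
      by (simp add: right_diff_distrib)
  qed
  have R3: "(\<Sum>i\<in>S. \<Sum>q\<in>T + U. if i + q = k then rep_at x i M * psum y z T U (\<lambda>l. n + shift l) q n else 0) =
     (\<Sum>i\<in>S. \<Sum>j\<in>T. \<Sum>l\<in>U. if i + j + l = k then trip i j l else 0)"
    unfolding triple_sum_right[OF fin(2,3), symmetric]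
    by (simp add: psum_def trip_def sum_distrib_left mult.assoc if_distrib[where f = "\<lambda>u. w * u" for w] cong: if_cong)
  from aI_diff_trans[OF L1 L2[unfolded L3]] aI_diff_trans[OF R1 R2[unfolded R3]]
  show "rep_at (x * y * z) k n - rep_at (x * (y * z)) k n \<in> aI n k"
    using aI_diff_trans aI_diff_swap by blast
qed

lemma distrib_right_ahat: "(x + y) * z = x * z + y * z"
  for x y z :: "('b, 'k::field) ahat"
proof (rule ahat_eqI)
  fix k :: "'b charge \<times> complex" and n :: nat
  define S where "S = asupp x \<union> asupp y \<union> asupp (x + y)"
  define T where "T = asupp z"
  let ?P = "\<lambda>x. psum x z S T (\<lambda>l. n + shift l) k n"
  have 1: "rep_at (w * z) k n - ?P w \<in> aI n k" if "asupp w \<subseteq> S" for w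
    by (rule rep_times) (use that in \<open>simp_all add: finite_asupp S_def T_def\<close>)
  have "?P (x + y) - (\<Sum>i\<in>S. \<Sum>j\<in>T. if i + j = k then
      (rep_at x i (n + shift j) + rep_at y i (n + shift j)) * rep_at z j n else 0) \<in> aI n k"
    unfolding psum_def
  proof (rule psum_factor_cong)
    fix i j
    show "rep_at (x + y) i (n + shift j) * rep_at z j n -
        (rep_at x i (n + shift j) + rep_at y i (n + shift j)) * rep_at z j n \<in> aI n (i + j)"
      by (rule aI_prod_cong[where m = "n + shift j"]) (simp_all add: rep_plus aI_0 rep_at_acomp acomp_add)
  qed
  also have "(\<Sum>i\<in>S. \<Sum>j\<in>T. if i + j = k then
      (rep_at x i (n + shift j) + rep_at y i (n + shift j)) * rep_at z j n else 0) = ?P x + ?P y"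
    by (simp add: psum_def sum.distrib[symmetric] distrib_right if_distrib cong: if_cong)
  finally have 2: "?P (x + y) - (?P x + ?P y) \<in> aI n k" .
  have 3: "(rep_at (x * z) k n + rep_at (y * z) k n) - (?P x + ?P y) \<in> aI n k"
    using aI_add[OF 1[of x] 1[of y]] by (simp add: S_def Un_assoc Un_upper1 le_supI1 le_supI2 algebra_simps)
  have "rep_at ((x + y) * z) k n - (?P x + ?P y) \<in> aI n k"
    by (rule aI_diff_trans[OF 1 2]) (simp add: S_def)
  from aI_diff_trans[OF this aI_diff_swap[OF 3]]
  have "rep_at ((x + y) * z) k n - (rep_at (x * z) k n + rep_at (y * z) k n) \<in> aI n k" .
  from aI_diff_trans[OF this aI_diff_swap[OF rep_plus]]
  show "rep_at ((x + y) * z) k n - rep_at (x * z + y * z) k n \<in> aI n k" .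
qed

lemma distrib_left_ahat: "z * (x + y) = z * x + z * y"
  for x y z :: "('b, 'k::field) ahat"
proof (rule ahat_eqI)
  fix k :: "'b charge \<times> complex" and n :: nat
  define S where "S = asupp x \<union> asupp y \<union> asupp (x + y)"
  define T where "T = asupp z"
  let ?P = "\<lambda>x. psum z x T S (\<lambda>l. n + shift l) k n"
  have 1: "rep_at (z * w) k n - ?P w \<in> aI n k" if "asupp w \<subseteq> S" for w
    by (rule rep_times) (use that in \<open>simp_all add: finite_asupp S_def T_def\<close>)
  have "?P (x + y) - (\<Sum>i\<in>T. \<Sum>j\<in>S. if i + j = k then
      rep_at z i (n + shift j) * (rep_at x j n + rep_at y j n) else 0) \<in> aI n k"
    unfolding psum_def
  proof (rule psum_factor_cong)
    fix i j
    show "rep_at z i (n + shift j) * rep_at (x + y) j n -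
        rep_at z i (n + shift j) * (rep_at x j n + rep_at y j n) \<in> aI n (i + j)"
      by (rule aI_prod_cong[where m = "n + shift j"]) (simp_all add: rep_plus aI_0 rep_at_acomp)
  qed
  also have "(\<Sum>i\<in>T. \<Sum>j\<in>S. if i + j = k then
      rep_at z i (n + shift j) * (rep_at x j n + rep_at y j n) else 0) = ?P x + ?P y"
    by (simp add: psum_def sum.distrib[symmetric] distrib_left if_distrib cong: if_cong)
  finally have 2: "?P (x + y) - (?P x + ?P y) \<in> aI n k" .
  have 3: "(rep_at (z * x) k n + rep_at (z * y) k n) - (?P x + ?P y) \<in> aI n k"
    using aI_add[OF 1[of x] 1[of y]] by (simp add: S_def Un_assoc Un_upper1 le_supI1 le_supI2 algebra_simps)
  have "rep_at (z * (x + y)) k n - (?P x + ?P y) \<in> aI n k"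
    by (rule aI_diff_trans[OF 1 2]) (simp add: S_def)
  from aI_diff_trans[OF this aI_diff_swap[OF 3]]
  have "rep_at (z * (x + y)) k n - (rep_at (z * x) k n + rep_at (z * y) k n) \<in> aI n k" .
  from aI_diff_trans[OF this aI_diff_swap[OF rep_plus]]
  show "rep_at (z * (x + y)) k n - rep_at (z * x + z * y) k n \<in> aI n k" .
qed

lemma asupp_1: "asupp 1 \<subseteq> {0}"
proof
  fix i assume "i \<in> asupp (1 :: ('a, 'b) ahat)"
  then obtain n where n: "rep_at (1 :: ('a, 'b) ahat) i n \<notin> aI n i" by (auto simp: asupp_iff)
  have "rep_at (1 :: ('a, 'b) ahat) i n - (if i = 0 then 1 else 0) \<in> aI n i"
    using rep_of_falg[of "1 :: ('a, 'b) falg" i n] by (simp only: one_ahat_def apart_1)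
  with n show "i \<in> {0}" by (simp split: if_splits)
qed

lemma rep_1: "rep_at 1 0 n - 1 \<in> aI n 0"
  using rep_of_falg[of 1 0 n] by (simp only: one_ahat_def apart_1 if_True simp_thms)

lemma psum_single_left:
  assumes "finite T" "k \<in> T"
  shows "psum x y {0} T m k n = rep_at x 0 (m k) * rep_at y k n"
proof -
  have "psum x y {0} T m k n = (\<Sum>j\<in>T. if j = k then rep_at x 0 (m j) * rep_at y j n else 0)"
    by (simp only: psum_def sum.insert finite.emptyI empty_iff not_False_eq_True sum.empty add_0_right add_0_left)
  also have "\<dots> = rep_at x 0 (m k) * rep_at y k n"
    by (subst sum.delta) (simp_all only: assms if_True)
  finally show ?thesis .
qed

lemma psum_single_right:
  assumes "finite S" "k \<in> S"
  shows "psum x y S {0} m k n = rep_at x k (m 0) * rep_at y 0 n"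
proof -
  have "psum x y S {0} m k n = (\<Sum>i\<in>S. if i = k then rep_at x i (m 0) * rep_at y 0 n else 0)"
    by (simp only: psum_def sum.insert finite.emptyI empty_iff not_False_eq_True sum.empty add_0_right add_0_left)
  also have "\<dots> = rep_at x k (m 0) * rep_at y 0 n"
    by (subst sum.delta) (simp_all only: assms if_True)
  finally show ?thesis .
qed

lemma mult_1_left_ahat: "1 * x = x" for x :: "('b, 'k::field) ahat"
proof (rule ahat_eqI)
  fix k :: "'b charge \<times> complex" and n :: nat
  define m where "m = (\<lambda>j :: 'b charge \<times> complex. n + shift j)"
  have "rep_at (1 * x) k n - psum 1 x {0} (insert k (asupp x)) m k n \<in> aI n k"
    by (rule rep_times) (simp_all add: finite_asupp m_def asupp_1 subset_insertI)
  also have "psum 1 x {0} (insert k (asupp x)) m k n = rep_at 1 0 (m k) * rep_at x k n"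
    by (rule psum_single_left) (simp_all add: finite_asupp)
  finally have 1: "rep_at (1 * x) k n - rep_at 1 0 (m k) * rep_at x k n \<in> aI n k" .
  have "rep_at 1 0 (m k) * rep_at x k n - 1 * rep_at x k n \<in> aI n (0 + k)"
    by (rule aI_prod_cong[where m = "m k", OF rep_1]) (simp_all add: aI_0 acomp_1 rep_at_acomp m_def)
  then have 2: "rep_at 1 0 (m k) * rep_at x k n - rep_at x k n \<in> aI n k" by simp
  from aI_diff_trans[OF 1 2] show "rep_at (1 * x) k n - rep_at x k n \<in> aI n k" .
qed

lemma mult_1_right_ahat: "x * 1 = x" for x :: "('b, 'k::field) ahat"
proof (rule ahat_eqI)
  fix k :: "'b charge \<times> complex" and n :: nat
  have s0: "shift (0 :: 'b charge \<times> complex) = 0" by (simp add: shift_def)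
  have "rep_at (x * 1) k n - psum x 1 (insert k (asupp x)) {0} (\<lambda>_. n) k n \<in> aI n k"
    by (rule rep_times) (simp_all add: finite_asupp s0 asupp_1 subset_insertI)
  also have "psum x 1 (insert k (asupp x)) {0} (\<lambda>_. n) k n = rep_at x k n * rep_at 1 0 n"
    by (rule psum_single_right) (simp_all add: finite_asupp)
  finally have 1: "rep_at (x * 1) k n - rep_at x k n * rep_at 1 0 n \<in> aI n k" .
  have "rep_at x k n * rep_at 1 0 n - rep_at x k n * 1 \<in> aI n (k + 0)"
    by (rule aI_prod_cong[where m = n, OF _ rep_1]) (simp_all add: aI_0 rep_at_acomp s0)
  then have 2: "rep_at x k n * rep_at 1 0 n - rep_at x k n \<in> aI n k" by simp
  from aI_diff_trans[OF 1 2] show "rep_at (x * 1) k n - rep_at x k n \<in> aI n k" .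
qed

instance ahat :: (type, field) ring_1
proof
  fix x y z :: "('a, 'b) ahat"
  show "x + y + z = x + (y + z)"
  proof (rule ahat_eqI)
    fix i n
    have "rep_at (x + y + z) i n - (rep_at x i n + rep_at y i n + rep_at z i n) \<in> aI n i"
      using aI_add[OF rep_plus[of "x + y" z i n] rep_plus[of x y i n]] by (simp add: algebra_simps)
    moreover have "(rep_at x i n + rep_at y i n + rep_at z i n) - rep_at (x + (y + z)) i n \<in> aI n i"
      using aI_minus[OF aI_add[OF rep_plus[of x "y + z" i n] rep_plus[of y z i n]]] by (simp add: algebra_simps)
    ultimately show "rep_at (x + y + z) i n - rep_at (x + (y + z)) i n \<in> aI n i" by (rule aI_diff_trans)
  qed
  show "x + y = y + x" by (simp add: plus_ahat_def add.commute)
  show "0 + x = x"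
  proof (rule ahat_eqI)
    fix i n
    show "rep_at (0 + x) i n - rep_at x i n \<in> aI n i"
      using aI_add[OF rep_plus[of 0 x i n] rep_zero[of i n]] by (simp add: algebra_simps)
  qed
  show "- x + x = 0"
  proof (rule ahat_eqI)
    fix i n
    show "rep_at (- x + x) i n - rep_at 0 i n \<in> aI n i"
      using aI_diff[OF aI_add[OF rep_plus[of "- x" x i n] rep_uminus[of x i n]] rep_zero[of i n]]
      by (simp add: algebra_simps)
  qed
  show "x - y = x + - y"
  proof (rule ahat_eqI)
    fix i n
    show "rep_at (x - y) i n - rep_at (x + - y) i n \<in> aI n i"
      using aI_diff[OF rep_minus[of x y i n] aI_add[OF rep_plus[of x "- y" i n] rep_uminus[of y i n]]]
      by (simp add: algebra_simps)
  qed
  show "x * y * z = x * (y * z)" by (rule mult_assoc_ahat)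
  show "(x + y) * z = x * z + y * z" by (rule distrib_right_ahat)
  show "x * (y + z) = x * y + x * z" by (rule distrib_left_ahat)
  show "1 * x = x" by (rule mult_1_left_ahat)
  show "x * 1 = x" by (rule mult_1_right_ahat)
  show "(0 :: ('a, 'b) ahat) \<noteq> 1"
  proof
    assume eq: "(0 :: ('a, 'b) ahat) = 1"
    have "rep_at (1 :: ('a, 'b) ahat) 0 0 - 1 \<in> aI 0 0" by (rule rep_1)
    moreover have "rep_at (1 :: ('a, 'b) ahat) 0 0 \<in> aI 0 0"
      unfolding eq[symmetric] by (rule rep_zero)
    ultimately have "(1 :: ('a, 'b) falg) \<in> aI 0 0"
      using aI_diff by fastforce
    then show False using one_notin_aI by blast
  qed
qed

text \<open>
  On each \<open>hcomp i\<close> the following topology induces the inverse limit topology.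
\<close>

instantiation ahat :: (type, field) t2_space
begin

definition open_ahat :: "('a, 'b) ahat set \<Rightarrow> bool" where
  "open_ahat U \<longleftrightarrow> (\<forall>x \<in> U. \<exists>n. \<forall>y. (\<forall>i. coset_at y i n = coset_at x i n) \<longrightarrow> y \<in> U)"

lemma coset_at_le:
  fixes x y :: "('a, 'b) ahat"
  assumes "coset_at x i n = coset_at y i n" "m \<le> n"
  shows "coset_at x i m = coset_at y i m"
proof -
  have "rep_at x i n - rep_at y i n \<in> aI m i"
    using assms aI_antimono[of m n i] by (auto simp: coset_at_rep coset_eq_iff)
  then have "rep_at x i m - rep_at y i m \<in> aI m i"
    using aI_diff_trans[OF aI_diff_swap[OF rep_le[OF assms(2)]] aI_diff_trans[OF _ rep_le[OF assms(2)]]]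
    by blast
  then show ?thesis by (simp add: coset_at_rep coset_eq_iff)
qed

instance
proof
  show "open (UNIV :: ('a, 'b) ahat set)" by (simp add: open_ahat_def)
  show "open (S \<inter> T)" if ST: "open S" "open T" for S T :: "('a, 'b) ahat set"
    unfolding open_ahat_def
  proof
    fix x assume "x \<in> S \<inter> T"
    then obtain m n where mn:
      "\<forall>y. (\<forall>i. coset_at y i m = coset_at x i m) \<longrightarrow> y \<in> S"
      "\<forall>y. (\<forall>i. coset_at y i n = coset_at x i n) \<longrightarrow> y \<in> T"
      using ST unfolding open_ahat_def by blast
    have "y \<in> S \<inter> T" if y: "\<forall>i. coset_at y i (max m n) = coset_at x i (max m n)" for y
    proof -
      have "coset_at y i m = coset_at x i m" "coset_at y i n = coset_at x i n" for i
        using coset_at_le[of y i "max m n" x] y by auto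
      then show ?thesis using mn by blast
    qed
    then show "\<exists>n. \<forall>y. (\<forall>i. coset_at y i n = coset_at x i n) \<longrightarrow> y \<in> S \<inter> T" by blast
  qed
  show "open (\<Union>K)" if "\<forall>S \<in> K. open S" for K :: "('a, 'b) ahat set set"
    using that unfolding open_ahat_def by (meson Union_iff)
  show "\<exists>U V. open U \<and> open V \<and> x \<in> U \<and> y \<in> V \<and> U \<inter> V = {}"
    if "x \<noteq> y" for x y :: "('a, 'b) ahat"
  proof -
    have "\<exists>i n. coset_at x i n \<noteq> coset_at y i n"
      using that coset_at_inject[of x y] by (metis ext)
    then obtain i n where n: "coset_at x i n \<noteq> coset_at y i n" by blast
    let ?U = "\<lambda>z. {w :: ('a, 'b) ahat. \<forall>k. coset_at w k n = coset_at z k n}"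
    have "open (?U z)" for z unfolding open_ahat_def by (intro ballI exI[of _ n]) simp
    moreover have "?U x \<inter> ?U y = {}"
    proof (rule equals0I)
      fix w assume "w \<in> ?U x \<inter> ?U y"
      then have "coset_at w i n = coset_at x i n" "coset_at w i n = coset_at y i n" by blast+
      with n show False by simp
    qed
    moreover have "x \<in> ?U x" "y \<in> ?U y" by simp_all
    ultimately show ?thesis by blast
  qed
qed

end

lemma apart_lookup: "Poly_Mapping.lookup (apart i u) w = (if word_deg w = i then Poly_Mapping.lookup u w else 0)"
proof -
  have "Poly_Mapping.lookup (apart i u) w =
     (\<Sum>v | v \<in> Poly_Mapping.keys u \<and> word_deg v = i. if v = w then Poly_Mapping.lookup u w else 0)"
    unfolding apart_def lookup_sum by (intro sum.cong refl) (simp add: lookup_single when_def)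
  also have "\<dots> = (if word_deg w = i then Poly_Mapping.lookup u w else 0)"
    by (subst sum.delta) (auto simp: in_keys_iff)
  finally show ?thesis .
qed

lemma apart_add: "apart i (u + v) = apart i u + apart i v"
  by (rule poly_mapping_eqI) (simp add: apart_lookup lookup_add)

lemma apart_same: "u \<in> acomp i \<Longrightarrow> apart j u = (if j = i then u else 0)"
  by (rule poly_mapping_eqI) (auto simp: apart_lookup acomp_def in_keys_iff)

lemma of_falg_0: "of_falg 0 = 0"
  by (simp add: of_falg_def zero_ahat_def apart_def)

lemma of_falg_add: "of_falg (u + v) = of_falg u + of_falg v"
proof (rule ahat_eqI)
  fix i n
  have "rep_at (of_falg (u + v)) i n - (rep_at (of_falg u) i n + rep_at (of_falg v) i n) \<in> aI n i"
    using aI_diff[OF rep_of_falg[of "u + v" i n] aI_add[OF rep_of_falg[of u i n] rep_of_falg[of v i n]]]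
    by (simp add: apart_add algebra_simps)
  from aI_diff_trans[OF this aI_diff_swap[OF rep_plus]]
  show "rep_at (of_falg (u + v)) i n - rep_at (of_falg u + of_falg v) i n \<in> aI n i" .
qed

lemma of_falg_sum: "of_falg (\<Sum>s\<in>S. f s) = (\<Sum>s\<in>S. of_falg (f s))"
  by (induction S rule: infinite_finite_induct) (simp_all add: of_falg_0 of_falg_add)

lemma summable_of_falg:
  assumes f: "\<And>j. f j \<in> acomp i" and ev: "\<And>n. eventually (\<lambda>j. f j \<in> aI n i) sequentially"
  shows "summable (\<lambda>j. of_falg (f j))"
proof -
  from ev have "\<forall>n. \<exists>M. \<forall>j\<ge>M. f j \<in> aI n i" by (simp add: eventually_sequentially)
  then obtain M where M: "\<And>n j. j \<ge> M n \<Longrightarrow> f j \<in> aI n i" by metis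
  define M' where "M' n = (\<Sum>k\<le>n. M k)" for n
  have M': "M n \<le> M' n" "M' n \<le> M' (Suc n)" for n
    unfolding M'_def by (auto intro: member_le_sum)
  have tail: "(\<Sum>j<q. f j) - (\<Sum>j<p. f j) \<in> aI n i" if "M n \<le> p" "p \<le> q" for n p q
  proof -
    have "(\<Sum>j<q. f j) - (\<Sum>j<p. f j) = (\<Sum>j\<in>{..<q} - {..<p}. f j)"
      using that by (subst sum_diff) auto
    also have "\<dots> \<in> aI n i" by (rule aI_sum) (use that M in auto)
    finally show ?thesis .
  qed
  define r where "r j n = (if j = i then \<Sum>l<M' n. f l else 0)" for j n
  have "{j. \<exists>n. r j n \<notin> aI n j} \<subseteq> {i}" by (auto simp: r_def aI_0 split: if_splits)
  then have "finite {j. \<exists>n. r j n \<notin> aI n j}" by (rule finite_subset) simp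
  then have coh: "coherent r"
    using tail[OF M'(1) M'(2)] by (simp add: coherent_def r_def acomp_0 aI_0 acomp_sum f)
  have "(\<lambda>q. \<Sum>j<q. of_falg (f j)) \<longlonglongrightarrow> mk_ahat r"
  proof (rule topological_tendstoI)
    fix U assume "open U" "mk_ahat r \<in> U"
    then obtain n where n: "\<And>y. (\<forall>j. coset_at y j n = coset_at (mk_ahat r) j n) \<Longrightarrow> y \<in> U"
      unfolding open_ahat_def by blast
    have "(\<Sum>j<q. of_falg (f j)) \<in> U" if "q \<ge> M' n" for q
    proof (rule n, rule allI)
      fix j
      have "coset_at (\<Sum>j<q. of_falg (f j)) j n = apart j (\<Sum>j<q. f j) +o aI n j"
        unfolding of_falg_sum[symmetric] unfolding of_falg_def by (rule coset_at_mk[OF coherent_apart])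
      also have "\<dots> = r j n +o aI n j"
        using tail[OF M'(1) that] by (simp add: coset_eq_iff apart_same[OF acomp_sum[OF f]] r_def aI_0)
      finally show "coset_at (\<Sum>j<q. of_falg (f j)) j n = coset_at (mk_ahat r) j n"
        by (simp add: coset_at_mk[OF coh])
    qed
    then show "eventually (\<lambda>q. (\<Sum>j<q. of_falg (f j)) \<in> U) sequentially"
      by (auto simp: eventually_sequentially)
  qed
  then show ?thesis by (auto simp: summable_def sums_def)
qed


section \<open>The space \<open>F(B, N, \<eta>)\<close>\<close>

text \<open>The biadditive extension of \<open>N\<close> to \<open>Q\<^sub>B\<close>, and the induced map to \<open>\<complex>/\<int>\<close>.\<close>

definition biext :: "('b \<Rightarrow> 'b \<Rightarrow> complex) \<Rightarrow> 'b charge \<Rightarrow> 'b charge \<Rightarrow> complex" where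
  "biext N \<alpha> \<beta> = (\<Sum>a \<in> Poly_Mapping.keys \<alpha>. \<Sum>b \<in> Poly_Mapping.keys \<beta>.
     of_int (Poly_Mapping.lookup \<alpha> a) * of_int (Poly_Mapping.lookup \<beta> b) * N a b)"

definition Delta :: "('b \<Rightarrow> 'b \<Rightarrow> complex) \<Rightarrow> 'b charge \<Rightarrow> 'b charge \<Rightarrow> complex set" where
  "Delta N \<alpha> \<beta> = biext N \<alpha> \<beta> +o \<int>"

text \<open>
  Below, \<open>emb\<close> is the inclusion of \<open>\<complex>\<close> into the ground field.
\<close>

definition lterm :: "(complex \<Rightarrow> 'k::field) \<Rightarrow> ('b \<Rightarrow> 'b \<Rightarrow> complex) \<Rightarrow>
    ('b charge \<Rightarrow> 'b charge \<Rightarrow> complex) \<Rightarrow> 'b \<Rightarrow> 'b \<Rightarrow> complex \<Rightarrow> complex \<Rightarrow> nat \<Rightarrow> ('b, 'k) falg" where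
  "lterm emb N \<eta> a b s t j = scal (emb ((-1) ^ j * (N a b gchoose j))) *
     (gen a (s + N a b - of_nat j) * gen b (t + of_nat j)
      - scal (emb (\<eta> (bas a) (bas b) * exp (of_real pi * \<i> * N a b))) *
        (gen b (t + N a b - of_nat j) * gen a (s + of_nat j)))"

definition lrel :: "(complex \<Rightarrow> 'k::field) \<Rightarrow> ('b \<Rightarrow> 'b \<Rightarrow> complex) \<Rightarrow>
    ('b charge \<Rightarrow> 'b charge \<Rightarrow> complex) \<Rightarrow> 'b \<Rightarrow> 'b \<Rightarrow> complex \<Rightarrow> complex \<Rightarrow> ('b, 'k) ahat" where
  "lrel emb N \<eta> a b s t = suminf (\<lambda>j. of_falg (lterm emb N \<eta> a b s t j))"

text \<open>The series of \<open>lrel\<close> converges, so \<open>suminf\<close> denotes its sum.\<close>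

lemma keys_scal_mult: "Poly_Mapping.keys (scal c * u) \<subseteq> Poly_Mapping.keys u"
proof
  fix w assume "w \<in> Poly_Mapping.keys (scal c * u)"
  then obtain p q where "p \<in> Poly_Mapping.keys (scal c :: ('a, 'b) falg)" "q \<in> Poly_Mapping.keys u" "w = p + q"
    using Poly_Mapping.keys_mult[of "scal c" u] by blast
  then show "w \<in> Poly_Mapping.keys u" by (auto simp: scal_def split: if_splits)
qed

lemma scal_mult_acomp: "u \<in> acomp i \<Longrightarrow> scal c * u \<in> acomp i"
  using keys_scal_mult[of c u] unfolding acomp_def by blast

lemma gen_acomp: "gen a n \<in> acomp (bas a, - n - 1)"
  by (simp add: acomp_def gen_def monomial_def word_deg_def word_charge_def)

lemma lterm_acomp: "lterm emb N \<eta> a b s t j \<in> acomp (bas a + bas b, - s - N a b - t - 2)"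
proof -
  have 1: "gen a (s + N a b - of_nat j) * gen b (t + of_nat j) \<in>
      (acomp (bas a + bas b, - s - N a b - t - 2) :: ('a, 'b) falg set)"
    using acomp_mult[OF gen_acomp[of a "s + N a b - of_nat j"] gen_acomp[of b "t + of_nat j"]]
    by (simp add: algebra_simps plus_prod_def)
  have 2: "gen b (t + N a b - of_nat j) * gen a (s + of_nat j) \<in>
      (acomp (bas a + bas b, - s - N a b - t - 2) :: ('a, 'b) falg set)"
    using acomp_mult[OF gen_acomp[of b "t + N a b - of_nat j"] gen_acomp[of a "s + of_nat j"]]
    by (simp add: algebra_simps plus_prod_def)
  show ?thesis unfolding lterm_def
    using acomp_add[OF 1 acomp_minus[OF scal_mult_acomp[OF 2]]]
    by (intro scal_mult_acomp) simp
qed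

lemma gen_hull:
  assumes "real n \<le> Re m + real j"
  shows "gen b (m + of_nat j) \<in> left_ideal hull afilt (- int n - 1)"
proof -
  have "gen b (m + of_nat j) \<in> afilt (- int n - 1)"
    using assms by (simp add: afilt_def gen_def monomial_def word_deg_def)
  then show ?thesis by (rule hull_inc)
qed

lemma summable_lterm: "summable (\<lambda>j. of_falg (lterm emb N \<eta> a b s t j))"
proof (rule summable_of_falg, rule lterm_acomp)
  fix n
  define M where "M = nat \<lceil>real n - min (Re s) (Re t)\<rceil>"
  have "lterm emb N \<eta> a b s t j \<in> aI n (bas a + bas b, - s - N a b - t - 2)" if "j \<ge> M" for j
  proof -
    have j: "real n \<le> Re s + real j" "real n \<le> Re t + real j" using that unfolding M_def by linarith+
    have "lterm emb N \<eta> a b s t j \<in> left_ideal hull afilt (- int n - 1)"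
      unfolding lterm_def
      by (intro hull_lmult hull_diff gen_hull j)
    then show ?thesis using lterm_acomp by (simp add: aI_def)
  qed
  then show "eventually (\<lambda>j. lterm emb N \<eta> a b s t j \<in> aI n (bas a + bas b, - s - N a b - t - 2)) sequentially"
    by (auto simp: eventually_sequentially)
qed

text \<open>
  The componentwise closure \<open>\<Oplus>\<^sub>i closure (S \<inter> hcomp i)\<close>; \<open>hcomp i\<close> is closed, so the closure in it is the
  closure in the whole completion.
\<close>

definition cclosure :: "('b, 'k::field) ahat set \<Rightarrow> ('b, 'k) ahat set" where
  "cclosure S = {x. \<forall>i. hpart i x \<in> closure (S \<inter> hcomp i)}"

definition Iideal :: "(complex \<Rightarrow> 'k::field) \<Rightarrow> ('b \<Rightarrow> 'b \<Rightarrow> complex) \<Rightarrow>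
    ('b charge \<Rightarrow> 'b charge \<Rightarrow> complex) \<Rightarrow> ('b, 'k) ahat set" where
  "Iideal emb N \<eta> = two_sided_ideal hull {lrel emb N \<eta> a b s t | a b s t. True}"

definition Jideal :: "('b \<Rightarrow> 'b \<Rightarrow> complex) \<Rightarrow> ('b, 'k::field) ahat set" where
  "Jideal N = left_ideal hull
     ({of_falg (gen a n) | a n. n \<notin> of_int ` {..<0}} \<union>
      {of_falg (monomial ((a, n) # w)) | a n w.
         w \<noteq> [] \<and> n \<notin> biext N (bas a) (word_charge w) +o \<int>})"

definition Krel :: "(complex \<Rightarrow> 'k::field) \<Rightarrow> ('b \<Rightarrow> 'b \<Rightarrow> complex) \<Rightarrow>
    ('b charge \<Rightarrow> 'b charge \<Rightarrow> complex) \<Rightarrow> ('b, 'k) ahat set" where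
  "Krel emb N \<eta> = cclosure (Iideal emb N \<eta>) + cclosure (Jideal N)"

text \<open>
  The quotient as a vector space over \<open>'k\<close>; the ring multiplication that module records
  carry is irrelevant.
\<close>

definition Fspace :: "(complex \<Rightarrow> 'k::field) \<Rightarrow> ('b \<Rightarrow> 'b \<Rightarrow> complex) \<Rightarrow>
    ('b charge \<Rightarrow> 'b charge \<Rightarrow> complex) \<Rightarrow> ('k, ('b, 'k) ahat set) module" where
  "Fspace emb N \<eta> = \<lparr>carrier = {x +o Krel emb N \<eta> | x. True},
     monoid.mult = undefined, one = undefined,
     ring.zero = Krel emb N \<eta>, add = (\<lambda>C D. C + D),
     module.smult = (\<lambda>c C. (of_falg (scal c) *o C) + Krel emb N \<eta>)\<rparr>"

definition Fcomp :: "(complex \<Rightarrow> 'k::field) \<Rightarrow> ('b \<Rightarrow> 'b \<Rightarrow> complex) \<Rightarrow>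
    ('b charge \<Rightarrow> 'b charge \<Rightarrow> complex) \<Rightarrow> 'b charge \<Rightarrow> complex \<Rightarrow> ('b, 'k) ahat set set" where
  "Fcomp emb N \<eta> \<alpha> d = {x +o Krel emb N \<eta> | x. x \<in> hcomp (\<alpha>, d)}"

definition Fcharge :: "(complex \<Rightarrow> 'k::field) \<Rightarrow> ('b \<Rightarrow> 'b \<Rightarrow> complex) \<Rightarrow>
    ('b charge \<Rightarrow> 'b charge \<Rightarrow> complex) \<Rightarrow> 'b charge \<Rightarrow> ('b, 'k) ahat set set" where
  "Fcharge emb N \<eta> \<alpha> = {finsum (Fspace emb N \<eta>) g D | g D.
     finite D \<and> (\<forall>d \<in> D. g d \<in> Fcomp emb N \<eta> \<alpha> d)}"

text \<open>
  Left multiplication by \<open>u \<in> A\<close> on cosets. The result is a union of cosets of \<open>Krel\<close>, and it is a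
  single coset, i.e. an element of the carrier, exactly if the map is well-defined at \<open>C\<close>.
\<close>

definition Faction :: "(complex \<Rightarrow> 'k::field) \<Rightarrow> ('b \<Rightarrow> 'b \<Rightarrow> complex) \<Rightarrow>
    ('b charge \<Rightarrow> 'b charge \<Rightarrow> complex) \<Rightarrow> ('b, 'k) falg \<Rightarrow> ('b, 'k) ahat set \<Rightarrow> ('b, 'k) ahat set" where
  "Faction emb N \<eta> u C = (of_falg u *o C) + Krel emb N \<eta>"

text \<open>
  The series \<open>a(z) = \<Sum>\<^sub>n a(n) z\<^bsup>-n-1\<^esup>\<close>: the coefficient of \<open>z\<^sup>e\<close> is the action of \<open>a(-e-1)\<close>.
\<close>

definition Fseries :: "(complex \<Rightarrow> 'k::field) \<Rightarrow> ('b \<Rightarrow> 'b \<Rightarrow> complex) \<Rightarrow>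
    ('b charge \<Rightarrow> 'b charge \<Rightarrow> complex) \<Rightarrow> 'b \<Rightarrow> complex \<Rightarrow> ('b, 'k) ahat set \<Rightarrow> ('b, 'k) ahat set" where
  "Fseries emb N \<eta> a e = Faction emb N \<eta> (gen a (- e - 1))"

declare split_paired_All [simp] split_paired_Ex [simp]

end

theory Submission
  imports Defs
begin

text \<open>
  The charge relations in \<open>J\<close> kill \<open>a(n)b\<close> for \<open>b\<close> of charge \<open>\<beta>\<close> unless \<open>n \<in> N(a, \<beta>) + \<int>\<close>. The point is
  that \<open>a(n)b = 0\<close> for \<open>Re n\<close> large, and for this it suffices that the degrees \<open>d\<close> with
  \<open>F(\<alpha>, d) \<noteq> 0\<close> have real parts bounded below for each charge \<open>\<alpha>\<close>. Let \<open>C \<ge> Re N(a, b) + 1\<close> for all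
  letters \<open>a, b\<close> occurring in \<open>\<alpha>\<close>; a word \<open>a\<^sub>1(n\<^sub>1) \<dots> a\<^sub>m(n\<^sub>m)\<close> of degree with real part \<open>< -m\<^sup>2C\<close>
  vanishes in \<open>F\<close>, by induction on \<open>m\<close>. If \<open>Re n\<^sub>m > -1\<close>, it is in \<open>J\<close>. If
  \<open>Re n\<^sub>k - Re n\<^sub>k\<^sub>+\<^sub>1 < C\<close> for all \<open>k\<close>, the degree is too high. Otherwise the locality relation for a
  \<open>k\<close> violating this expresses the word by words in which the degree of the suffix starting at position \<open>k + 1\<close> has
  dropped by at least \<open>1\<close> and all other suffixes keep their degree, so that after finitely many
  steps some proper suffix vanishes by induction.
\<close>

declare split_paired_All [simp del] split_paired_Ex [simp del]

section \<open>The completion as a graded topological ring\<close>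

text \<open>Says that x maps to zero in the quotient of degree i by \<open>aI n i\<close>; the
  choice of \<open>rep_at\<close> is immaterial, as two representatives differ by an element of
  \<open>aI n i\<close>. Estimates of this kind replace open sets below.\<close>

definition vanish :: "nat \<Rightarrow> 'b charge \<times> complex \<Rightarrow> ('b, 'k::field) ahat \<Rightarrow> bool" where
  "vanish n i x \<longleftrightarrow> rep_at x i n \<in> aI n i"

lemma aI_cong_iff: "u - v \<in> aI n i \<Longrightarrow> u \<in> aI n i \<longleftrightarrow> v \<in> aI n i"
  using aI_add[of "u - v" n i v] aI_diff[of u n i "u - v"] by auto

lemma vanish_0: "vanish n i 0"
  by (simp add: vanish_def rep_zero)

lemma vanish_add: "vanish n i x \<Longrightarrow> vanish n i y \<Longrightarrow> vanish n i (x + y)"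
  using aI_cong_iff[OF rep_plus[of x y i n]] by (simp add: vanish_def aI_add)

lemma vanish_uminus: "vanish n i x \<Longrightarrow> vanish n i (- x)"
  using aI_cong_iff[OF rep_uminus[of x i n]] by (simp add: vanish_def aI_minus)

lemma vanish_diff: "vanish n i x \<Longrightarrow> vanish n i y \<Longrightarrow> vanish n i (x - y)"
  using aI_cong_iff[OF rep_minus[of x y i n]] by (simp add: vanish_def aI_diff)

lemma vanish_diff_iff: "vanish n i (x - y) \<longleftrightarrow> rep_at x i n - rep_at y i n \<in> aI n i"
  using aI_cong_iff[OF rep_minus[of x y i n]] by (simp add: vanish_def)

lemma vanish_diff_swap: "vanish n i (x - y) \<Longrightarrow> vanish n i (y - x)"
  using vanish_uminus[of n i "x - y"] by simp

lemma vanish_diff_trans: "vanish n i (x - y) \<Longrightarrow> vanish n i (y - z) \<Longrightarrow> vanish n i (x - z)"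
  using vanish_add[of n i "x - y" "y - z"] by simp

lemma vanish_cong_iff: "vanish n i (x - y) \<Longrightarrow> vanish n i x \<longleftrightarrow> vanish n i y"
  using vanish_add[of n i "x - y" y] vanish_diff[of n i x "x - y"] by auto

lemma vanish_sum: "(\<And>s. s \<in> S \<Longrightarrow> vanish n i (f s)) \<Longrightarrow> vanish n i (sum f S)"
  by (induction S rule: infinite_finite_induct) (auto simp: vanish_0 vanish_add)

lemma vanish_antimono:
  assumes "m \<le> n" "vanish n i x"
  shows "vanish m i x"
proof -
  have "rep_at x i n \<in> aI m i" using assms aI_antimono[of m n i] by (auto simp: vanish_def)
  then show ?thesis using aI_cong_iff[OF rep_le[OF assms(1), of x i]] by (simp add: vanish_def)
qed

lemma vanish_imp_0: "(\<And>i n. vanish n i x) \<Longrightarrow> x = 0"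
  by (rule ahat_eqI) (simp add: vanish_def aI_diff rep_zero)

lemma vanish_eqI: "(\<And>i n. vanish n i (x - y)) \<Longrightarrow> x = y"
  using vanish_imp_0[of "x - y"] by simp

lemma coset_at_eq_iff: "coset_at x i n = coset_at y i n \<longleftrightarrow> vanish n i (x - y)"
  by (simp add: coset_at_rep coset_eq_iff vanish_diff_iff)

lemma asupp_vanish: "asupp x \<subseteq> P \<longleftrightarrow> (\<forall>i n. i \<notin> P \<longrightarrow> vanish n i x)"
  by (auto simp: asupp_iff vanish_def subset_iff)

lemma hcomp_iff: "x \<in> hcomp i \<longleftrightarrow> (\<forall>j n. j \<noteq> i \<longrightarrow> vanish n j x)"
  using asupp_vanish[of x "{i}"] by (simp add: hcomp_def)

lemma hcomp_0: "0 \<in> hcomp i"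
  by (simp add: hcomp_iff vanish_0)

lemma hcomp_add: "x \<in> hcomp i \<Longrightarrow> y \<in> hcomp i \<Longrightarrow> x + y \<in> hcomp i"
  by (simp add: hcomp_iff vanish_add)

lemma hcomp_uminus: "x \<in> hcomp i \<Longrightarrow> - x \<in> hcomp i"
  by (simp add: hcomp_iff vanish_uminus)

lemma hcomp_diff: "x \<in> hcomp i \<Longrightarrow> y \<in> hcomp i \<Longrightarrow> x - y \<in> hcomp i"
  by (simp add: hcomp_iff vanish_diff)

lemma hcomp_sum: "(\<And>s. s \<in> S \<Longrightarrow> f s \<in> hcomp i) \<Longrightarrow> sum f S \<in> hcomp i"
  by (simp add: hcomp_iff vanish_sum)

lemma hcomp_1: "1 \<in> hcomp 0"
  using asupp_1 by (simp add: hcomp_def)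

lemma hcomp_eqI: "x \<in> hcomp i \<Longrightarrow> y \<in> hcomp i \<Longrightarrow> (\<And>n. vanish n i (x - y)) \<Longrightarrow> x = y"
  by (rule vanish_eqI) (metis hcomp_diff hcomp_iff)

lemma vanish_of_falg: "vanish n i (of_falg u) \<longleftrightarrow> apart i u \<in> aI n i"
  using aI_cong_iff[OF rep_of_falg[of u i n]] by (simp add: vanish_def)

lemma of_falg_hcomp: "u \<in> acomp i \<Longrightarrow> of_falg u \<in> hcomp i"
  by (simp add: hcomp_iff vanish_of_falg apart_same aI_0)

lemma of_falg_uminus: "of_falg (- u) = - of_falg u"
  using of_falg_add[of "- u" u] by (simp add: of_falg_0 eq_neg_iff_add_eq_0)

lemma of_falg_diff: "of_falg (u - v) = of_falg u - of_falg v"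
  using of_falg_add[of u "- v"] by (simp add: of_falg_uminus)

text \<open>The free algebra is dense in each degree: the n-th representative approximates x to
  order n. Nothing is claimed in the other degrees.\<close>

lemma vanish_approx: "vanish n i (x - of_falg (rep_at x i n))"
  using aI_diff_swap[OF rep_of_falg[of "rep_at x i n" i n]]
  by (simp add: vanish_diff_iff apart_same[OF rep_at_acomp])

text \<open>As in \<open>open_ahat\<close>, one order n serves all degrees at once: the points
  agreeing with x to order n in every degree form an open set, and these sets are a neighbourhood
  base at x.\<close>

lemma ahat_closure_iff: "x \<in> closure S \<longleftrightarrow> (\<forall>n. \<exists>y \<in> S. \<forall>i. vanish n i (x - y))"
proof (rule iffI)
  assume x: "x \<in> closure S"
  show "\<forall>n. \<exists>y \<in> S. \<forall>i. vanish n i (x - y)"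
  proof
    fix n
    let ?U = "{y. \<forall>i. coset_at y i n = coset_at x i n}"
    have "open ?U" unfolding open_ahat_def by (intro ballI exI[of _ n]) simp
    then obtain y where "y \<in> S" "y \<in> ?U"
      using x unfolding closure_iff_nhds_not_empty by blast
    then show "\<exists>y \<in> S. \<forall>i. vanish n i (x - y)" by (auto simp: coset_at_eq_iff intro: vanish_diff_swap)
  qed
next
  assume *: "\<forall>n. \<exists>y \<in> S. \<forall>i. vanish n i (x - y)"
  show "x \<in> closure S"
    unfolding closure_iff_nhds_not_empty
  proof (intro allI impI)
    fix A V assume "V \<subseteq> A" "open V" "x \<in> V"
    then obtain n where n: "\<And>y. (\<forall>i. coset_at y i n = coset_at x i n) \<Longrightarrow> y \<in> V"
      unfolding open_ahat_def by blast
    from * obtain y where "y \<in> S" "\<forall>i. vanish n i (x - y)" by blast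
    then show "S \<inter> A \<noteq> {}" using n[of y] \<open>V \<subseteq> A\<close> by (auto simp: coset_at_eq_iff intro: vanish_diff_swap)
  qed
qed

section \<open>Projections to sets of degrees\<close>

text \<open>P may be infinite, in contrast to the single degree of \<open>hpart\<close>: the
  component of charge \<open>\<alpha>\<close> is the projection to
  \<open>{\<alpha>} \<times> UNIV\<close>.\<close>

definition part :: "('b charge \<times> complex) set \<Rightarrow> ('b, 'k::field) ahat \<Rightarrow> ('b, 'k) ahat" where
  "part P x = mk_ahat (\<lambda>i n. if i \<in> P then rep_at x i n else 0)"

lemma coherent_part: "coherent (\<lambda>i n. if i \<in> P then rep_at x i n else 0)"
proof -
  have "{i. \<exists>n. (if i \<in> P then rep_at x i n else 0) \<notin> aI n i} \<subseteq> asupp x"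
    by (auto simp: asupp_iff aI_0)
  then have "finite {i. \<exists>n. (if i \<in> P then rep_at x i n else 0) \<notin> aI n i}"
    by (rule finite_subset) (rule finite_asupp)
  then show ?thesis using coherent_rep[of x] by (simp add: coherent_def acomp_0 aI_0)
qed

lemma hpart_eq_part: "hpart i x = part {i} x"
  unfolding hpart_def part_def by (rule arg_cong[of _ _ mk_ahat]) (auto intro!: ext)

lemma rep_part: "rep_at (part P x) i n - (if i \<in> P then rep_at x i n else 0) \<in> aI n i"
  unfolding part_def by (rule rep_mk[OF coherent_part])

lemma vanish_part_in: "i \<in> P \<Longrightarrow> vanish n i (part P x - x)"
  using rep_part[of P x i n] by (simp add: vanish_diff_iff)

lemma vanish_part_out: "i \<notin> P \<Longrightarrow> vanish n i (part P x)"
  using rep_part[of P x i n] by (simp add: vanish_def)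

text \<open>An element that vanishes to every order in every degree is 0, so the two conditions
  determine z. Most rules for \<open>part\<close> are read off from this without returning to
  representatives.\<close>

lemma part_unique:
  assumes "\<And>i n. i \<in> P \<Longrightarrow> vanish n i (z - x)" "\<And>i n. i \<notin> P \<Longrightarrow> vanish n i z"
  shows "part P x = z"
proof (rule vanish_eqI)
  fix i n
  show "vanish n i (part P x - z)"
  proof (cases "i \<in> P")
    case True
    show ?thesis by (rule vanish_diff_trans[OF vanish_part_in[OF True] vanish_diff_swap[OF assms(1)[OF True]]])
  next
    case False
    show ?thesis by (rule vanish_diff[OF vanish_part_out[OF False] assms(2)[OF False]])
  qed
qed

lemma part_add: "part P (x + y) = part P x + part P y"
proof (rule part_unique)
  fix i n assume "i \<in> P"
  then show "vanish n i (part P x + part P y - (x + y))"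
    using vanish_add[OF vanish_part_in[of i P n x] vanish_part_in[of i P n y]] by (simp add: algebra_simps)
qed (simp add: vanish_add vanish_part_out)

lemma part_0: "part P 0 = 0"
  by (rule part_unique) (simp_all add: vanish_0)

lemma part_uminus: "part P (- x) = - part P x"
  using part_add[of P "- x" x] by (simp add: part_0 eq_neg_iff_add_eq_0)

lemma part_diff: "part P (x - y) = part P x - part P y"
  using part_add[of P x "- y"] by (simp add: part_uminus)

lemma part_sum: "part P (sum f S) = (\<Sum>s\<in>S. part P (f s))"
  by (induction S rule: infinite_finite_induct) (simp_all add: part_0 part_add)

lemma part_id: "asupp x \<subseteq> P \<Longrightarrow> part P x = x"
  by (rule part_unique) (simp_all add: vanish_0 asupp_vanish)

lemma part_eq_0: "asupp x \<inter> P = {} \<Longrightarrow> part P x = 0"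
proof (rule part_unique)
  fix i n assume "asupp x \<inter> P = {}" "i \<in> P"
  then have "vanish n i x" unfolding vanish_def by (intro rep_not_supp) blast
  then show "vanish n i (0 - x)" by (simp add: vanish_uminus)
qed (rule vanish_0)

lemma part_part: "part P (part R x) = part (P \<inter> R) x"
proof (rule sym, rule part_unique)
  fix i n
  show "vanish n i (part P (part R x) - x)" if "i \<in> P \<inter> R"
    using that vanish_diff_trans[OF vanish_part_in[of i P n "part R x"] vanish_part_in[of i R n x]] by simp
  show "vanish n i (part P (part R x))" if "i \<notin> P \<inter> R"
  proof (cases "i \<in> P")
    case True
    then show ?thesis
      using that vanish_cong_iff[OF vanish_part_in[OF True, of n "part R x"]] by (simp add: vanish_part_out)
  qed (rule vanish_part_out)
qed

lemma asupp_part: "asupp (part P x) \<subseteq> P"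
  by (simp add: asupp_vanish vanish_part_out)

lemma part_hcomp: "part {i} x \<in> hcomp i"
  using asupp_part[of "{i}" x] by (simp add: hcomp_def)

lemma part_of_hcomp: "x \<in> hcomp i \<Longrightarrow> part P x = (if i \<in> P then x else 0)"
  by (auto simp: hcomp_def part_id intro!: part_eq_0 part_id)

lemma part_insert: "i \<notin> P \<Longrightarrow> part (insert i P) x = part {i} x + part P x"
proof (rule part_unique)
  fix j n assume "i \<notin> P"
  show "vanish n j (part {i} x + part P x - x)" if "j \<in> insert i P"
  proof (cases "j = i")
    case True
    then show ?thesis using vanish_add[OF vanish_part_in[of j "{i}" n x] vanish_part_out[of j P n x]]
      \<open>i \<notin> P\<close> by (simp add: algebra_simps)
  next
    case False
    then show ?thesis using vanish_add[OF vanish_part_in[of j P n x] vanish_part_out[of j "{i}" n x]]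
      that by (simp add: algebra_simps)
  qed
qed (simp add: vanish_add vanish_part_out)

lemma part_finite: "finite S \<Longrightarrow> part S x = (\<Sum>i\<in>S. part {i} x)"
proof (induction S rule: finite_induct)
  case empty
  show ?case by (simp add: part_eq_0)
next
  case (insert i S)
  then show ?case using part_insert[of i S x] by simp
qed

lemma ahat_decomp: "x = (\<Sum>i\<in>asupp x. part {i} x)"
  by (rule trans[OF sym[OF part_id[OF order.refl]] part_finite[OF finite_asupp]])

lemma part_Compl: "part P x + part (- P) x = x"
proof (rule vanish_eqI)
  fix i n
  show "vanish n i (part P x + part (- P) x - x)"
  proof (cases "i \<in> P")
    case True
    then show ?thesis using vanish_add[OF vanish_part_in[OF True, of n x] vanish_part_out[of i "- P" n x]]
      by (simp add: algebra_simps)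
  next
    case False
    then show ?thesis using vanish_add[OF vanish_part_in[of i "- P" n x] vanish_part_out[OF False, of n x]]
      by (simp add: algebra_simps)
  qed
qed

section \<open>Products of homogeneous elements\<close>

lemma rep_times_hcomp:
  assumes "x \<in> hcomp i" "y \<in> hcomp j" "m \<ge> n + shift j"
  shows "rep_at (x * y) (i + j) n - rep_at x i m * rep_at y j n \<in> aI n (i + j)"
proof -
  have "rep_at (x * y) (i + j) n - psum x y {i} {j} (\<lambda>_. m) (i + j) n \<in> aI n (i + j)"
    by (rule rep_times) (use assms in \<open>simp_all add: hcomp_def\<close>)
  then show ?thesis unfolding psum_def by simp
qed

lemma mult_hcomp: "x \<in> hcomp i \<Longrightarrow> y \<in> hcomp j \<Longrightarrow> x * y \<in> hcomp (i + j)"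
proof -
  assume "x \<in> hcomp i" "y \<in> hcomp j"
  then have "asupp x + asupp y \<subseteq> {i} + {j}" unfolding hcomp_def by (intro set_plus_mono2) blast+
  then show "x * y \<in> hcomp (i + j)" using asupp_times[of x y] by (simp add: hcomp_def set_plus_def)
qed

lemma vanish_lmult:
  assumes "x \<in> hcomp i" "y \<in> hcomp j" "vanish n j y"
  shows "vanish n (i + j) (x * y)"
  using aI_cong_iff[OF rep_times_hcomp[OF assms(1,2) order.refl]] assms(3)
  by (simp add: vanish_def aI_lmult rep_at_acomp)

text \<open>Unlike left multiplication, right multiplication by an element of degree j can raise the
  real part of the degree of a suffix, by at most \<open>shift j\<close>; the order of x is larger
  than n by at least that amount to compensate.\<close>

lemma vanish_rmult:
  assumes "x \<in> hcomp i" "y \<in> hcomp j" "vanish m i x" "m \<ge> n + shift j"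
  shows "vanish n (i + j) (x * y)"
  using aI_cong_iff[OF rep_times_hcomp[OF assms(1,2,4)]] assms(3,4)
  by (simp add: vanish_def aI_rmult rep_at_acomp)

lemma of_falg_mult:
  assumes "u \<in> acomp i" "v \<in> acomp j"
  shows "of_falg (u * v) = of_falg u * of_falg v"
proof (rule hcomp_eqI)
  show "of_falg (u * v) \<in> hcomp (i + j)" by (intro of_falg_hcomp acomp_mult assms)
  show "of_falg u * of_falg v \<in> hcomp (i + j)" by (intro mult_hcomp of_falg_hcomp assms)
  fix n
  let ?m = "n + shift j"
  have 1: "rep_at (of_falg (u * v)) (i + j) n - u * v \<in> aI n (i + j)"
    using rep_of_falg[of "u * v" "i + j" n] by (simp add: apart_same[OF acomp_mult[OF assms]])
  have 2: "rep_at (of_falg u * of_falg v) (i + j) n - rep_at (of_falg u) i ?m * rep_at (of_falg v) j n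
      \<in> aI n (i + j)"
    by (intro rep_times_hcomp of_falg_hcomp assms order.refl)
  have 3: "rep_at (of_falg u) i ?m * rep_at (of_falg v) j n - u * v \<in> aI n (i + j)"
    by (rule aI_prod_cong[OF _ _ _ _ order.refl])
      (use rep_of_falg[of u i ?m] rep_of_falg[of v j n] in
        \<open>simp_all add: apart_same[OF assms(1)] apart_same[OF assms(2)] assms rep_at_acomp\<close>)
  show "vanish n (i + j) (of_falg (u * v) - of_falg u * of_falg v)"
    unfolding vanish_diff_iff by (rule aI_diff_trans[OF 1 aI_diff_swap[OF aI_diff_trans[OF 2 3]]])
qed

text \<open>The components of x in degrees other than k - i are moved by g to degrees other than
  k.\<close>

lemma part_lmult:
  assumes "g \<in> hcomp i"
  shows "part {k} (g * x) = g * part {k - i} x"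
proof -
  let ?y = "part (- {k - i}) x"
  have "x = part {k - i} x + ?y"
    using part_Compl[of "{k - i}" x] by simp
  then have "g * x = g * part {k - i} x + g * ?y" by (metis distrib_left)
  moreover have "asupp (g * ?y) \<inter> {k} = {}"
  proof -
    have "asupp (g * ?y) \<subseteq> {i} + - {k - i}"
      using asupp_times[of g ?y] set_plus_mono2[of "asupp g" "{i}" "asupp ?y" "- {k - i}"]
        asupp_part[of "- {k - i}" x] assms unfolding hcomp_def by blast
    also have "\<dots> \<subseteq> - {k}" by (auto simp: set_plus_def)
    finally show ?thesis by blast
  qed
  then have "part {k} (g * ?y) = 0" by (rule part_eq_0)
  moreover have "part {k} (g * part {k - i} x) = g * part {k - i} x"
    using part_of_hcomp[OF mult_hcomp[OF assms part_hcomp[of "k - i" x]], of "{k}"] by simp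
  ultimately show ?thesis by (simp add: part_add)
qed

section \<open>Componentwise closures of left ideals\<close>

lemma left_ideal_0: "left_ideal L \<Longrightarrow> 0 \<in> L"
  and left_ideal_add: "left_ideal L \<Longrightarrow> x \<in> L \<Longrightarrow> y \<in> L \<Longrightarrow> x + y \<in> L"
  and left_ideal_lmult: "left_ideal L \<Longrightarrow> x \<in> L \<Longrightarrow> r * x \<in> L"
  by (simp_all add: left_ideal_def)

lemma closure_hcomp_subset: "closure (S \<inter> hcomp i) \<subseteq> hcomp i"
proof
  fix x assume x: "x \<in> closure (S \<inter> hcomp i)"
  show "x \<in> hcomp i" unfolding hcomp_iff
  proof (intro allI impI)
    fix j n assume "j \<noteq> i"
    obtain y where "y \<in> hcomp i" "\<forall>i. vanish n i (x - y)"
      using x unfolding ahat_closure_iff by blast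
    then show "vanish n j x" using vanish_cong_iff[of n j x y] \<open>j \<noteq> i\<close> by (auto simp: hcomp_iff)
  qed
qed

lemma closure_hcomp_add:
  assumes L: "left_ideal L" and "x \<in> closure (L \<inter> hcomp i)" "y \<in> closure (L \<inter> hcomp i)"
  shows "x + y \<in> closure (L \<inter> hcomp i)"
  unfolding ahat_closure_iff
proof
  fix n
  obtain x' y' where *: "x' \<in> L \<inter> hcomp i" "y' \<in> L \<inter> hcomp i"
    "\<forall>i. vanish n i (x - x')" "\<forall>i. vanish n i (y - y')"
    using assms unfolding ahat_closure_iff by blast
  have "\<forall>i. vanish n i (x + y - (x' + y'))"
    using *(3,4) vanish_add[of n _ "x - x'" "y - y'"] by (simp add: algebra_simps)
  then show "\<exists>z \<in> L \<inter> hcomp i. \<forall>i. vanish n i (x + y - z)"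
    using * by (intro bexI[of _ "x' + y'"]) (auto simp: hcomp_add left_ideal_add[OF L])
qed

text \<open>Since \<open>aI n\<close> absorbs left factors, g * y approximates g * x to the same
  order n to which y approximates x.\<close>

lemma closure_hcomp_lmult:
  assumes L: "left_ideal L" and g: "g \<in> hcomp k" and x: "x \<in> closure (L \<inter> hcomp i)"
  shows "g * x \<in> closure (L \<inter> hcomp (k + i))"
  unfolding ahat_closure_iff
proof
  fix n
  obtain y where y: "y \<in> L \<inter> hcomp i" "\<forall>i. vanish n i (x - y)"
    using x unfolding ahat_closure_iff by blast
  have xy: "x - y \<in> hcomp i" using x y closure_hcomp_subset hcomp_diff by blast
  have gxy: "g * (x - y) \<in> hcomp (k + i)" by (rule mult_hcomp[OF g xy])
  have "vanish n (k + i) (g * (x - y))" by (rule vanish_lmult[OF g xy]) (use y in blast)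
  then have "vanish n j (g * x - g * y)" for j
    using gxy by (cases "j = k + i") (auto simp: hcomp_iff right_diff_distrib)
  then show "\<exists>z \<in> L \<inter> hcomp (k + i). \<forall>i. vanish n i (g * x - z)"
    using y g by (intro bexI[of _ "g * y"]) (auto simp: mult_hcomp left_ideal_lmult[OF L])
qed

lemma cclosure_iff: "x \<in> cclosure S \<longleftrightarrow> (\<forall>i. part {i} x \<in> closure (S \<inter> hcomp i))"
  by (simp add: cclosure_def hpart_eq_part)

lemma closure_hcomp_0: "left_ideal L \<Longrightarrow> 0 \<in> closure (L \<inter> hcomp i)"
  by (rule subsetD[OF closure_subset]) (simp add: left_ideal_0 hcomp_0)

lemma cclosure_0: "left_ideal L \<Longrightarrow> 0 \<in> cclosure L"
  by (simp add: cclosure_iff part_0 closure_hcomp_0)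

lemma cclosure_add: "left_ideal L \<Longrightarrow> x \<in> cclosure L \<Longrightarrow> y \<in> cclosure L \<Longrightarrow> x + y \<in> cclosure L"
  by (simp add: cclosure_iff part_add closure_hcomp_add)

lemma cclosure_lmult:
  assumes "left_ideal L" "g \<in> hcomp k" "x \<in> cclosure L"
  shows "g * x \<in> cclosure L"
  unfolding cclosure_iff
proof
  fix i
  have "g * part {i - k} x \<in> closure (L \<inter> hcomp (k + (i - k)))"
    by (rule closure_hcomp_lmult) (use assms in \<open>simp_all add: cclosure_iff\<close>)
  then show "part {i} (g * x) \<in> closure (L \<inter> hcomp i)" by (simp add: part_lmult[OF assms(2)])
qed

lemma cclosure_part:
  assumes "left_ideal L" "x \<in> cclosure L"
  shows "part P x \<in> cclosure L"
  unfolding cclosure_iff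
proof
  fix i
  show "part {i} (part P x) \<in> closure (L \<inter> hcomp i)"
    using assms by (cases "i \<in> P") (auto simp: part_part cclosure_iff closure_hcomp_0 part_eq_0)
qed

lemma cclosure_hcomp: "left_ideal L \<Longrightarrow> x \<in> hcomp i \<Longrightarrow> x \<in> cclosure L \<longleftrightarrow> x \<in> closure (L \<inter> hcomp i)"
  by (auto simp: cclosure_iff part_of_hcomp closure_hcomp_0 dest: spec[of _ i])

lemma ideal_hcomp_cclosure: "left_ideal L \<Longrightarrow> x \<in> L \<Longrightarrow> x \<in> hcomp i \<Longrightarrow> x \<in> cclosure L"
  using cclosure_hcomp closure_subset[of "L \<inter> hcomp i"] by blast

lemma cclosure_sum:
  "left_ideal L \<Longrightarrow> (\<And>s. s \<in> S \<Longrightarrow> f s \<in> cclosure L) \<Longrightarrow> sum f S \<in> cclosure L"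
  by (induction S rule: infinite_finite_induct) (auto simp: cclosure_0 cclosure_add)

section \<open>Limits of series in the completion\<close>

lemma hcomp_complete:
  fixes y :: "nat \<Rightarrow> ('b, 'k::field) ahat"
  assumes "\<And>r. y r \<in> hcomp i" "\<And>r. vanish r i (y r)"
  shows "\<exists>Y \<in> hcomp i. \<forall>n. vanish n i (Y - (\<Sum>r<n. y r))"
proof -
  define s where "s n = (\<Sum>r<n. y r)" for n
  \<comment> \<open>A diagonal choice: level n of the limit is read off from the n-th partial sum,
    which the later terms leave unchanged at that level.\<close>
  define f where "f j n = (if j = i then rep_at (s n) i n else 0)" for j n
  have d: "f i (Suc n) - f i n \<in> aI n i" for n
  proof -
    have "vanish n i (s (Suc n) - s n)" by (simp add: s_def assms)
    then have "rep_at (s (Suc n)) i n - rep_at (s n) i n \<in> aI n i" by (simp add: vanish_diff_iff)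
    from aI_diff_trans[OF rep_le[of n "Suc n"] this] show ?thesis by (simp add: f_def)
  qed
  have "{j. \<exists>n. f j n \<notin> aI n j} \<subseteq> {i}" by (auto simp: f_def aI_0 split: if_splits)
  then have "finite {j. \<exists>n. f j n \<notin> aI n j}" by (rule finite_subset) simp
  moreover have "f j (Suc n) - f j n \<in> aI n j" for j n
    using d[of n] by (cases "j = i") (auto simp: f_def aI_0)
  ultimately have coh: "coherent f"
    by (auto simp: coherent_def f_def rep_at_acomp acomp_0)
  have rep: "rep_at (mk_ahat f) j n - f j n \<in> aI n j" for j n by (rule rep_mk[OF coh])
  have "mk_ahat f \<in> hcomp i"
    using rep by (fastforce simp: hcomp_iff vanish_def f_def split: if_splits)
  moreover have "vanish n i (mk_ahat f - s n)" for n
    using rep[of i n] by (simp add: vanish_diff_iff f_def)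
  ultimately show ?thesis unfolding s_def by blast
qed

text \<open>The limit is approximated to order n by its n-th partial sum, and that in turn by an
  element of L, so it stays in the closure.\<close>

lemma cclosure_complete:
  fixes y :: "nat \<Rightarrow> ('b, 'k::field) ahat"
  assumes L: "left_ideal L" and y: "\<And>r. y r \<in> cclosure L" "\<And>r. y r \<in> hcomp i" "\<And>r. vanish r i (y r)"
  shows "\<exists>Y \<in> cclosure L \<inter> hcomp i. \<forall>n. vanish n i (Y - (\<Sum>r<n. y r))"
proof -
  obtain Y where Y: "Y \<in> hcomp i" "\<And>n. vanish n i (Y - (\<Sum>r<n. y r))"
    using hcomp_complete[OF y(2,3)] by blast
  have "Y \<in> closure (L \<inter> hcomp i)"
    unfolding ahat_closure_iff
  proof
    fix n
    have "(\<Sum>r<n. y r) \<in> cclosure L" "(\<Sum>r<n. y r) \<in> hcomp i"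
      using y by (simp_all add: cclosure_sum[OF L] hcomp_sum)
    then have "(\<Sum>r<n. y r) \<in> closure (L \<inter> hcomp i)" using cclosure_hcomp[OF L] by blast
    then obtain z where z: "z \<in> L \<inter> hcomp i" "\<forall>j. vanish n j ((\<Sum>r<n. y r) - z)"
      unfolding ahat_closure_iff by blast
    have "vanish n j (Y - z)" for j
      using vanish_diff_trans[OF Y(2)[of n]] z Y(1) hcomp_diff[of Y i z]
      by (cases "j = i") (auto simp: hcomp_iff)
    then show "\<exists>z \<in> L \<inter> hcomp i. \<forall>j. vanish n j (Y - z)" using z by blast
  qed
  then show ?thesis using Y cclosure_hcomp[OF L] by blast
qed

text \<open>
  A sum of two closed ideals need not be closed; decompositions that respect the filtration
  make the limits of both summands exist.
\<close>

lemma cclosure_plus_limit: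
  fixes x :: "('b, 'k::field) ahat"
  assumes I: "left_ideal I" and J: "left_ideal J"
    and dec: "\<And>n u. n \<ge> m \<Longrightarrow> u \<in> aI n i \<Longrightarrow>
      \<exists>y \<in> cclosure I \<inter> hcomp i. \<exists>z \<in> cclosure J \<inter> hcomp i.
        vanish n i y \<and> vanish n i z \<and> of_falg u = y + z"
    and x: "x \<in> hcomp i" "vanish m i x"
  shows "x \<in> cclosure I + cclosure J"
proof -
  \<comment> \<open>In the limit, x is its representative at level m plus the series of the
    increments \<open>u r\<close>, and \<open>dec\<close> applies to the increment
    \<open>u r\<close> at level m + r.\<close>
  define u where "u r = rep_at x i (m + Suc r) - rep_at x i (m + r)" for r
  have u: "u r \<in> aI (m + r) i" for r unfolding u_def by (rule rep_le) simp
  have "\<forall>r. \<exists>y z. y \<in> cclosure I \<inter> hcomp i \<and> z \<in> cclosure J \<inter> hcomp i \<and>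
     vanish (m + r) i y \<and> vanish (m + r) i z \<and> of_falg (u r) = y + z"
    using dec[OF _ u] by (meson le_add1)
  then obtain y z where yz: "\<And>r. y r \<in> cclosure I \<inter> hcomp i" "\<And>r. z r \<in> cclosure J \<inter> hcomp i"
    "\<And>r. vanish (m + r) i (y r)" "\<And>r. vanish (m + r) i (z r)" "\<And>r. of_falg (u r) = y r + z r"
    by metis
  obtain Y where Y: "Y \<in> cclosure I \<inter> hcomp i" "\<And>n. vanish n i (Y - (\<Sum>r<n. y r))"
    using cclosure_complete[OF I, of y i] yz vanish_antimono[OF le_add2] by blast
  obtain Z where Z: "Z \<in> cclosure J \<inter> hcomp i" "\<And>n. vanish n i (Z - (\<Sum>r<n. z r))"
    using cclosure_complete[OF J, of z i] yz vanish_antimono[OF le_add2] by blast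
  have "rep_at x i m \<in> aI m i" using x by (simp add: vanish_def)
  from dec[OF order.refl this] obtain y' z' where yz': "y' \<in> cclosure I \<inter> hcomp i" "z' \<in> cclosure J \<inter> hcomp i"
    "of_falg (rep_at x i m) = y' + z'" by blast
  \<comment> \<open>Here y' and z' come from the representative at level m, while Y and Z collect
    the increments.\<close>
  have "x = (y' + Y) + (z' + Z)"
  proof (rule hcomp_eqI)
    show "x \<in> hcomp i" by (rule x)
    show "(y' + Y) + (z' + Z) \<in> hcomp i" using yz' Y Z by (simp add: hcomp_add)
    fix n
    have "(\<Sum>r<n. y r) + (\<Sum>r<n. z r) = of_falg (\<Sum>r<n. u r)"
      by (simp add: of_falg_sum yz sum.distrib)
    also have "(\<Sum>r<n. u r) = rep_at x i (m + n) - rep_at x i m"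
      unfolding u_def using sum_lessThan_telescope[of "\<lambda>r. rep_at x i (m + r)" n] by simp
    finally have sums: "y' + z' + ((\<Sum>r<n. y r) + (\<Sum>r<n. z r)) = of_falg (rep_at x i (m + n))"
      by (simp add: of_falg_diff yz')
    then have "x - ((y' + Y) + (z' + Z)) = (x - of_falg (rep_at x i (m + n)))
        - ((Y - (\<Sum>r<n. y r)) + (Z - (\<Sum>r<n. z r)))"
      by (simp add: algebra_simps flip: sums)
    moreover have "vanish n i (x - of_falg (rep_at x i (m + n)))"
      by (rule vanish_antimono[OF _ vanish_approx]) simp
    moreover have "vanish n i ((Y - (\<Sum>r<n. y r)) + (Z - (\<Sum>r<n. z r)))"
      by (intro vanish_add Y Z)
    ultimately show "vanish n i (x - ((y' + Y) + (z' + Z)))" by (simp only: vanish_diff)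
  qed
  then show ?thesis using cclosure_add[OF I, of y' Y] cclosure_add[OF J, of z' Z] yz' Y Z
    by (auto intro: set_plus_intro)
qed

section \<open>Words modulo the relations\<close>

lemma two_sided_ideal_hull: "two_sided_ideal (two_sided_ideal hull S)"
  unfolding two_sided_ideal_def left_ideal_def hull_def by auto

lemma left_ideal_Iideal: "left_ideal (Iideal emb N \<eta>)"
  using two_sided_ideal_hull unfolding Iideal_def two_sided_ideal_def by blast

lemma Iideal_rmult: "x \<in> Iideal emb N \<eta> \<Longrightarrow> x * r \<in> Iideal emb N \<eta>"
  using two_sided_ideal_hull unfolding Iideal_def two_sided_ideal_def by blast

lemma lrel_Iideal: "lrel emb N \<eta> a b s t \<in> Iideal emb N \<eta>"
  unfolding Iideal_def by (rule hull_inc) blast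

lemma left_ideal_Jideal: "left_ideal (Jideal N)"
  unfolding Jideal_def by (rule left_ideal_hull)

lemmas left_ideals = left_ideal_Iideal left_ideal_Jideal

lemma Krel_I: "x \<in> cclosure (Iideal emb N \<eta>) \<Longrightarrow> x \<in> Krel emb N \<eta>"
  unfolding Krel_def using set_plus_intro[OF _ cclosure_0[OF left_ideal_Jideal]] by fastforce

lemma Krel_J: "x \<in> cclosure (Jideal N) \<Longrightarrow> x \<in> Krel emb N \<eta>"
  unfolding Krel_def using set_plus_intro[OF cclosure_0[OF left_ideal_Iideal]] by fastforce

lemma Krel_0: "0 \<in> Krel emb N \<eta>"
  by (intro Krel_I cclosure_0 left_ideals)

lemma Krel_add:
  assumes "x \<in> Krel emb N \<eta>" "y \<in> Krel emb N \<eta>"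
  shows "x + y \<in> Krel emb N \<eta>"
proof -
  obtain x1 x2 y1 y2 where *: "x = x1 + x2" "y = y1 + y2"
    "x1 \<in> cclosure (Iideal emb N \<eta>)" "y1 \<in> cclosure (Iideal emb N \<eta>)"
    "x2 \<in> cclosure (Jideal N)" "y2 \<in> cclosure (Jideal N)"
    using assms unfolding Krel_def by (auto elim!: set_plus_elim)
  have "(x1 + y1) + (x2 + y2) \<in> Krel emb N \<eta>"
    unfolding Krel_def using * by (intro set_plus_intro cclosure_add left_ideals)
  then show ?thesis by (simp add: * algebra_simps)
qed

lemma Krel_lmult:
  assumes "g \<in> hcomp k" "x \<in> Krel emb N \<eta>"
  shows "g * x \<in> Krel emb N \<eta>"
proof -
  obtain x1 x2 where *: "x = x1 + x2" "x1 \<in> cclosure (Iideal emb N \<eta>)" "x2 \<in> cclosure (Jideal N)"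
    using assms(2) unfolding Krel_def by (rule set_plus_elim)
  show ?thesis unfolding Krel_def *(1) distrib_left
    using * by (intro set_plus_intro cclosure_lmult[OF _ assms(1)] left_ideals)
qed

lemma Krel_uminus: "x \<in> Krel emb N \<eta> \<Longrightarrow> - x \<in> Krel emb N \<eta>"
  using Krel_lmult[OF hcomp_uminus[OF hcomp_1], of x] by simp

lemma Krel_diff: "x \<in> Krel emb N \<eta> \<Longrightarrow> y \<in> Krel emb N \<eta> \<Longrightarrow> x - y \<in> Krel emb N \<eta>"
  using Krel_add[of x _ _ _ "- y"] Krel_uminus[of y] by simp

lemma Krel_sum: "(\<And>s. s \<in> S \<Longrightarrow> f s \<in> Krel emb N \<eta>) \<Longrightarrow> sum f S \<in> Krel emb N \<eta>"
  by (induction S rule: infinite_finite_induct) (auto simp: Krel_0 Krel_add)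

lemma Krel_part:
  assumes "x \<in> Krel emb N \<eta>"
  shows "part P x \<in> Krel emb N \<eta>"
proof -
  obtain x1 x2 where *: "x = x1 + x2" "x1 \<in> cclosure (Iideal emb N \<eta>)" "x2 \<in> cclosure (Jideal N)"
    using assms unfolding Krel_def by (rule set_plus_elim)
  show ?thesis unfolding Krel_def *(1) part_add
    using * by (intro set_plus_intro cclosure_part left_ideals)
qed

text \<open>Both closures are stable under projection to a degree, so any decomposition of a
  homogeneous x can be projected to its degree.\<close>

lemma Krel_hcompE:
  assumes "x \<in> Krel emb N \<eta>" "x \<in> hcomp i"
  obtains y z where "y \<in> cclosure (Iideal emb N \<eta>) \<inter> hcomp i" "z \<in> cclosure (Jideal N) \<inter> hcomp i"
    "x = y + z"
proof -
  obtain x1 x2 where *: "x = x1 + x2" "x1 \<in> cclosure (Iideal emb N \<eta>)" "x2 \<in> cclosure (Jideal N)"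
    using assms unfolding Krel_def by (auto elim!: set_plus_elim)
  have "x = part {i} x1 + part {i} x2"
    using part_of_hcomp[OF assms(2), of "{i}"] by (simp add: * part_add)
  then show ?thesis
    using that * cclosure_part[OF left_ideal_Iideal] cclosure_part[OF left_ideal_Jideal] part_hcomp
    by blast
qed

section \<open>Words and their degrees\<close>

lemma monomial_mult: "monomial v * monomial w = monomial (v @ w)"
  by (simp add: monomial_def mult_single plus_list_def)

lemma gen_mult_monomial: "gen a n * monomial w = monomial ((a, n) # w)"
  by (simp add: gen_def monomial_mult)

lemma monomial_acomp: "monomial w \<in> acomp (word_deg w)"
  by (simp add: acomp_def monomial_def)

lemma monomial_hcomp: "of_falg (monomial w) \<in> hcomp (word_deg w)"
  by (intro of_falg_hcomp monomial_acomp)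

lemma of_falg_monomial_append: "of_falg (monomial (v @ w)) = of_falg (monomial v) * of_falg (monomial w)"
  by (simp add: of_falg_mult[OF monomial_acomp monomial_acomp] flip: monomial_mult)

lemma word_deg_append: "word_deg (v @ w) = word_deg v + word_deg w"
  using word_deg_plus[of v w] by (simp add: plus_list_def)

lemma word_deg_Nil: "word_deg [] = 0"
  using word_deg_zero by (simp add: zero_list_def)

lemma word_deg_Cons: "word_deg ((a, n) # w) = (bas a, - n - 1) + word_deg w"
  by (simp add: word_deg_def word_charge_def)

lemma scal_acomp: "scal c \<in> acomp 0"
  by (simp add: acomp_def scal_def word_deg_zero)

lemma scal_hcomp: "of_falg (scal c) \<in> hcomp 0"
  by (intro of_falg_hcomp scal_acomp)

lemma scal_mult_monomial: "scal c * monomial w = Poly_Mapping.single w c"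
  by (simp add: scal_def monomial_def mult_single)

lemma monomial_mult_scal: "monomial w * scal c = scal c * monomial w"
  by (simp add: scal_def monomial_def mult_single)

lemma of_falg_scal_mult: "u \<in> acomp i \<Longrightarrow> of_falg (scal c * u) = of_falg (scal c) * of_falg u"
  by (rule of_falg_mult[OF scal_acomp])

lemma of_falg_expand:
  assumes "u \<in> acomp i"
  shows "of_falg u = (\<Sum>w\<in>Poly_Mapping.keys u.
    of_falg (scal (Poly_Mapping.lookup u w)) * of_falg (monomial w))"
proof -
  have "{w \<in> Poly_Mapping.keys u. word_deg w = i} = Poly_Mapping.keys u"
    using assms by (auto simp: acomp_def)
  then have "u = (\<Sum>w\<in>Poly_Mapping.keys u. Poly_Mapping.single w (Poly_Mapping.lookup u w))"
    using apart_same[OF assms, of i] by (simp add: apart_def)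
  then have "of_falg u = (\<Sum>w\<in>Poly_Mapping.keys u. of_falg (Poly_Mapping.single w (Poly_Mapping.lookup u w)))"
    by (metis (no_types) of_falg_sum)
  then show ?thesis
    by (simp add: of_falg_scal_mult[OF monomial_acomp] flip: scal_mult_monomial)
qed

lemma lookup_word_charge: "Poly_Mapping.lookup (word_charge w) a = int (count (mset (map fst w)) a)"
  by (induction w) (auto simp: word_charge_def lookup_add lookup_single when_def)

text \<open>As the charge group is free on the letters, the charge of a word records the multiset of
  its letters. This makes length an induction parameter for whole degrees, and lets one constant
  bound N on the letters of all words of a charge.\<close>

lemma word_charge_eqD:
  assumes "word_charge v = word_charge w"
  shows "length v = length w" "fst ` set v = fst ` set w"
proof -
  have "count (mset (map fst v)) a = count (mset (map fst w)) a" for a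
    using lookup_word_charge[of v a] lookup_word_charge[of w a] assms by simp
  then have *: "mset (map fst v) = mset (map fst w)" by (rule multiset_eqI)
  from arg_cong[OF *, of size] show "length v = length w" by simp
  from arg_cong[OF *, of set_mset] show "fst ` set v = fst ` set w" by simp
qed

lemma word_deg_eqD:
  assumes "word_deg v = word_deg w"
  shows "length v = length w" "fst ` set v = fst ` set w"
  using word_charge_eqD[of v w] assms by (simp_all add: word_deg_def)

text \<open>For real part at most -n - 1 the whole degree i component lies in the filtration step
  that generates \<open>aI n i\<close>.\<close>

lemma vanish_low_deg:
  assumes "x \<in> hcomp i" "Re (snd i) \<le> - real n - 1"
  shows "vanish n j x"
proof (cases "j = i")
  case True
  have "rep_at x i n \<in> afilt (- int n - 1)"
    using rep_at_acomp[of x i n] assms(2) by (simp add: afilt_def acomp_def)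
  then have "rep_at x i n \<in> left_ideal hull afilt (- int n - 1)" by (rule hull_inc)
  then show ?thesis using True by (simp add: vanish_def aI_def rep_at_acomp)
qed (use assms(1) in \<open>simp add: hcomp_iff\<close>)

section \<open>Words that are zero in the quotient\<close>

text \<open>A negative integer has real part at most -1, so c(n) is one of the generators of J, and
  J absorbs the prefix from the left.\<close>

lemma last_letter_Krel:
  assumes "Re n > - 1"
  shows "of_falg (monomial (v @ [(c, n)])) \<in> Krel emb N \<eta>"
proof -
  have "n \<noteq> of_int k" if "k < 0" for k
  proof
    assume "n = of_int k"
    then have "Re n = of_int k" by simp
    moreover have "(of_int k :: real) \<le> - 1" using that by linarith
    ultimately show False using assms by linarith
  qed
  then have "of_falg (monomial [(c, n)]) \<in> Jideal N"
    unfolding Jideal_def gen_def[symmetric] by (intro hull_inc) blast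
  then have "of_falg (monomial (v @ [(c, n)])) \<in> Jideal N"
    unfolding of_falg_monomial_append by (rule left_ideal_lmult[OF left_ideal_Jideal])
  then show ?thesis
    by (intro Krel_J ideal_hcomp_cclosure[OF left_ideal_Jideal _ monomial_hcomp])
qed

lemma suffix_Krel: "of_falg (monomial s) \<in> Krel emb N \<eta> \<Longrightarrow> of_falg (monomial (v @ s)) \<in> Krel emb N \<eta>"
  unfolding of_falg_monomial_append by (rule Krel_lmult[OF monomial_hcomp])

text \<open>
  A word in \<open>I\<^sub>n\<close> has a suffix of degree at most \<open>-n-1\<close>. For large \<open>n\<close> it is a proper suffix, and a
  homogeneous decomposition of it along the two ideals lies in \<open>I\<^sub>n\<close> for degree reasons.
\<close>

lemma high_filtration_Krel:
  fixes w :: "('b \<times> complex) list" and x :: "('b, 'k::field) ahat"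
  assumes low: "\<And>s y. length s < length w \<Longrightarrow> fst ` set s \<subseteq> fst ` set w \<Longrightarrow>
      Re (snd (word_deg s)) < q \<Longrightarrow> y \<in> hcomp (word_deg s) \<Longrightarrow> y \<in> Krel emb N \<eta>"
    and m: "- real m \<le> q" "- real m \<le> Re (snd (word_deg w))"
    and x: "x \<in> hcomp (word_deg w)" "vanish m (word_deg w) x"
  shows "x \<in> Krel emb N \<eta>"
  unfolding Krel_def
proof (rule cclosure_plus_limit[OF left_ideals _ x])
  let ?i = "word_deg w"
  let ?I = "cclosure (Iideal emb N \<eta>)" and ?J = "cclosure (Jideal N)"
  fix n and u :: "('b, 'k) falg" assume n: "m \<le> n" and u: "u \<in> aI n ?i"
  have "\<exists>y z. y \<in> ?I \<inter> hcomp ?i \<and> z \<in> ?J \<inter> hcomp ?i \<and> vanish n ?i y \<and> vanish n ?i z \<and>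
     of_falg (scal (Poly_Mapping.lookup u p)) * of_falg (monomial p) = y + z"
    if p: "p \<in> Poly_Mapping.keys u" for p
  proof -
    have pi: "word_deg p = ?i" using u p by (auto simp: aI_def acomp_def)
    obtain v s where vs: "p = v @ s" "Re (snd (word_deg s)) \<le> - real n - 1"
      using hull_afilt_suffix[of u "- int n - 1" p] u p by (auto simp: aI_def)
    \<comment> \<open>Otherwise s = p, and the degree of w would have real part at most -n - 1 <
      -m.\<close>
    have "v \<noteq> []" using vs n m pi by auto
    then have "length s < length w" using word_deg_eqD[OF pi] vs by (cases v) auto
    moreover have "fst ` set s \<subseteq> fst ` set w" using word_deg_eqD[OF pi] vs by auto
    moreover have "Re (snd (word_deg s)) < q" using vs n m by linarith
    ultimately have "of_falg (monomial s) \<in> Krel emb N \<eta>" by (rule low) (rule monomial_hcomp)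
    then obtain y z where yz: "y \<in> ?I \<inter> hcomp (word_deg s)" "z \<in> ?J \<inter> hcomp (word_deg s)"
      "of_falg (monomial s) = y + z"
      using monomial_hcomp by (rule Krel_hcompE)
    let ?g = "of_falg (scal (Poly_Mapping.lookup u p)) * of_falg (monomial v)"
    have g: "?g \<in> hcomp (word_deg v)" using mult_hcomp[OF scal_hcomp monomial_hcomp] by simp
    have deg: "word_deg v + word_deg s = ?i" using pi vs by (simp add: word_deg_append)
    have "?g * y \<in> ?I \<inter> hcomp ?i" "?g * z \<in> ?J \<inter> hcomp ?i"
      using yz cclosure_lmult[OF left_ideal_Iideal g] cclosure_lmult[OF left_ideal_Jideal g]
        mult_hcomp[OF g] unfolding deg[symmetric] by blast+
    moreover have "vanish n (word_deg s) y" "vanish n (word_deg s) z"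
      using yz vs vanish_low_deg by blast+
    then have "vanish n ?i (?g * y)" "vanish n ?i (?g * z)"
      unfolding deg[symmetric] using yz by (auto intro: vanish_lmult[OF g])
    moreover have "of_falg (scal (Poly_Mapping.lookup u p)) * of_falg (monomial p) = ?g * y + ?g * z"
      using yz(3) by (simp add: vs(1) of_falg_monomial_append mult.assoc flip: distrib_left)
    ultimately show ?thesis by blast
  qed
  then obtain y z where yz: "\<And>p. p \<in> Poly_Mapping.keys u \<Longrightarrow> y p \<in> ?I \<inter> hcomp ?i \<and> z p \<in> ?J \<inter> hcomp ?i \<and>
     vanish n ?i (y p) \<and> vanish n ?i (z p) \<and>
     of_falg (scal (Poly_Mapping.lookup u p)) * of_falg (monomial p) = y p + z p"
    by metis
  have "of_falg u = sum y (Poly_Mapping.keys u) + sum z (Poly_Mapping.keys u)"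
    using of_falg_expand[OF aI_acomp[OF u]] yz by (simp add: sum.distrib)
  moreover have "sum y (Poly_Mapping.keys u) \<in> ?I \<inter> hcomp ?i" "sum z (Poly_Mapping.keys u) \<in> ?J \<inter> hcomp ?i"
    using yz by (auto intro!: cclosure_sum left_ideals hcomp_sum)
  moreover have "vanish n ?i (sum y (Poly_Mapping.keys u))" "vanish n ?i (sum z (Poly_Mapping.keys u))"
    using yz by (auto intro!: vanish_sum)
  ultimately show "\<exists>y \<in> ?I \<inter> hcomp ?i. \<exists>z \<in> ?J \<inter> hcomp ?i.
      vanish n ?i y \<and> vanish n ?i z \<and> of_falg u = y + z" by blast
qed

text \<open>
  The potential of the rewriting: exchanging two neighbouring modes changes one summand only.
\<close>

fun suffix_sum :: "('b \<times> complex) list \<Rightarrow> real" where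
  "suffix_sum [] = 0"
| "suffix_sum (x # w) = Re (snd (word_deg (x # w))) + suffix_sum w"

text \<open>Suffixes that begin inside v have equal degrees in both words, so their summands
  cancel.\<close>

lemma suffix_sum_append:
  "word_deg x = word_deg y \<Longrightarrow> suffix_sum (v @ x) - suffix_sum (v @ y) = suffix_sum x - suffix_sum y"
proof (induction v)
  case (Cons p v)
  have "word_deg ((p # v) @ x) = word_deg ((p # v) @ y)"
    using Cons.prems by (simp only: word_deg_append)
  then show ?case using Cons by simp
qed simp

text \<open>Pigeonhole: the sum has one summand for each nonempty suffix, so if their average is
  below q, one of them is.\<close>

lemma suffix_sum_low:
  assumes "suffix_sum w < q * real (length w)"
  shows "\<exists>v s. w = v @ s \<and> Re (snd (word_deg s)) < q"
  using assms
proof (induction w)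
  case (Cons x w)
  show ?case
  proof (cases "Re (snd (word_deg (x # w))) < q")
    case False
    then have "suffix_sum w < q * real (length w)" using Cons.prems by (simp add: algebra_simps)
    from Cons.IH[OF this] show ?thesis by (metis append_Cons)
  qed (use append_Nil in blast)
qed simp

lemma not_successively_split:
  "\<not> successively P w \<Longrightarrow> \<exists>v x y u. w = v @ x # y # u \<and> \<not> P x y"
proof (induction P w rule: successively.induct)
  case (3 P x y w)
  show ?case
  proof (cases "P x y")
    case True
    with 3 obtain v x' y' u where "y # w = v @ x' # y' # u" "\<not> P x' y'" by auto
    then have "x # y # w = (x # v) @ x' # y' # u" by simp
    then show ?thesis using \<open>\<not> P x' y'\<close> by blast
  qed (use append_Nil in blast)
qed simp_all

text \<open>Read from the right, the exponents start with real part at most -1 and grow by less than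
  C at each step. The k-th one is thus at most C * k - 1 and contributes at least -C * k to the
  degree; the total is at least -C * (1 + ... + L), where L is the length.\<close>

lemma word_deg_lower_bound:
  assumes "successively (\<lambda>x y. Re (snd x) - Re (snd y) < C) w" "C \<ge> 0"
    and "w \<noteq> [] \<Longrightarrow> Re (snd (last w)) \<le> - 1"
  shows "Re (snd (word_deg w)) \<ge> - C * (real (length w))\<^sup>2"
proof -
  \<comment> \<open>The bound on the first exponent is carried along so that the next letter to the
    left can be compared with it.\<close>
  have "Re (snd (word_deg w)) \<ge> - C * (real (length w))\<^sup>2 \<and>
      (w \<noteq> [] \<longrightarrow> Re (snd (hd w)) \<le> C * real (length w) - 1)"
    using assms
  proof (induction w)
    case Nil
    then show ?case by (simp add: word_deg_Nil)
  next
    case (Cons x w)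
    obtain a n where x: "x = (a, n)" by (cases x)
    have IH: "Re (snd (word_deg w)) \<ge> - C * (real (length w))\<^sup>2"
      "w \<noteq> [] \<Longrightarrow> Re (snd (hd w)) \<le> C * real (length w) - 1"
      using Cons by (auto simp: successively_Cons word_deg_Nil split: if_splits)
    have n: "Re n \<le> C * real (length (x # w)) - 1"
    proof (cases "w = []")
      case False
      then have "Re n < C + Re (snd (hd w))" using Cons.prems(1) x by (simp add: successively_Cons)
      then show ?thesis using IH(2)[OF False] by (simp add: algebra_simps)
    qed (use Cons.prems x in simp)
    \<comment> \<open>This is the slack between L^2 + L + 1 and (L + 1)^2, times C, for L =
      \<open>length w\<close>.\<close>
    have "0 \<le> C * real (length w)" using Cons.prems by simp
    then have "Re (snd (word_deg (x # w))) \<ge> - C * (real (length (x # w)))\<^sup>2"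
      using IH(1) n by (simp add: x word_deg_Cons power2_eq_square algebra_simps)
    then show ?case using n x by simp
  qed
  then show ?thesis by blast
qed

section \<open>The locality relation as a rewriting rule\<close>

text \<open>With s = m - N(a, b) and t = n, the term j = 0 begins with a(m) b(n), the pair to be
  rewritten.\<close>

lemma lterm_eq:
  "lterm emb N \<eta> a b (m - N a b) n j = scal (emb ((-1) ^ j * (N a b gchoose j))) *
    (monomial [(a, m - of_nat j), (b, n + of_nat j)]
     - scal (emb (\<eta> (bas a) (bas b) * exp (of_real pi * \<i> * N a b))) *
       monomial [(b, n + N a b - of_nat j), (a, m - N a b + of_nat j)])"
  by (simp add: lterm_def gen_def monomial_mult)

lemma monomial_sandwich:
  "monomial v * (scal c * (monomial p - scal d * monomial p')) * monomial w =
   scal c * (monomial (v @ p @ w) - scal d * monomial (v @ p' @ w))"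
proof -
  have "monomial v * (scal c * (monomial p - scal d * monomial p')) * monomial w =
      (monomial v * scal c) * monomial p * monomial w
      - (monomial v * scal c) * scal d * monomial p' * monomial w"
    by (simp add: algebra_simps)
  also have "\<dots> = scal c * (monomial v * monomial p * monomial w)
      - scal c * (monomial v * scal d) * monomial p' * monomial w"
    by (simp only: monomial_mult_scal mult.assoc)
  also have "\<dots> = scal c * (monomial v * monomial p * monomial w)
      - scal c * scal d * (monomial v * monomial p' * monomial w)"
    by (simp only: monomial_mult_scal mult.assoc)
  finally show ?thesis by (simp add: monomial_mult algebra_simps)
qed

text \<open>M is taken positive so that the leading term j = 0 belongs to the partial sum.\<close>

lemma lrel_approx:
  "\<exists>M>0. \<forall>i. vanish n i (lrel emb N \<eta> a b s t - (\<Sum>j<M. of_falg (lterm emb N \<eta> a b s t j)))"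
proof -
  let ?f = "\<lambda>j. of_falg (lterm emb N \<eta> a b s t j)" and ?l = "lrel emb N \<eta> a b s t"
  let ?U = "{y. \<forall>i. coset_at y i n = coset_at ?l i n}"
  have "open ?U" unfolding open_ahat_def by (intro ballI exI[of _ n]) simp
  moreover have "(\<lambda>M. \<Sum>j<M. ?f j) \<longlonglongrightarrow> ?l"
    unfolding lrel_def by (rule summable_LIMSEQ[OF summable_lterm])
  moreover have "?l \<in> ?U" by simp
  ultimately have "eventually (\<lambda>M. (\<Sum>j<M. ?f j) \<in> ?U) sequentially"
    using topological_tendstoD by blast
  then obtain M where "(\<Sum>j<Suc M. ?f j) \<in> ?U"
    unfolding eventually_sequentially by (meson le_SucI order.refl)
  then have "vanish n i (?l - (\<Sum>j<Suc M. ?f j))" for i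
    using coset_at_eq_iff[of "\<Sum>j<Suc M. ?f j" i n ?l] vanish_diff_swap by blast
  then show ?thesis by blast
qed

lemma lrel_hcomp: "lrel emb N \<eta> a b s t \<in> hcomp (bas a + bas b, - s - N a b - t - 2)"
  unfolding hcomp_iff
proof (intro allI impI)
  fix i n assume i: "i \<noteq> (bas a + bas b, - s - N a b - t - 2)"
  obtain M where M: "\<forall>i. vanish n i (lrel emb N \<eta> a b s t - (\<Sum>j<M. of_falg (lterm emb N \<eta> a b s t j)))"
    using lrel_approx[where emb = emb and N = N and \<eta> = \<eta> and a = a and b = b and s = s and t = t and n = n] by blast
  have "vanish n i (\<Sum>j<M. of_falg (lterm emb N \<eta> a b s t j))"
  proof (rule vanish_sum)
    fix j
    show "vanish n i (of_falg (lterm emb N \<eta> a b s t j))"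
      using of_falg_hcomp[OF lterm_acomp[of emb N \<eta> a b s t j]] i unfolding hcomp_iff by blast
  qed
  then show "vanish n i (lrel emb N \<eta> a b s t)" using vanish_cong_iff M by blast
qed

text \<open>Multiplying the relation by v on the left and by u on the right gives an element of I.
  Solved for its leading term, it expresses \<open>w 0\<close> by the words \<open>w j\<close> with
  j > 0, the words \<open>w' j\<close> and a remainder vanishing to order r, to which
  \<open>tail\<close> applies.\<close>

lemma word_Krel_step:
  fixes v u :: "('b \<times> complex) list" and a b :: 'b and m n :: complex
    and emb :: "complex \<Rightarrow> 'k::field" and N :: "'b \<Rightarrow> 'b \<Rightarrow> complex"
    and \<eta> :: "'b charge \<Rightarrow> 'b charge \<Rightarrow> complex"
  defines "w j \<equiv> v @ [(a, m - of_nat j), (b, n + of_nat j)] @ u"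
    and "w' j \<equiv> v @ [(b, n + N a b - of_nat j), (a, m - N a b + of_nat j)] @ u"
  assumes emb: "emb 1 = 1"
    and terms: "\<And>j. j > 0 \<Longrightarrow> of_falg (monomial (w j)) \<in> Krel emb N \<eta>"
      "\<And>j. of_falg (monomial (w' j)) \<in> Krel emb N \<eta>"
    and tail: "\<And>x. x \<in> hcomp (word_deg (w 0)) \<Longrightarrow> vanish r (word_deg (w 0)) x \<Longrightarrow> x \<in> Krel emb N \<eta>"
  shows "of_falg (monomial (w 0)) \<in> Krel emb N \<eta>"
proof -
  define t where "t j = lterm emb N \<eta> a b (m - N a b) n j" for j
  define l where "l = lrel emb N \<eta> a b (m - N a b) n"
  define V where "V = (of_falg (monomial v) :: ('b, 'k) ahat)"
  define U where "U = (of_falg (monomial u) :: ('b, 'k) ahat)"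
  define c where "c j = emb ((-1) ^ j * (N a b gchoose j))" for j
  define d where "d = emb (\<eta> (bas a) (bas b) * exp (of_real pi * \<i> * N a b))"
  define i where "i = (bas a + bas b, - m - n - 2)"
  have l: "l \<in> hcomp i" using lrel_hcomp[of emb N \<eta> a b "m - N a b" n] by (simp add: l_def i_def)
  have t: "t j \<in> acomp i" for j
    using lterm_acomp[of emb N \<eta> a b "m - N a b" n j] by (simp add: t_def i_def)
  have VU: "V \<in> hcomp (word_deg v)" "U \<in> hcomp (word_deg u)"
    by (simp_all add: V_def U_def monomial_hcomp)
  have deg: "word_deg v + i + word_deg u = word_deg (w 0)"
    by (simp add: w_def i_def word_deg_append word_deg_Cons word_deg_Nil plus_prod_def algebra_simps)
  have deg_w: "word_deg (w j) = word_deg (w 0)" "word_deg (w' j) = word_deg (w 0)" for j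
    by (simp_all add: w_def w'_def word_deg_append word_deg_Cons word_deg_Nil plus_prod_def algebra_simps)
  have sandwich: "V * of_falg (t j) * U = of_falg (scal (c j)) *
      (of_falg (monomial (w j)) - of_falg (scal d) * of_falg (monomial (w' j)))" for j
  proof -
    have "V * of_falg (t j) * U = of_falg (monomial v * t j * monomial u)"
      unfolding V_def U_def
      by (simp add: of_falg_mult[OF monomial_acomp t]
        of_falg_mult[OF acomp_mult[OF monomial_acomp t] monomial_acomp])
    also have "monomial v * t j * monomial u = scal (c j) * (monomial (w j) - scal d * monomial (w' j))"
      unfolding t_def lterm_eq w_def w'_def c_def d_def by (rule monomial_sandwich)
    also have "of_falg \<dots> = of_falg (scal (c j)) * of_falg (monomial (w j) - scal d * monomial (w' j))"
    proof (rule of_falg_scal_mult)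
      show "monomial (w j) - scal d * monomial (w' j) \<in> acomp (word_deg (w 0))"
        using acomp_add[OF _ acomp_minus[OF scal_mult_acomp]] monomial_acomp deg_w
        by (metis (no_types, lifting) add_uminus_conv_diff)
    qed
    finally show ?thesis by (simp add: of_falg_diff of_falg_scal_mult[OF monomial_acomp])
  qed
  \<comment> \<open>The additional \<open>shift (word_deg u)\<close> compensates the loss of order
    under right multiplication by U.\<close>
  obtain M where M: "M > 0" "\<And>i. vanish (r + shift (word_deg u)) i (l - (\<Sum>j<M. of_falg (t j)))"
    using lrel_approx[where emb = emb and N = N and \<eta> = \<eta> and a = a and b = b and
      s = "m - N a b" and t = n and n = "r + shift (word_deg u)", folded l_def t_def] by blast
  have "V * l * U \<in> Iideal emb N \<eta>"
    unfolding l_def by (intro Iideal_rmult left_ideal_lmult[OF left_ideal_Iideal] lrel_Iideal)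
  then have 1: "V * l * U \<in> Krel emb N \<eta>"
    using mult_hcomp[OF mult_hcomp[OF VU(1) l] VU(2)]
    by (intro Krel_I ideal_hcomp_cclosure[OF left_ideal_Iideal])
  have diff: "l - (\<Sum>j<M. of_falg (t j)) \<in> hcomp i"
    using l t by (intro hcomp_diff hcomp_sum of_falg_hcomp)
  have 2: "V * (l - (\<Sum>j<M. of_falg (t j))) * U \<in> Krel emb N \<eta>"
  proof (rule tail)
    show "V * (l - (\<Sum>j<M. of_falg (t j))) * U \<in> hcomp (word_deg (w 0))"
      unfolding deg[symmetric] by (intro mult_hcomp VU diff)
    show "vanish r (word_deg (w 0)) (V * (l - (\<Sum>j<M. of_falg (t j))) * U)"
      unfolding deg[symmetric]
      by (intro vanish_rmult[OF mult_hcomp[OF VU(1) diff] VU(2) _ order.refl]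
        vanish_lmult[OF VU(1) diff] M)
  qed
  have 3: "V * of_falg (t j) * U \<in> Krel emb N \<eta>" if "j > 0" for j
    unfolding sandwich using terms that by (intro Krel_lmult[OF scal_hcomp] Krel_diff) auto
  have "V * l * U - V * (l - (\<Sum>j<M. of_falg (t j))) * U = (\<Sum>j<M. V * of_falg (t j) * U)"
    by (simp add: algebra_simps sum_distrib_left sum_distrib_right)
  also have "\<dots> = V * of_falg (t 0) * U + (\<Sum>j\<in>{..<M} - {0}. V * of_falg (t j) * U)"
    using M(1) by (intro sum.remove) auto
  finally have "V * of_falg (t 0) * U = V * l * U - V * (l - (\<Sum>j<M. of_falg (t j))) * U
      - (\<Sum>j\<in>{..<M} - {0}. V * of_falg (t j) * U)" by simp
  then have 4: "V * of_falg (t 0) * U \<in> Krel emb N \<eta>"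
    using Krel_diff[OF Krel_diff[OF 1 2] Krel_sum[of "{..<M} - {0}" "\<lambda>j. V * of_falg (t j) * U"]] 3 by simp
  \<comment> \<open>The binomial coefficient for j = 0 is 1, so \<open>w 0\<close> occurs with
    coefficient 1.\<close>
  have "of_falg (scal (c 0)) = (1 :: ('b, 'k) ahat)"
    by (simp add: c_def emb scal_def one_ahat_def)
  then have "of_falg (monomial (w 0)) = V * of_falg (t 0) * U + of_falg (scal d) * of_falg (monomial (w' 0))"
    by (simp add: sandwich)
  then show ?thesis using Krel_add[OF 4 Krel_lmult[OF scal_hcomp terms(2)]] by simp
qed

section \<open>Vanishing in low degrees\<close>

text \<open>The induction on r bounds the excess of \<open>suffix_sum\<close> over D times the
  length, and each rewriting lowers this potential by at least 1. Once there is no excess, some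
  suffix has degree with real part below D; as the whole word has D, the suffix is proper, and
  \<open>low\<close> applies to it.\<close>

lemma low_word_Krel:
  fixes w :: "('b \<times> complex) list" and emb :: "complex \<Rightarrow> 'k::field"
  assumes emb: "emb 1 = 1"
    and C: "C \<ge> 0" "\<And>a b. a \<in> fst ` set w \<Longrightarrow> b \<in> fst ` set w \<Longrightarrow> Re (N a b) + 1 \<le> C"
    and low: "\<And>s (y :: ('b, 'k) ahat). length s < length w \<Longrightarrow> fst ` set s \<subseteq> fst ` set w \<Longrightarrow>
      Re (snd (word_deg s)) < - C * (real (length w))\<^sup>2 \<Longrightarrow> y \<in> hcomp (word_deg s) \<Longrightarrow> y \<in> Krel emb N \<eta>"
    and w: "Re (snd (word_deg w)) < - C * (real (length w))\<^sup>2"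
  shows "of_falg (monomial w) \<in> Krel emb N \<eta>"
proof -
  define D where "D = Re (snd (word_deg w))"
  define q where "q = - C * (real (length w))\<^sup>2"
  have "of_falg (monomial p) \<in> Krel emb N \<eta>"
    if "word_deg p = word_deg w" "suffix_sum p < D * real (length w) + real r" for r p
    using that
  proof (induction r arbitrary: p)
    case 0
    have len: "length p = length w" "fst ` set p = fst ` set w" using word_deg_eqD[OF 0(1)] by auto
    then obtain v s where vs: "p = v @ s" "Re (snd (word_deg s)) < D"
      using suffix_sum_low[of p D] 0 by auto
    then have "v \<noteq> []" using 0 by (auto simp: D_def)
    then have "length s < length w" using len vs by (cases v) auto
    then have "of_falg (monomial s) \<in> Krel emb N \<eta>"
      by (rule low) (use vs len w in \<open>auto simp: monomial_hcomp D_def\<close>)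
    then show ?case unfolding vs by (rule suffix_Krel)
  next
    case (Suc r)
    have len: "length p = length w" "fst ` set p = fst ` set w" using word_deg_eqD[OF Suc.prems(1)] by auto
    show ?case
    proof (cases "p \<noteq> [] \<and> Re (snd (last p)) > - 1")
      case True
      then have "p = butlast p @ [(fst (last p), snd (last p))]" by simp
      then show ?thesis using last_letter_Krel True by metis
    next
      case False
      \<comment> \<open>Otherwise the exponents grow too slowly from right to left for a degree
        below q.\<close>
      have "\<not> successively (\<lambda>x y. Re (snd x) - Re (snd y) < C) p"
      proof
        assume "successively (\<lambda>x y. Re (snd x) - Re (snd y) < C) p"
        from word_deg_lower_bound[OF this C(1)] False
        have "Re (snd (word_deg p)) \<ge> - C * (real (length p))\<^sup>2" by auto
        then show False using w len Suc.prems by simp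
      qed
      then obtain v x y u where "p = v @ x # y # u" "\<not> Re (snd x) - Re (snd y) < C"
        using not_successively_split by blast
      then obtain a m b n where p: "p = v @ (a, m) # (b, n) # u" and mn: "Re m - Re n \<ge> C"
        by (cases x; cases y) auto
      define f where "f j = v @ [(a, m - of_nat j), (b, n + of_nat j)] @ u" for j
      define f' where "f' j = v @ [(b, n + N a b - of_nat j), (a, m - N a b + of_nat j)] @ u" for j
      have pf: "p = f 0" by (simp add: p f_def)
      have deg: "word_deg (f j) = word_deg p" "word_deg (f' j) = word_deg p" for j
        by (simp_all add: p f_def f'_def word_deg_append word_deg_Cons plus_prod_def algebra_simps)
      have deg': "word_deg ([(a, m - of_nat j), (b, n + of_nat j)] @ u) = word_deg ((a, m) # (b, n) # u)"
        "word_deg ([(b, n + N a b - of_nat j), (a, m - N a b + of_nat j)] @ u) = word_deg ((a, m) # (b, n) # u)" for j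
        by (simp_all add: word_deg_Cons plus_prod_def algebra_simps)
      \<comment> \<open>Among the suffixes only the one starting at the second letter of the pair
        changes its degree, namely by -j.\<close>
      have "suffix_sum (f j) = suffix_sum p - real j" for j
        using suffix_sum_append[OF deg'(1), of v j] unfolding f_def p
        by (simp add: word_deg_Cons algebra_simps)
      then have f: "of_falg (monomial (f j)) \<in> Krel emb N \<eta>" if "j > 0" for j
        using that Suc deg by (intro Suc.IH) auto
      have "a \<in> fst ` set w" "b \<in> fst ` set w" unfolding len(2)[symmetric] p by auto
      \<comment> \<open>The words \<open>f' j\<close> have to drop by at least 1 even for j = 0;
        this is the reason for the summand 1 in the condition on C.\<close>
      then have "Re (N a b) + 1 \<le> Re m - Re n" using C(2) mn by fastforce
      moreover have "suffix_sum (f' j) = suffix_sum p - (Re m - Re n - Re (N a b)) - real j" for j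
        using suffix_sum_append[OF deg'(2), of v j] unfolding f'_def p
        by (simp add: word_deg_Cons algebra_simps)
      ultimately have f': "of_falg (monomial (f' j)) \<in> Krel emb N \<eta>" for j
        using Suc deg by (intro Suc.IH) auto
      \<comment> \<open>Large enough for both conditions on the order in
        \<open>high_filtration_Krel\<close>.\<close>
      define k where "k = nat \<lceil>max (- q) (- D)\<rceil>"
      have k: "- real k \<le> q" "- real k \<le> D" unfolding k_def by linarith+
      have "x \<in> Krel emb N \<eta>" if "x \<in> hcomp (word_deg (f 0))" "vanish k (word_deg (f 0)) x" for x
        by (rule high_filtration_Krel[of w q, OF low])
          (use k that Suc.prems pf in \<open>simp_all add: q_def D_def\<close>)
      with emb f f' show ?thesis unfolding pf f_def f'_def by (rule word_Krel_step)
    qed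
  qed
  moreover have "suffix_sum w < D * real (length w) + real (nat (\<lfloor>suffix_sum w - D * real (length w)\<rfloor> + 1))"
    by linarith
  ultimately show ?thesis by blast
qed

text \<open>By strong induction on the length. An element x splits into a representative, which is a
  finite combination of words of the degree of w and covered by \<open>low_word_Krel\<close>, and a
  remainder vanishing to order k, covered by \<open>high_filtration_Krel\<close>.\<close>

lemma low_hcomp_Krel:
  fixes w :: "('b \<times> complex) list" and emb :: "complex \<Rightarrow> 'k::field" and x :: "('b, 'k) ahat"
  assumes emb: "emb 1 = 1"
    and C: "C \<ge> 0" "\<And>a b. a \<in> fst ` set w \<Longrightarrow> b \<in> fst ` set w \<Longrightarrow> Re (N a b) + 1 \<le> C"
    and w: "Re (snd (word_deg w)) < - C * (real (length w))\<^sup>2"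
    and x: "x \<in> hcomp (word_deg w)"
  shows "x \<in> Krel emb N \<eta>"
  using C(2) w x
proof (induction "length w" arbitrary: w x rule: less_induct)
  case less
  have low: "y \<in> Krel emb N \<eta>" if s: "length s < length w" "fst ` set s \<subseteq> fst ` set w"
    "Re (snd (word_deg s)) < - C * (real (length w))\<^sup>2" "y \<in> hcomp (word_deg s)"
    for s and y :: "('b, 'k) ahat"
  proof (rule less.hyps[OF s(1)])
    \<comment> \<open>The threshold for a shorter word is no lower, so a degree below the threshold
      of w is below that of s.\<close>
    have "C * (real (length s))\<^sup>2 \<le> C * (real (length w))\<^sup>2"
      using s(1) C(1) by (intro mult_left_mono power_mono) auto
    then show "Re (snd (word_deg s)) < - C * (real (length s))\<^sup>2" using s(3) by simp
    show "Re (N a b) + 1 \<le> C" if "a \<in> fst ` set s" "b \<in> fst ` set s" for a b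
      using less.prems(1) s(2) that by blast
  qed (rule s(4))
  have word: "of_falg (monomial p) \<in> Krel emb N \<eta>" if "word_deg p = word_deg w" for p
    using word_deg_eqD[OF that] that less.prems low by (intro low_word_Krel[where emb = emb and C = C, OF emb C(1)]) auto
  let ?i = "word_deg w"
  define k where "k = nat \<lceil>max (C * (real (length w))\<^sup>2) (- Re (snd ?i))\<rceil>"
  have k: "- real k \<le> - C * (real (length w))\<^sup>2" "- real k \<le> Re (snd ?i)" unfolding k_def by linarith+
  let ?u = "rep_at x ?i k"
  have "of_falg ?u \<in> Krel emb N \<eta>"
    unfolding of_falg_expand[OF rep_at_acomp]
  proof (intro Krel_sum Krel_lmult[OF scal_hcomp] word)
    fix p assume "p \<in> Poly_Mapping.keys ?u"
    then show "word_deg p = ?i" using rep_at_acomp[of x ?i k] by (auto simp: acomp_def)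
  qed
  moreover have "x - of_falg ?u \<in> Krel emb N \<eta>"
  proof (rule high_filtration_Krel[OF low k])
    show "x - of_falg ?u \<in> hcomp ?i" using less.prems by (intro hcomp_diff of_falg_hcomp rep_at_acomp)
    show "vanish k ?i (x - of_falg ?u)" by (rule vanish_approx)
  qed
  ultimately show ?case using Krel_add[of "of_falg ?u" _ _ _ "x - of_falg ?u"] by simp
qed

text \<open>All words of charge \<open>\<gamma>\<close> have the same length and the same letters,
  so one C and one threshold serve every d. If there is no such word, the components of charge
  \<open>\<gamma>\<close> are already 0 in the completion.\<close>

lemma degree_bound:
  fixes emb :: "complex \<Rightarrow> 'k::field" and N :: "'b \<Rightarrow> 'b \<Rightarrow> complex"
  assumes emb: "emb 1 = 1"
  shows "\<exists>q. \<forall>d. Re d < q \<longrightarrow> hcomp (\<gamma>, d) \<subseteq> Krel emb N \<eta>"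
proof (cases "\<exists>w. word_charge w = \<gamma>")
  case True
  then obtain w0 where w0: "word_charge w0 = \<gamma>" by blast
  let ?B = "fst ` set w0"
  \<comment> \<open>A sum of moduli bounds N on all pairs of letters, is nonnegative, and makes
    sense for the empty word too.\<close>
  define C where "C = 1 + (\<Sum>a\<in>?B. \<Sum>b\<in>?B. cmod (N a b))"
  have "C \<ge> 0" unfolding C_def by (intro add_nonneg_nonneg sum_nonneg) simp_all
  have NC: "Re (N a b) + 1 \<le> C" if "a \<in> ?B" "b \<in> ?B" for a b
  proof -
    have "Re (N a b) \<le> cmod (N a b)" by (rule complex_Re_le_cmod)
    also have "\<dots> \<le> (\<Sum>b\<in>?B. cmod (N a b))" by (rule member_le_sum) (use that in auto)
    also have "\<dots> \<le> (\<Sum>a\<in>?B. \<Sum>b\<in>?B. cmod (N a b))"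
      by (rule member_le_sum) (use that in \<open>auto intro: sum_nonneg\<close>)
    finally show ?thesis by (simp add: C_def)
  qed
  have "x \<in> Krel emb N \<eta>" if d: "Re d < - C * (real (length w0))\<^sup>2" and x: "x \<in> hcomp (\<gamma>, d)"
    for d and x :: "('b, 'k) ahat"
  proof (cases "\<exists>w. word_deg w = (\<gamma>, d)")
    case True
    then obtain w where w: "word_deg w = (\<gamma>, d)" by blast
    then have "word_charge w = word_charge w0" by (simp add: word_deg_def w0)
    from word_charge_eqD[OF this] show ?thesis
      using low_hcomp_Krel[where emb = emb and N = N and C = C and w = w, OF emb \<open>C \<ge> 0\<close>] NC d x w by simp
  next
    case False
    \<comment> \<open>Without words of this degree every representative is 0.\<close>
    have "x = 0"
    proof (rule hcomp_eqI[OF x hcomp_0])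
      fix n
      have "Poly_Mapping.keys (rep_at x (\<gamma>, d) n) = {}"
        using False rep_at_acomp[of x "(\<gamma>, d)" n] by (auto simp: acomp_def)
      then show "vanish n (\<gamma>, d) (x - 0)" by (simp add: vanish_def aI_0)
    qed
    then show ?thesis by (simp add: Krel_0)
  qed
  then show ?thesis by blast
next
  case False
  have "x = 0" if x: "x \<in> hcomp (\<gamma>, d)" for d and x :: "('b, 'k) ahat"
  proof (rule hcomp_eqI[OF x hcomp_0])
    fix n
    have "Poly_Mapping.keys (rep_at x (\<gamma>, d) n) = {}"
      using False rep_at_acomp[of x "(\<gamma>, d)" n] by (auto simp: acomp_def word_deg_def)
    then show "vanish n (\<gamma>, d) (x - 0)" by (simp add: vanish_def aI_0)
  qed
  then show ?thesis using Krel_0 by blast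
qed

section \<open>The quotient as a graded vector space\<close>

lemma biext_0_right: "biext N \<alpha> 0 = 0"
  by (simp add: biext_def)

lemma gen_commute_scal:
  "of_falg (gen a n) * of_falg (scal c) = of_falg (scal c) * of_falg (gen a n)"
  unfolding of_falg_mult[OF gen_acomp scal_acomp, symmetric] of_falg_mult[OF scal_acomp gen_acomp, symmetric]
  by (simp add: gen_def monomial_mult_scal)

lemma sum_in_left_ideal: "left_ideal L \<Longrightarrow> (\<And>s. s \<in> S \<Longrightarrow> f s \<in> L) \<Longrightarrow> sum f S \<in> L"
  by (induction S rule: infinite_finite_induct) (auto simp: left_ideal_0 left_ideal_add)

text \<open>For a word w of charge \<open>\<beta>\<close>, a(n) w is a generator of J. In its
  degree, x is a limit of combinations of such words, and left multiplication preserves the order of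
  approximation, so a(n) x lies in the closure of J.\<close>

lemma gen_mult_Krel:
  fixes x :: "('b, 'k::field) ahat"
  assumes n: "n \<notin> biext N (bas a) \<beta> +o \<int>" and x: "x \<in> hcomp (\<beta>, d)"
  shows "of_falg (gen a n) * x \<in> Krel emb N \<eta>"
proof -
  let ?g = "of_falg (gen a n) :: ('b, 'k) ahat" and ?k = "(bas a, - n - 1)"
  have g: "?g \<in> hcomp ?k" by (intro of_falg_hcomp gen_acomp)
  have word: "of_falg (monomial ((a, n) # w)) \<in> (Jideal N :: ('b, 'k) ahat set)"
    if w: "word_deg w = (\<beta>, d)" for w
  proof (cases "w = []")
    \<comment> \<open>The generators with a charge condition have at least two letters. For the
      empty word \<open>\<beta>\<close> is 0, so n is not an integer and a(n) is a generator of the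
      other kind.\<close>
    case True
    then have "\<beta> = 0" using w by (simp add: word_deg_Nil zero_prod_def)
    then have "n \<notin> \<int>" using n by (auto simp: biext_0_right elt_set_plus_def)
    then have "n \<notin> of_int ` {..<0}" using Ints_of_int by blast
    then have "of_falg (gen a n) \<in> (Jideal N :: ('b, 'k) ahat set)"
      unfolding Jideal_def by (intro hull_inc) blast
    then show ?thesis using True by (simp add: gen_def)
  next
    case False
    have "word_charge w = \<beta>" using w by (simp add: word_deg_def)
    then show ?thesis unfolding Jideal_def using False n by (intro hull_inc) blast
  qed
  have "?g * x \<in> closure (Jideal N \<inter> hcomp (?k + (\<beta>, d)))"
    unfolding ahat_closure_iff
  proof
    fix m
    let ?u = "rep_at x (\<beta>, d) m"
    have "?g * of_falg ?u = (\<Sum>w\<in>Poly_Mapping.keys ?u.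
        of_falg (scal (Poly_Mapping.lookup ?u w)) * of_falg (monomial ((a, n) # w)))"
      unfolding of_falg_expand[OF rep_at_acomp] sum_distrib_left
    proof (rule sum.cong[OF refl])
      fix w
      let ?s = "scal (Poly_Mapping.lookup ?u w)"
      have "?g * of_falg (monomial w) = of_falg (monomial ((a, n) # w))"
        by (simp add: gen_mult_monomial flip: of_falg_mult[OF gen_acomp monomial_acomp])
      then show "?g * (of_falg ?s * of_falg (monomial w)) = of_falg ?s * of_falg (monomial ((a, n) # w))"
        using gen_commute_scal[of a n "Poly_Mapping.lookup ?u w"] by (simp only: mult.assoc[symmetric]) (simp only: mult.assoc)
    qed
    also have "\<dots> \<in> Jideal N"
    proof (intro sum_in_left_ideal[OF left_ideal_Jideal] left_ideal_lmult[OF left_ideal_Jideal] word)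
      fix w assume "w \<in> Poly_Mapping.keys ?u"
      then show "word_deg w = (\<beta>, d)" using rep_at_acomp[of x "(\<beta>, d)" m] by (auto simp: acomp_def)
    qed
    finally have J: "?g * of_falg ?u \<in> Jideal N" .
    have h: "?g * of_falg ?u \<in> hcomp (?k + (\<beta>, d))"
      by (intro mult_hcomp g of_falg_hcomp rep_at_acomp)
    have xu: "x - of_falg ?u \<in> hcomp (\<beta>, d)" by (intro hcomp_diff x of_falg_hcomp rep_at_acomp)
    have "vanish m i (?g * x - ?g * of_falg ?u)" for i
    proof (cases "i = ?k + (\<beta>, d)")
      case True
      show ?thesis unfolding True right_diff_distrib[symmetric]
        by (rule vanish_lmult[OF g xu vanish_approx])
    next
      case False
      then show ?thesis using mult_hcomp[OF g xu]
        unfolding right_diff_distrib[symmetric] hcomp_iff by blast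
    qed
    then show "\<exists>y\<in>Jideal N \<inter> hcomp (?k + (\<beta>, d)). \<forall>i. vanish m i (?g * x - y)"
      using J h by blast
  qed
  then show ?thesis
    using Krel_J cclosure_hcomp[OF left_ideal_Jideal mult_hcomp[OF g x]] by blast
qed

section \<open>Computing with cosets\<close>

lemma Krel_coset_eq_iff: "x +o Krel emb N \<eta> = y +o Krel emb N \<eta> \<longleftrightarrow> x - y \<in> Krel emb N \<eta>"
proof
  assume "x +o Krel emb N \<eta> = y +o Krel emb N \<eta>"
  moreover have "x \<in> x +o Krel emb N \<eta>" using Krel_0 by (force simp: elt_set_plus_def)
  ultimately show "x - y \<in> Krel emb N \<eta>" by (auto simp: elt_set_plus_def)
next
  have sub: "x +o Krel emb N \<eta> \<subseteq> y +o Krel emb N \<eta>" if "x - y \<in> Krel emb N \<eta>" for x y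
  proof
    fix z assume "z \<in> x +o Krel emb N \<eta>"
    then obtain k where "k \<in> Krel emb N \<eta>" "z = x + k" by (auto simp: elt_set_plus_def)
    then have "z = y + ((x - y) + k)" "(x - y) + k \<in> Krel emb N \<eta>" using that by (auto intro: Krel_add)
    then show "z \<in> y +o Krel emb N \<eta>" unfolding elt_set_plus_def by blast
  qed
  assume "x - y \<in> Krel emb N \<eta>"
  moreover from Krel_uminus[OF this] have "y - x \<in> Krel emb N \<eta>" by simp
  ultimately show "x +o Krel emb N \<eta> = y +o Krel emb N \<eta>" using sub by blast
qed

lemma Krel_coset_zero_iff: "x +o Krel emb N \<eta> = Krel emb N \<eta> \<longleftrightarrow> x \<in> Krel emb N \<eta>"
  using Krel_coset_eq_iff[of x emb N \<eta> 0] by simp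

lemma Krel_coset_add: "(x +o Krel emb N \<eta>) + (y +o Krel emb N \<eta>) = (x + y) +o Krel emb N \<eta>"
proof (intro equalityI subsetI)
  fix z assume "z \<in> (x +o Krel emb N \<eta>) + (y +o Krel emb N \<eta>)"
  then obtain k l where kl: "k \<in> Krel emb N \<eta>" "l \<in> Krel emb N \<eta>" "z = (x + k) + (y + l)"
    by (auto simp: elt_set_plus_def elim!: set_plus_elim)
  then have "z = (x + y) + (k + l)" "k + l \<in> Krel emb N \<eta>" by (auto simp: algebra_simps intro: Krel_add)
  then show "z \<in> (x + y) +o Krel emb N \<eta>" unfolding elt_set_plus_def by blast
next
  fix z assume "z \<in> (x + y) +o Krel emb N \<eta>"
  then obtain k where k: "k \<in> Krel emb N \<eta>" "z = (x + 0) + (y + k)"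
    by (auto simp: elt_set_plus_def algebra_simps)
  show "z \<in> (x +o Krel emb N \<eta>) + (y +o Krel emb N \<eta>)"
    unfolding k(2) by (intro set_plus_intro set_plus_intro2 k(1) Krel_0)
qed

text \<open>K absorbs homogeneous left factors, so multiplication by g is well defined on cosets;
  adding K fills the product set up to a full coset.\<close>

lemma Krel_coset_lmult:
  assumes g: "g \<in> hcomp i"
  shows "(g *o (x +o Krel emb N \<eta>)) + Krel emb N \<eta> = (g * x) +o Krel emb N \<eta>"
proof (intro equalityI subsetI)
  fix z assume "z \<in> (g *o (x +o Krel emb N \<eta>)) + Krel emb N \<eta>"
  then obtain k l where kl: "k \<in> Krel emb N \<eta>" "l \<in> Krel emb N \<eta>" "z = g * (x + k) + l"
    by (auto simp: elt_set_plus_def elt_set_times_def elim!: set_plus_elim)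
  then have "z = g * x + (g * k + l)" "g * k + l \<in> Krel emb N \<eta>"
    by (auto simp: algebra_simps intro: Krel_add Krel_lmult[OF g])
  then show "z \<in> (g * x) +o Krel emb N \<eta>" unfolding elt_set_plus_def by blast
next
  fix z assume "z \<in> (g * x) +o Krel emb N \<eta>"
  then obtain k where k: "k \<in> Krel emb N \<eta>" "z = g * (x + 0) + k"
    by (auto simp: elt_set_plus_def)
  show "z \<in> (g *o (x +o Krel emb N \<eta>)) + Krel emb N \<eta>"
    unfolding k(2) by (intro set_plus_intro set_times_intro2 set_plus_intro2 k(1) Krel_0)
qed

text \<open>Every operation, and zero too, is expressed by cosets of representatives, so that the
  vector space laws reduce to ring laws of the completion.\<close>

lemma Fspace_simps:
  "carrier (Fspace emb N \<eta>) = range (\<lambda>x. x +o Krel emb N \<eta>)"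
  "ring.zero (Fspace emb N \<eta>) = 0 +o Krel emb N \<eta>"
  "(x +o Krel emb N \<eta>) \<oplus>\<^bsub>Fspace emb N \<eta>\<^esub> (y +o Krel emb N \<eta>) = (x + y) +o Krel emb N \<eta>"
  "c \<odot>\<^bsub>Fspace emb N \<eta>\<^esub> (x +o Krel emb N \<eta>) = (of_falg (scal c) * x) +o Krel emb N \<eta>"
  by (auto simp: Fspace_def Krel_coset_add Krel_coset_lmult[OF scal_hcomp])

lemma Faction_coset:
  assumes "u \<in> acomp i"
  shows "Faction emb N \<eta> u (x +o Krel emb N \<eta>) = (of_falg u * x) +o Krel emb N \<eta>"
  unfolding Faction_def by (rule Krel_coset_lmult[OF of_falg_hcomp[OF assms]])

lemma abelian_group_Fspace: "abelian_group (Fspace emb N \<eta>)"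
proof (rule abelian_groupI)
  fix v assume "v \<in> carrier (Fspace emb N \<eta>)"
  then obtain x where "v = x +o Krel emb N \<eta>" by (auto simp: Fspace_simps)
  then show "\<exists>y\<in>carrier (Fspace emb N \<eta>). y \<oplus>\<^bsub>Fspace emb N \<eta>\<^esub> v = \<zero>\<^bsub>Fspace emb N \<eta>\<^esub>"
    by (intro bexI[of _ "(- x) +o Krel emb N \<eta>"]) (simp_all add: Fspace_simps)
qed (auto simp: Fspace_simps add_ac simp del: set_zero_plus)

lemma of_falg_scal_1: "of_falg (scal 1) = 1"
  by (simp add: scal_def one_ahat_def)

lemma of_falg_scal_add: "of_falg (scal (c + d)) = of_falg (scal c) + of_falg (scal d)"
  by (simp add: scal_def single_add of_falg_add)

lemma of_falg_scal_scal: "of_falg (scal (c * d)) = of_falg (scal c) * of_falg (scal d)"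
  unfolding of_falg_mult[OF scal_acomp scal_acomp, symmetric] by (simp add: scal_def mult_single)

lemma module_Fspace: "Module.module (ring_of_type_algebra :: 'k::field ring) (Fspace emb N \<eta> :: ('k, ('b, 'k) ahat set) module)"
proof (rule moduleI)
  show "cring (ring_of_type_algebra :: 'k ring)" by (rule cring_from_type_algebra)
  show "abelian_group (Fspace emb N \<eta> :: ('k, ('b, 'k) ahat set) module)" by (rule abelian_group_Fspace)
qed (auto simp: Fspace_simps ring_of_type_algebra_def of_falg_scal_1 of_falg_scal_add of_falg_scal_scal
    algebra_simps)

lemma finsum_Fspace:
  "finite S \<Longrightarrow> finsum (Fspace emb N \<eta>) (\<lambda>s. f s +o Krel emb N \<eta>) S = (\<Sum>s\<in>S. f s) +o Krel emb N \<eta>"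
proof (induction S rule: finite_induct)
  interpret abelian_group "Fspace emb N \<eta>" by (rule abelian_group_Fspace)
  case empty
  show ?case by (simp add: Fspace_simps)
next
  interpret abelian_group "Fspace emb N \<eta>" by (rule abelian_group_Fspace)
  case (insert s S)
  then show ?case by (subst finsum_insert) (auto simp: Fspace_simps)
qed

lemma finsum_Fspace_cong:
  assumes "finite S" "\<And>s. s \<in> S \<Longrightarrow> g s = f s +o Krel emb N \<eta>"
  shows "finsum (Fspace emb N \<eta>) g S = (\<Sum>s\<in>S. f s) +o Krel emb N \<eta>"
proof -
  interpret abelian_group "Fspace emb N \<eta>" by (rule abelian_group_Fspace)
  have "finsum (Fspace emb N \<eta>) g S = finsum (Fspace emb N \<eta>) (\<lambda>s. f s +o Krel emb N \<eta>) S"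
    by (rule finsum_cong') (use assms in \<open>auto simp: Fspace_simps\<close>)
  then show ?thesis by (simp add: finsum_Fspace assms(1))
qed

text \<open>Elements of the completion have finite support, so a finite sum over degrees amounts to
  a single representative supported in charge \<open>\<alpha>\<close>.\<close>

lemma Fcharge_eq: "Fcharge emb N \<eta> \<alpha> = {x +o Krel emb N \<eta> | x. asupp x \<subseteq> {\<alpha>} \<times> UNIV}"
proof (intro equalityI subsetI)
  fix v assume "v \<in> Fcharge emb N \<eta> \<alpha>"
  then obtain g D where g: "v = finsum (Fspace emb N \<eta>) g D" "finite D" "\<forall>d \<in> D. g d \<in> Fcomp emb N \<eta> \<alpha> d"
    unfolding Fcharge_def by blast
  then have "\<forall>d\<in>D. \<exists>x. x \<in> hcomp (\<alpha>, d) \<and> g d = x +o Krel emb N \<eta>" unfolding Fcomp_def by blast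
  then obtain f where f: "\<And>d. d \<in> D \<Longrightarrow> f d \<in> hcomp (\<alpha>, d)" "\<And>d. d \<in> D \<Longrightarrow> g d = f d +o Krel emb N \<eta>"
    by metis
  have "v = sum f D +o Krel emb N \<eta>" unfolding g(1) by (rule finsum_Fspace_cong[OF g(2) f(2)])
  moreover have "asupp (sum f D) \<subseteq> {\<alpha>} \<times> UNIV"
    unfolding asupp_vanish using f(1) by (intro allI impI vanish_sum) (fastforce simp: hcomp_iff)
  ultimately show "v \<in> {x +o Krel emb N \<eta> | x. asupp x \<subseteq> {\<alpha>} \<times> UNIV}" by blast
next
  fix v assume "v \<in> {x +o Krel emb N \<eta> | x. asupp x \<subseteq> {\<alpha>} \<times> UNIV}"
  then obtain x where x: "v = x +o Krel emb N \<eta>" "asupp x \<subseteq> {\<alpha>} \<times> UNIV" by blast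
  let ?D = "snd ` asupp x"
  have "asupp x = Pair \<alpha> ` ?D" using x(2) by force
  then have "x = (\<Sum>i\<in>Pair \<alpha> ` ?D. part {i} x)" using ahat_decomp by metis
  also have "\<dots> = (\<Sum>d\<in>?D. part {(\<alpha>, d)} x)" by (subst sum.reindex) (auto intro: inj_onI)
  finally have "v = finsum (Fspace emb N \<eta>) (\<lambda>d. part {(\<alpha>, d)} x +o Krel emb N \<eta>) ?D"
    using finsum_Fspace[of ?D emb N \<eta> "\<lambda>d. part {(\<alpha>, d)} x"] x(1) finite_asupp[of x] by simp
  moreover have "part {(\<alpha>, d)} x +o Krel emb N \<eta> \<in> Fcomp emb N \<eta> \<alpha> d" for d
    unfolding Fcomp_def using part_hcomp by blast
  ultimately show "v \<in> Fcharge emb N \<eta> \<alpha>"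
    unfolding Fcharge_def using finite_asupp[of x] by blast
qed

lemma submodule_Fcharge:
  "submodule (Fcharge emb N \<eta> \<alpha>) (ring_of_type_algebra :: 'k::field ring)
     (Fspace emb N \<eta> :: ('k, ('b, 'k) ahat set) module)"
proof -
  interpret Module.module "ring_of_type_algebra :: 'k ring" "Fspace emb N \<eta> :: ('k, ('b, 'k) ahat set) module"
    by (rule module_Fspace)
  let ?F = "Fspace emb N \<eta> :: ('k, ('b, 'k) ahat set) module"
  have minus: "\<ominus>\<^bsub>?F\<^esub> (x +o Krel emb N \<eta>) = (- x) +o Krel emb N \<eta>" for x
    by (rule M.minus_equality) (auto simp: Fspace_simps)
  show ?thesis
  proof (rule submoduleI)
    show "Fcharge emb N \<eta> \<alpha> \<subseteq> carrier ?F" by (auto simp: Fcharge_eq Fspace_simps)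
    show "\<zero>\<^bsub>?F\<^esub> \<in> Fcharge emb N \<eta> \<alpha>"
      unfolding Fcharge_eq Fspace_simps asupp_vanish using vanish_0 by blast
    fix v assume "v \<in> Fcharge emb N \<eta> \<alpha>"
    then obtain x where x: "v = x +o Krel emb N \<eta>" "asupp x \<subseteq> {\<alpha>} \<times> UNIV" by (auto simp: Fcharge_eq)
    have "asupp (- x) \<subseteq> {\<alpha>} \<times> UNIV" using x(2) unfolding asupp_vanish using vanish_uminus by blast
    then show "\<ominus>\<^bsub>?F\<^esub> v \<in> Fcharge emb N \<eta> \<alpha>" unfolding x(1) minus Fcharge_eq by blast
    show "c \<odot>\<^bsub>?F\<^esub> v \<in> Fcharge emb N \<eta> \<alpha>" for c
    proof -
      have "asupp (of_falg (scal c) * x) \<subseteq> {0} + {\<alpha>} \<times> UNIV"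
        by (rule order.trans[OF asupp_times set_plus_mono2[OF _ x(2)]])
          (use scal_hcomp[of c] in \<open>simp add: hcomp_def\<close>)
      also have "\<dots> \<subseteq> {\<alpha>} \<times> UNIV" by (auto simp: set_plus_def)
      finally show ?thesis unfolding x(1) Fspace_simps Fcharge_eq by blast
    qed
    fix w assume "w \<in> Fcharge emb N \<eta> \<alpha>"
    then obtain y where y: "w = y +o Krel emb N \<eta>" "asupp y \<subseteq> {\<alpha>} \<times> UNIV" by (auto simp: Fcharge_eq)
    have "asupp (x + y) \<subseteq> {\<alpha>} \<times> UNIV"
      using x(2) y(2) unfolding asupp_vanish using vanish_add by blast
    then show "v \<oplus>\<^bsub>?F\<^esub> w \<in> Fcharge emb N \<eta> \<alpha>" unfolding x(1) y(1) Fspace_simps Fcharge_eq by blast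
  qed
qed

text \<open>Existence: a representative is split into its charge parts. Uniqueness: K is stable
  under projection to a charge by \<open>Krel_part\<close>, so two decompositions can be compared
  charge by charge.\<close>

lemma graded_vs_Fspace:
  "graded_vs (ring_of_type_algebra :: 'k::field ring)
     (Fspace emb N \<eta> :: ('k, ('b, 'k) ahat set) module) (Fcharge emb N \<eta>)"
proof -
  let ?F = "Fspace emb N \<eta> :: ('k, ('b, 'k) ahat set) module"
  let ?K = "Krel emb N \<eta> :: ('b, 'k) ahat set"
  let ?dec = "\<lambda>v g. (\<forall>\<alpha>. g \<alpha> \<in> Fcharge emb N \<eta> \<alpha>) \<and> finite {\<alpha>. g \<alpha> \<noteq> \<zero>\<^bsub>?F\<^esub>} \<and>
        v = finsum ?F g {\<alpha>. g \<alpha> \<noteq> \<zero>\<^bsub>?F\<^esub>}"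
  have "\<exists>!g. ?dec v g" if "v \<in> carrier ?F" for v
  proof -
    from that obtain x where v: "v = x +o ?K" by (auto simp: Fspace_simps)
    define h where "h \<alpha> = part ({\<alpha>} \<times> UNIV) x" for \<alpha>
    show ?thesis
    proof (rule ex1I[of _ "\<lambda>\<alpha>. h \<alpha> +o ?K"])
      let ?S = "{\<alpha>. h \<alpha> +o ?K \<noteq> \<zero>\<^bsub>?F\<^esub>}"
      have sub: "?S \<subseteq> fst ` asupp x"
      proof (rule subsetI, rule ccontr)
        fix \<alpha> assume *: "\<alpha> \<in> ?S" "\<alpha> \<notin> fst ` asupp x"
        then have "h \<alpha> = 0" unfolding h_def by (intro part_eq_0) force
        with * show False by (simp add: Fspace_simps)
      qed
      \<comment> \<open>The charges of x missing from \<open>?S\<close> are those whose part lies in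
        K, so omitting them changes x by an element of K.\<close>
      have "x - sum h ?S \<in> ?K"
      proof -
        have "x = (\<Sum>i\<in>asupp x. part {i} x)" by (rule ahat_decomp)
        also have "\<dots> = (\<Sum>\<alpha>\<in>fst ` asupp x. \<Sum>i\<in>{i \<in> asupp x. fst i = \<alpha>}. part {i} x)"
          by (rule sum.image_gen[OF finite_asupp])
        also have "\<dots> = sum h (fst ` asupp x)"
        proof (rule sum.cong[OF refl])
          fix \<alpha>
          have "(\<Sum>i\<in>{i \<in> asupp x. fst i = \<alpha>}. part {i} x) = part {i \<in> asupp x. fst i = \<alpha>} x"
            by (rule part_finite[symmetric]) (simp add: finite_asupp)
          also have "\<dots> = part ({\<alpha>} \<times> UNIV) (part (asupp x) x)"
            unfolding part_part by (rule arg_cong[of _ _ "\<lambda>P. part P x"]) auto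
          also have "\<dots> = h \<alpha>" by (simp add: part_id h_def)
          finally show "(\<Sum>i\<in>{i \<in> asupp x. fst i = \<alpha>}. part {i} x) = h \<alpha>" .
        qed
        finally have "x - sum h ?S = sum h (fst ` asupp x - ?S)"
          using sum_diff[OF finite_imageI[OF finite_asupp] sub, of h] by simp
        also have "\<dots> \<in> ?K" by (rule Krel_sum) (simp add: Fspace_simps Krel_coset_zero_iff)
        finally show ?thesis .
      qed
      moreover have fin: "finite ?S" using sub finite_asupp[of x] finite_subset by blast
      ultimately have "v = finsum ?F (\<lambda>\<alpha>. h \<alpha> +o ?K) ?S"
        by (simp add: finsum_Fspace v Krel_coset_eq_iff)
      moreover have "h \<alpha> +o ?K \<in> Fcharge emb N \<eta> \<alpha>" for \<alpha>
        unfolding Fcharge_eq h_def using asupp_part by blast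
      ultimately show "?dec v (\<lambda>\<alpha>. h \<alpha> +o ?K)" using fin by blast
    next
      fix g assume g: "?dec v g"
      define S where "S = {\<alpha>. g \<alpha> \<noteq> \<zero>\<^bsub>?F\<^esub>}"
      have "\<forall>\<alpha>. \<exists>y. g \<alpha> = y +o ?K \<and> asupp y \<subseteq> {\<alpha>} \<times> UNIV" using g unfolding Fcharge_eq by blast
      then obtain y where y: "\<And>\<alpha>. g \<alpha> = y \<alpha> +o ?K" "\<And>\<alpha>. asupp (y \<alpha>) \<subseteq> {\<alpha>} \<times> UNIV" by metis
      have fin: "finite S" using g by (simp add: S_def)
      have "v = sum y S +o ?K"
        using g finsum_Fspace_cong[OF fin y(1)] by (simp add: S_def)
      then have xy: "x - sum y S \<in> ?K" by (simp add: v Krel_coset_eq_iff)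
      have "h \<alpha> - y \<alpha> \<in> ?K" for \<alpha>
      proof -
        have out: "part ({\<alpha>} \<times> UNIV) (y \<beta>) = (if \<beta> = \<alpha> then y \<beta> else 0)" for \<beta>
          using y(2)[of \<beta>] by (auto intro!: part_id part_eq_0)
        have "part ({\<alpha>} \<times> UNIV) (x - sum y S) = h \<alpha> - (if \<alpha> \<in> S then y \<alpha> else 0)"
          using fin by (simp add: part_diff part_sum out h_def sum.delta)
        then have "h \<alpha> - (if \<alpha> \<in> S then y \<alpha> else 0) \<in> ?K" using Krel_part[OF xy, of "{\<alpha>} \<times> UNIV"] by simp
        \<comment> \<open>Where g is zero, the chosen representative may be nonzero, but it lies in
          K.\<close>
        moreover have "y \<alpha> \<in> ?K" if "\<alpha> \<notin> S"
          using that y(1)[of \<alpha>] by (simp add: S_def Fspace_simps Krel_coset_zero_iff)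
        ultimately show ?thesis using Krel_diff by (cases "\<alpha> \<in> S") fastforce+
      qed
      then show "g = (\<lambda>\<alpha>. h \<alpha> +o ?K)"
        using y(1) Krel_coset_eq_iff by (metis ext)
    qed
  qed
  then show ?thesis
    unfolding graded_vs_def
    by (intro conjI allI ballI field_from_type_algebra module_Fspace submodule_Fcharge)
qed

section \<open>The field property\<close>

lemma Fseries_endo:
  "Fseries emb N \<eta> a e \<in> vs_endos (ring_of_type_algebra :: 'k::field ring)
     (Fspace emb N \<eta> :: ('k, ('b, 'k) ahat set) module)"
proof -
  let ?g = "gen a (- e - 1) :: ('b, 'k) falg"
  have "of_falg ?g * (of_falg (scal c) * x) = of_falg (scal c) * (of_falg ?g * x)" for c x
    by (simp only: mult.assoc[symmetric] gen_commute_scal)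
  then show ?thesis
    by (auto simp: vs_endos_def Fseries_def Fspace_simps Faction_coset[OF gen_acomp] distrib_left)
qed

text \<open>
  A single exponent suffices: all coefficients outside its upward progression vanish, either by the
  charge relations or by the degree bound.
\<close>

lemma Fseries_shifted:
  fixes emb :: "complex \<Rightarrow> 'k::field" and a :: 'b
  assumes emb: "emb 1 = 1" and v: "v \<in> Fcharge emb N \<eta> \<beta>"
  shows "(\<lambda>e. Fseries emb N \<eta> a e v) \<in>
    shifted_series (Fspace emb N \<eta>) (Fcharge emb N \<eta> (bas a + \<beta>)) (uminus ` Delta N (bas a) \<beta>)"
proof -
  let ?F = "Fspace emb N \<eta>"
  interpret abelian_group ?F by (rule abelian_group_Fspace)
  obtain x where x: "v = x +o Krel emb N \<eta>" "asupp x \<subseteq> {\<beta>} \<times> UNIV" using v by (auto simp: Fcharge_eq)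
  have Fs: "Fseries emb N \<eta> a e v = of_falg (gen a (- e - 1)) * x +o Krel emb N \<eta>" for e
    unfolding Fseries_def x(1) by (rule Faction_coset[OF gen_acomp])
  have dec: "of_falg (gen a n) * x = (\<Sum>i\<in>asupp x. of_falg (gen a n) * part {i} x)" for n
    by (subst ahat_decomp) (rule sum_distrib_left)
  have zero: "Fseries emb N \<eta> a e v = \<zero>\<^bsub>?F\<^esub>"
    if "\<And>d. d \<in> snd ` asupp x \<Longrightarrow> of_falg (gen a (- e - 1)) * part {(\<beta>, d)} x \<in> Krel emb N \<eta>" for e
  proof -
    have "of_falg (gen a (- e - 1)) * x \<in> Krel emb N \<eta>"
      unfolding dec
    proof (rule Krel_sum)
      fix i assume i: "i \<in> asupp x"
      then have "i = (\<beta>, snd i)" using x(2) by (cases i) auto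
      then show "of_falg (gen a (- e - 1)) * part {i} x \<in> Krel emb N \<eta>" using that i by (metis imageI)
    qed
    then show ?thesis by (simp add: Fs Fspace_simps Krel_coset_zero_iff)
  qed
  have charge: "Fseries emb N \<eta> a e v \<in> Fcharge emb N \<eta> (bas a + \<beta>)" for e
  proof -
    have "asupp (of_falg (gen a (- e - 1)) * x) \<subseteq> {(bas a, - (- e - 1) - 1)} + {\<beta>} \<times> UNIV"
      by (rule order.trans[OF asupp_times set_plus_mono2[OF _ x(2)]])
        (use of_falg_hcomp[OF gen_acomp[of a "- e - 1"]] in \<open>simp add: hcomp_def\<close>)
    also have "\<dots> \<subseteq> {bas a + \<beta>} \<times> UNIV" by (auto simp: set_plus_def)
    finally show ?thesis unfolding Fs Fcharge_eq by blast
  qed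
  obtain q where q: "\<And>d. Re d < q \<Longrightarrow> hcomp (bas a + \<beta>, d) \<subseteq> Krel emb N \<eta>"
    using degree_bound[where emb = emb, OF emb] by blast
  define b where "b = biext N (bas a) \<beta>"
  \<comment> \<open>The mode a(-e-1) raises degrees by e, and R bounds the real parts of the degrees
    of x. The choice of M gives Re (e + d) < q for all these degrees d as soon as Re e < Re
    e0.\<close>
  define R where "R = (\<Sum>d\<in>snd ` asupp x. \<bar>Re d\<bar>)"
  define M where "M = nat \<lceil>R - q - Re b + 1\<rceil>"
  define e0 where "e0 = - b - of_nat M"
  have low: "Fseries emb N \<eta> a e v = \<zero>\<^bsub>?F\<^esub>" if e: "Re e < Re e0" for e
  proof (rule zero)
    fix d assume d: "d \<in> snd ` asupp x"
    have "\<bar>Re d\<bar> \<le> R" unfolding R_def by (rule member_le_sum) (use d finite_asupp[of x] in auto)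
    moreover have "R - q - Re b + 1 \<le> real M" unfolding M_def by linarith
    ultimately have "Re (e + d) < q" using e by (simp add: e0_def)
    moreover have "of_falg (gen a (- e - 1)) * part {(\<beta>, d)} x \<in> hcomp (bas a + \<beta>, e + d)"
      using mult_hcomp[OF of_falg_hcomp[OF gen_acomp[of a "- e - 1"]] part_hcomp[of "(\<beta>, d)" x]] by simp
    ultimately show "of_falg (gen a (- e - 1)) * part {(\<beta>, d)} x \<in> Krel emb N \<eta>" using q by blast
  qed
  \<comment> \<open>The exponent e belongs to the mode n = -e - 1. The integers absorb the 1, so n
    lies in the coset of b exactly if e + b is an integer.\<close>
  have off: "Fseries emb N \<eta> a e v = \<zero>\<^bsub>?F\<^esub>" if e: "e + b \<notin> \<int>" for e
  proof (rule zero, rule gen_mult_Krel[OF _ part_hcomp])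
    show "- e - 1 \<notin> biext N (bas a) \<beta> +o \<int>"
    proof
      assume "- e - 1 \<in> biext N (bas a) \<beta> +o \<int>"
      then obtain k where k: "k \<in> \<int>" "- e - 1 = b + k" by (auto simp: elt_set_plus_def b_def)
      have "e + b = - (- e - 1) - 1 + b" by simp
      also have "\<dots> = - k - 1" unfolding k(2) by simp
      finally have "e + b = - k - 1" .
      then show False using e k(1) by simp
    qed
  qed
  \<comment> \<open>With a single starting exponent e0 the index set has at most one element, and it
    is empty exactly when e is outside the progression from e0.\<close>
  have sum: "Fseries emb N \<eta> a e v = finsum ?F (\<lambda>(d, j). Fseries emb N \<eta> a (d + of_nat j) v)
      {(d, j). d \<in> {e0} \<and> d + of_nat j = e}" for e
  proof (cases "\<exists>j. e = e0 + of_nat j")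
    case True
    then obtain j where j: "e = e0 + of_nat j" by blast
    then have "{(d, j). d \<in> {e0} \<and> d + of_nat j = e} = {(e0, j)}" by auto
    moreover have "Fseries emb N \<eta> a e v \<in> carrier ?F" by (auto simp: Fs Fspace_simps)
    ultimately show ?thesis by (simp add: j)
  next
    case False
    then have "{(d, j). d \<in> {e0} \<and> d + of_nat j = e} = {}" by auto
    moreover have "Fseries emb N \<eta> a e v = \<zero>\<^bsub>?F\<^esub>"
    proof (cases "e + b \<in> \<int>")
      case True
      then obtain k where k: "e + b = of_int k" by (elim Ints_cases)
      \<comment> \<open>An exponent of the right coset outside the progression is e0 minus a
        positive integer, so the degree bound takes over.\<close>
      have "k < - int M"
      proof (rule ccontr)
        assume "\<not> k < - int M"
        then have "int (nat (k + int M)) = k + int M" by simp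
        then have "(of_nat (nat (k + int M)) :: complex) = of_int k + of_nat M"
          by (metis of_int_add of_int_of_nat_eq)
        then have "e = e0 + of_nat (nat (k + int M))" using k by (simp add: e0_def algebra_simps)
        then show False using False by blast
      qed
      then have "real_of_int k < - real M" by linarith
      moreover have "Re e = real_of_int k - Re b" using arg_cong[OF k, of Re] by simp
      ultimately show ?thesis by (intro low) (simp add: e0_def)
    qed (rule off)
    ultimately show ?thesis by (simp only: finsum_empty)
  qed
  have e0: "e0 \<in> uminus ` Delta N (bas a) \<beta>"
  proof
    show "e0 = - (b + of_nat M)" by (simp add: e0_def)
    show "b + of_nat M \<in> Delta N (bas a) \<beta>" unfolding Delta_def b_def by (intro set_plus_intro2) simp
  qed
  show ?thesis
    unfolding shifted_series_def
  proof (intro CollectI exI conjI)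
    show "finite {e0}" "{e0} \<subseteq> uminus ` Delta N (bas a) \<beta>" using e0 by simp_all
    show "\<forall>d\<in>{e0}. \<forall>j. Fseries emb N \<eta> a (d + of_nat j) v \<in> Fcharge emb N \<eta> (bas a + \<beta>)"
      by (intro ballI allI charge)
    show "\<forall>e. Fseries emb N \<eta> a e v = finsum ?F (\<lambda>(d, j). Fseries emb N \<eta> a (d + of_nat j) v)
      {(d, j). d \<in> {e0} \<and> d + of_nat j = e}" by (rule allI) (rule sum)
  qed
qed

theorem proposition4p1:
  fixes emb :: "complex \<Rightarrow> 'k::field"
    and N :: "'b \<Rightarrow> 'b \<Rightarrow> complex"
    and \<eta> :: "'b charge \<Rightarrow> 'b charge \<Rightarrow> complex"
    and a :: 'b
  assumes emb_add: "\<And>x y. emb (x + y) = emb x + emb y"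
    and emb_mult: "\<And>x y. emb (x * y) = emb x * emb y"
    and emb_one: "emb 1 = 1"
    and N_sym: "\<And>a b. N a b = N b a"
    and eta_nz: "\<And>\<alpha> \<beta>. \<eta> \<alpha> \<beta> \<noteq> 0"
    and eta_left: "\<And>\<alpha> \<beta> \<gamma>. \<eta> (\<alpha> + \<beta>) \<gamma> = \<eta> \<alpha> \<gamma> * \<eta> \<beta> \<gamma>"
    and eta_right: "\<And>\<alpha> \<beta> \<gamma>. \<eta> \<alpha> (\<beta> + \<gamma>) = \<eta> \<alpha> \<beta> * \<eta> \<alpha> \<gamma>"
    and eta_diag: "\<And>\<alpha>. \<eta> \<alpha> \<alpha> = exp (- (of_real pi * \<i> * biext N \<alpha> \<alpha>))"
  shows "is_field_of_charge (ring_of_type_algebra :: 'k ring) (Fspace emb N \<eta>)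
           (Fcharge emb N \<eta>) (Delta N) (bas a) (Fseries emb N \<eta> a)"
  unfolding is_field_of_charge_def
  by (intro conjI allI ballI graded_vs_Fspace Fseries_endo Fseries_shifted emb_one)

end
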